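(* Assume $p\nmid n$, and let $\mathcal H,\mathcal B$ be the quadratic and bilinear maps attached to the canonical involution defining $SL_n$. i) There is a unique lift of Frobenius $\phi_{GL_n}$ on $\widehat{GL_n}$ that is $\mathcal H$-horizontal and $\mathcal B$-symmetric with respect to $\phi_{GL_n,0}$. It is given by $\phi_{GL_n}(x)=\lambda(x)\cdot x^{(p)}$, where $\lambda(x)\in R[x,\det(x)^{-1}]^\wedge$, $\lambda(x)=\left(\frac{\det(x^{(p)})}{(\det(x))^p}\right)^{-1/n}$. ii) $\phi_{GL_n}$ is bicompatible with $N$. iii) $\phi_{GL_n}$ and $\phi_{GL_n,0}$ coincide on the set $SL_n\cap\phi_{GL_n,0}^{-1}(SL_n)$; in particular the root subgroups $U_{\chi_i-\chi_j}$ ($i\ne j$) are $\phi_{GL_n}$-horizontal and the lifts of Frobenius induced by $\phi_{GL_n}$ on $\widehat{\mathbb G_a}=\mathrm{Spf}\,R[z]^\wedge$ are given by $z\mapsto z^p$. iv) The arithmetic logarithmic derivative $l\delta:GL_n\to\mathfrak{gl}_n$ attached to $\phi_{GL_n}$ is given by $$l\delta a=\delta a\cdot(\lambda(a)\cdot a^{(p)})^{-1}+\frac{\lambda(a)^{-1}-1}{p}\cdot 1_n$$ and it satisfies $l\delta(ab)=(\phi(a)\cdot l\delta(b)\cdot\phi(a)^{-1})+_\delta l\delta(a)$ for all $a,b\in GL_n$ with either $a$ or $b$ in $N$. v) The map $\{\ ,\ \}:GL_n\times GL_n\to\mathfrak{gl}_n$ attached to $\phi_{GL_n}$ is given by $\{a,b\}=p^{-1}\left(\frac{\lambda(a)\lambda(b)}{\lambda(ab)}a^{(p)}b^{(p)}((ab)^{(p)})^{-1}-1_n\right)$.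 vi) If $\epsilon=1+p\alpha$, $\alpha\in\mathfrak{gl}_n$, then the equation $l\delta(u)=\alpha$ (with unknown $u\in GL_n$) is equivalent to either of the equations $\delta u=\left(\lambda(u)\cdot\alpha+\frac{\lambda(u)-1}{p}\cdot 1_n\right)\cdot u^{(p)}$ and $\phi(u)=\epsilon\cdot\lambda(u)\cdot u^{(p)}$. vii) Let $\alpha\in L_\delta(SL_n)$, let $\phi^\alpha_{GL_n}$ be the lift of Frobenius on $\widehat{GL_n}$ defined by $\phi^\alpha_{GL_n}(x)=\epsilon\cdot\phi_{GL_n}(x)$, $\epsilon=1+p\alpha$, and let $\delta^\alpha_{GL_n}$ be the $p$-derivation on $\mathcal O(GL_n)^\wedge$ associated to $\phi^\alpha_{GL_n}$. Let $\mathcal H^*(x)=\det(x)\in\mathcal O(GL_n)^\wedge$. Then $\delta^\alpha_{GL_n}(\mathcal H^* )=0$.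
   Context: Fix an odd prime $p$. $R$ is the unique complete discrete valuation ring with maximal ideal $pR$ and residue field an algebraic closure of $\mathbb F_p$; $\phi:R\to R$ is the unique lift of Frobenius, $\delta a=(\phi(a)-a^p)/p$; for a matrix $a$ over $R$, $\phi(a),\delta a,a^{(p)}$ are obtained by applying $\phi$, $\delta$, $p$-th power to the entries. A hat denotes $p$-adic completion. For smooth $X$ over $R$, $X$ also denotes $X(R)$. A lift of Frobenius on $\widehat X$ is a morphism of formal schemes reducing mod $p$ to the $p$-power Frobenius and compatible with $\phi$ on $R$ (for $X$ affine, a ring endomorphism of $\mathcal O(X)^\wedge$); it acts on $R$-points by $P\mapsto\phi_X\circ P\circ\phi^{-1}$. A smooth closed subscheme $Z\subset X$ is $\phi_X$-horizontal if $\phi_X$ maps the ideal of $\widehat Z$ into itself, and then there is an induced lift $\phi_Z$. The $p$-derivation associated to $\phi_X$ is $f\mapsto(\phi_X(f)-f^p)/p$. $GL_n=\mathrm{Spec}\,R[x,\det(x)^{-1}]$, $\phi_{GL_n,0}(x)=x^{(p)}$. Given a lift $\phi_{GL_n}$ with $\Phi(x)=\phi_{GL_n}(x)$, the induced map on points is $a\mapsto\phi^{-1}(\Phi(a))$; the attached arithmetic logarithmic derivative is $l\delta a=\frac1p(\phi(a)\Phi(a)^{-1}-1)$, and $\{a,b\}=p^{-1}(\Phi(a)\Phi(b)\Phi(ab)^{-1}-1)$. $\mathfrak{gl}_n$ denotes $n\times n$ matrices over $R$, with $a+_\delta b=a+b+pab$. $L_\delta(SL_n)=\{\alpha\in\mathfrak{gl}_n:\det(1+p\alpha)=1\}$.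 Fractional powers are principal roots: for $U\equiv1$ mod $p$ and an integer $\nu$ with $p\nmid\nu$, $U^{1/\nu}=\sum_{m\ge0}\binom{1/\nu}{m}p^m\left(\frac{U-1}{p}\right)^m$. $T$ is the diagonal torus and $N$ its normalizer in $GL_n$. $\phi_{GL_n}$ is left (resp. right) compatible with a smooth closed subgroup $H$ if $H$ is $\phi_{GL_n}$-horizontal and $\phi_{GL_n}\circ m=m\circ(\phi_H\times\phi_{GL_n})$ on $\widehat H\times\widehat{GL_n}$ (resp. $\phi_{GL_n}\circ m=m\circ(\phi_{GL_n}\times\phi_H)$ on $\widehat{GL_n}\times\widehat H$), $m$ being multiplication; bicompatible means both. $U_{\chi_i-\chi_j}=\{1+\mu e_{ij}\}\simeq\mathbb G_a=\mathrm{Spec}\,R[z]$ ($e_{ij}$ the elementary matrix, $z\leftrightarrow\mu$). Canonical involution of $SL_n$: $G=GL_n'=\{\mathrm{diag}(x,t)\in GL_{n+1}:x\in GL_n,t\in\mathbb G_m,\det(x)^2=t^n\}$, with étale projection $(x,t)\mapsto x$ to $GL_n$; $(x,t)^\tau=(t^{-1}x,t^{-1})$; $\mathcal H(g)=(g^\tau)^{-1}g$, $\mathcal B(g,h)=(g^\tau)^{-1}h$ on $G$. Lifts of Frobenius on $\widehat{GL_n}$ extend uniquely to $\widehat G$; $\phi_{G,0}$ is the extension of $\phi_{GL_n,0}$. $\phi_{GL_n}$ is $\mathcal H$-horizontal with respect to $\phi_{GL_n,0}$ if its extension $\phi_G$ satisfies $\mathcal H\circ\phi_G=\phi_{G,0}\circ\mathcal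 H$, and $\mathcal B$-symmetric if $\mathcal B\circ(\phi_{G,0}\times\phi_G)=\mathcal B\circ(\phi_G\times\phi_{G,0})$ as maps $\widehat G\to\widehat G$, where $f_1\times f_2$ has components $f_1,f_2$. *)

theory Defs
  imports "HOL-Analysis.Analysis" "HOL-Library.Poly_Mapping"
begin

section \<open>Commutative rings with a distinguished prime\<close>

text \<open>
  The prime \<open>p\<close> is attached to the type of the ring, so that the \<open>p\<close>-adic completion below is
  again a type. The axiom says that \<open>p\<close> is not a unit, so that the completion is not the zero ring.
\<close>

class with_prime = comm_ring_1 +
  fixes base_prime :: "'a itself \<Rightarrow> nat"
  assumes base_prime_not_unit: "\<not> of_nat (base_prime TYPE('a)) dvd (1::'a)"

abbreviation pelt :: "'a::with_prime"
  where "pelt \<equiv> of_nat (base_prime TYPE('a))"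

text \<open>
  The base ring \<open>R\<close>: a complete discrete valuation ring with maximal ideal \<open>pR\<close>, \<open>p\<close> an odd
  prime, whose residue field is algebraically closed and algebraic over the field with \<open>p\<close>
  elements. The two conditions on the residue field are written with monic polynomials whose
  coefficients are lifted to \<open>R\<close>, respectively to the integers. The constant \<open>frob\<close> is the lift
  \<open>\<phi>\<close> of Frobenius on \<open>R\<close>; exactly one map satisfies the last four axioms.
\<close>

class frobenius_dvr = idom + with_prime +
  fixes frob :: "'a \<Rightarrow> 'a"
  assumes base_prime_prime: "prime (base_prime TYPE('a))"
    and base_prime_odd: "odd (base_prime TYPE('a))"
    and pelt_nonzero: "of_nat (base_prime TYPE('a)) \<noteq> (0::'a)"
    and pelt_uniformizer:
      "a \<noteq> 0 \<Longrightarrow> \<exists>u k. u dvd 1 \<and> a = u * of_nat (base_prime TYPE('a)) ^ k"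
    and padically_complete:
      "(\<And>k. of_nat (base_prime TYPE('a)) ^ k dvd s (Suc k) - s k) \<Longrightarrow>
        \<exists>l. \<forall>k. of_nat (base_prime TYPE('a)) ^ k dvd l - s k"
    and residue_field_alg_closed:
      "n > 0 \<Longrightarrow> \<exists>x. of_nat (base_prime TYPE('a)) dvd x ^ n + (\<Sum>k<n. f k * x ^ k)"
    and residue_field_algebraic:
      "\<exists>n (c :: nat \<Rightarrow> int). n > 0 \<and>
         of_nat (base_prime TYPE('a)) dvd a ^ n + (\<Sum>k<n. of_int (c k) * a ^ k)"
    and frob_one: "frob 1 = 1"
    and frob_add: "frob (a + b) = frob a + frob b"
    and frob_mult: "frob (a * b) = frob a * frob b"
    and frob_lift: "of_nat (base_prime TYPE('a)) dvd frob a - a ^ base_prime TYPE('a)"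

definition is_ring_hom :: "('a::comm_ring_1 \<Rightarrow> 'b::comm_ring_1) \<Rightarrow> bool" where
  "is_ring_hom h \<longleftrightarrow> h 1 = 1 \<and> (\<forall>a b. h (a + b) = h a + h b) \<and> (\<forall>a b. h (a * b) = h a * h b)"

definition ring_inv :: "'a::comm_ring_1 \<Rightarrow> 'a" where
  "ring_inv a = (THE b. a * b = 1)"

text \<open>Division by \<open>p\<close>; it is applied to multiples of \<open>p\<close> in rings without \<open>p\<close>-torsion only.\<close>

definition pdiv :: "'a::with_prime \<Rightarrow> 'a" where
  "pdiv a = (THE b. pelt * b = a)"

definition padic_sums :: "(nat \<Rightarrow> 'a::with_prime) \<Rightarrow> 'a \<Rightarrow> bool" where
  "padic_sums f s \<longleftrightarrow> (\<forall>k. \<exists>M. \<forall>m\<ge>M. pelt ^ k dvd s - (\<Sum>i<m. f i))"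

text \<open>The image of a rational number whose denominator is a unit of the ring.\<close>

definition rat_in :: "rat \<Rightarrow> 'a::comm_ring_1" where
  "rat_in r = (case quotient_of r of (a, b) \<Rightarrow> of_int a * ring_inv (of_int b))"

text \<open>The principal root \<open>U\<close> to the power \<open>1/\<nu>\<close>, for \<open>U \<equiv> 1\<close> modulo \<open>p\<close> and \<open>\<nu>\<close> prime to \<open>p\<close>.\<close>

definition principal_root :: "int \<Rightarrow> 'a::with_prime \<Rightarrow> 'a" where
  "principal_root \<nu> U =
     (THE s. padic_sums (\<lambda>m. rat_in ((1 / of_int \<nu>) gchoose m) * pelt ^ m * pdiv (U - 1) ^ m) s)"


section \<open>The \<open>p\<close>-adic completion\<close>

text \<open>
  An element of the inverse limit of the rings \<open>A/p\<^sup>kA\<close> is given by a sequence of representatives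
  \<open>s k\<close> of its components, compatible under reduction; two sequences define the same element if
  they are congruent in each component.
\<close>

definition coherent :: "(nat \<Rightarrow> 'a::with_prime) \<Rightarrow> bool" where
  "coherent s \<longleftrightarrow> (\<forall>k. pelt ^ k dvd s (Suc k) - s k)"

definition padic_rel :: "(nat \<Rightarrow> 'a::with_prime) \<Rightarrow> (nat \<Rightarrow> 'a) \<Rightarrow> bool" where
  "padic_rel s t \<longleftrightarrow> coherent s \<and> coherent t \<and> (\<forall>k. pelt ^ k dvd s k - t k)"

lemma coherent_const: "coherent (\<lambda>_. a)"
  by (simp add: coherent_def)

lemma dvd_diff_add:
  fixes d :: "'a::comm_ring_1"
  assumes "d dvd a - b" "d dvd a' - b'"
  shows "d dvd (a + a') - (b + b')"
  using dvd_add[OF assms] by (simp add: algebra_simps)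

lemma dvd_diff_uminus:
  fixes d :: "'a::comm_ring_1"
  assumes "d dvd a - b"
  shows "d dvd - a - - b"
  using assms by (metis dvd_minus_iff minus_diff_minus)

lemma dvd_diff_minus:
  fixes d :: "'a::comm_ring_1"
  assumes "d dvd a - b" "d dvd a' - b'"
  shows "d dvd (a - a') - (b - b')"
  using dvd_diff_add[OF assms(1) dvd_diff_uminus[OF assms(2)]] by simp

lemma dvd_diff_mult:
  fixes d :: "'a::comm_ring_1"
  assumes "d dvd a - b" "d dvd a' - b'"
  shows "d dvd (a * a') - (b * b')"
proof -
  have "a * a' - b * b' = (a - b) * a' + b * (a' - b')"
    by (simp add: algebra_simps)
  then show ?thesis
    using assms by simp
qed

quotient_type (overloaded) 'a padic = "nat \<Rightarrow> 'a::with_prime" / partial: padic_rel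
proof (rule part_equivpI)
  show "\<exists>s::nat \<Rightarrow> 'a. padic_rel s s"
    by (rule exI[of _ "\<lambda>_. 0"]) (simp add: padic_rel_def coherent_const)
  show "symp (padic_rel :: (nat \<Rightarrow> 'a) \<Rightarrow> _)"
  proof (rule sympI)
    fix s t :: "nat \<Rightarrow> 'a"
    assume st: "padic_rel s t"
    have "pelt ^ k dvd t k - s k" for k
    proof -
      have "pelt ^ k dvd - (s k - t k)"
        using st unfolding padic_rel_def dvd_minus_iff by blast
      then show ?thesis
        by simp
    qed
    then show "padic_rel t s"
      using st by (simp add: padic_rel_def)
  qed
  show "transp (padic_rel :: (nat \<Rightarrow> 'a) \<Rightarrow> _)"
  proof (rule transpI)
    fix r s t :: "nat \<Rightarrow> 'a"
    assume *: "padic_rel r s" "padic_rel s t"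
    have "pelt ^ k dvd r k - t k" for k
    proof -
      have "pelt ^ k dvd (r k - s k) + (s k - t k)"
        using * by (intro dvd_add) (simp_all add: padic_rel_def)
      then show ?thesis
        by simp
    qed
    then show "padic_rel r t"
      using * by (simp add: padic_rel_def)
  qed
qed

lift_definition to_hat :: "'a::with_prime \<Rightarrow> 'a padic" is "\<lambda>a _. a"
  by (simp add: padic_rel_def coherent_const)

instantiation padic :: (with_prime) comm_ring_1
begin

lift_definition zero_padic :: "'a padic" is "\<lambda>_. 0"
  by (simp add: padic_rel_def coherent_const)

lift_definition one_padic :: "'a padic" is "\<lambda>_. 1"
  by (simp add: padic_rel_def coherent_const)

lift_definition plus_padic :: "'a padic \<Rightarrow> 'a padic \<Rightarrow> 'a padic" is "\<lambda>s t k. s k + t k"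
  unfolding padic_rel_def coherent_def by (blast intro: dvd_diff_add)

lift_definition uminus_padic :: "'a padic \<Rightarrow> 'a padic" is "\<lambda>s k. - s k"
  unfolding padic_rel_def coherent_def by (blast intro: dvd_diff_uminus)

lift_definition minus_padic :: "'a padic \<Rightarrow> 'a padic \<Rightarrow> 'a padic" is "\<lambda>s t k. s k - t k"
  unfolding padic_rel_def coherent_def by (blast intro: dvd_diff_minus)

lift_definition times_padic :: "'a padic \<Rightarrow> 'a padic \<Rightarrow> 'a padic" is "\<lambda>s t k. s k * t k"
  unfolding padic_rel_def coherent_def by (blast intro: dvd_diff_mult)

instance
proof
  fix a b c :: "'a padic"
  show "a * b * c = a * (b * c)"
    by transfer (simp add: padic_rel_def coherent_def mult.assoc dvd_diff_mult)
  show "a * b = b * a"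
    by transfer (simp add: padic_rel_def coherent_def mult.commute dvd_diff_mult)
  show "1 * a = a"
    by transfer (simp add: padic_rel_def coherent_def)
  show "a + b + c = a + (b + c)"
    by transfer (simp add: padic_rel_def coherent_def add.assoc dvd_diff_add)
  show "a + b = b + a"
    by transfer (simp add: padic_rel_def coherent_def add.commute dvd_diff_add)
  show "0 + a = a"
    by transfer (simp add: padic_rel_def coherent_def)
  show "- a + a = 0"
    by transfer (simp add: padic_rel_def coherent_def)
  show "a - b = a + - b"
    by transfer (simp add: padic_rel_def coherent_def dvd_diff_minus)
  show "(a + b) * c = a * c + b * c"
    by transfer (simp add: padic_rel_def coherent_def distrib_right dvd_diff_mult dvd_diff_add)
  show "(0 :: 'a padic) \<noteq> 1"
  proof
    assume "(0 :: 'a padic) = 1"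
    then have "padic_rel (\<lambda>_. 0 :: 'a) (\<lambda>_. 1)"
      by transfer
    then have "pelt ^ 1 dvd (0 - 1 :: 'a)"
      unfolding padic_rel_def by blast
    then show False
      using base_prime_not_unit[where 'a = 'a] by simp
  qed
qed

end

lemma of_nat_padic: "(of_nat m :: 'a::with_prime padic) = to_hat (of_nat m)"
proof (induction m)
  case 0
  show ?case
    unfolding of_nat_0 by transfer (simp add: padic_rel_def coherent_const)
next
  case (Suc m)
  show ?case
    unfolding of_nat_Suc Suc.IH by transfer (simp add: padic_rel_def coherent_const)
qed

instantiation padic :: (with_prime) with_prime
begin

definition base_prime_padic :: "'a padic itself \<Rightarrow> nat" where
  "base_prime_padic _ = base_prime TYPE('a)"

instance
proof
  show "\<not> of_nat (base_prime TYPE('a padic)) dvd (1 :: 'a padic)"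
  proof
    assume "of_nat (base_prime TYPE('a padic)) dvd (1 :: 'a padic)"
    then obtain b :: "'a padic" where "1 = to_hat pelt * b"
      unfolding base_prime_padic_def of_nat_padic by (elim dvdE)
    then have "\<exists>s. padic_rel (\<lambda>_. 1 :: 'a) (\<lambda>k. pelt * s k)"
      by transfer blast
    then obtain s where s: "padic_rel (\<lambda>_. 1 :: 'a) (\<lambda>k. pelt * s k)"
      by (elim exE)
    have "pelt ^ 1 dvd (1 :: 'a) - pelt * s 1"
      by (rule s[unfolded padic_rel_def, THEN conjunct2, THEN conjunct2, THEN spec])
    then obtain c where "1 - pelt * s 1 = pelt * c"
      unfolding power_one_right by (elim dvdE)
    then have "(1 :: 'a) = pelt * (c + s 1)"
      by (simp add: algebra_simps)
    then show False
      using base_prime_not_unit[where 'a = 'a] by (metis dvd_triv_left)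
  qed
qed

end


section \<open>Coordinate rings of affine schemes\<close>

text \<open>
  Polynomials in the variables \<open>'v\<close> over \<open>'c\<close> are finitely supported functions from monomials to
  coefficients. \<open>poly_eval \<sigma> a f\<close> substitutes \<open>a v\<close> for the variable \<open>v\<close> and applies \<open>\<sigma>\<close> to the
  coefficients.
\<close>

type_synonym ('v, 'c) mpol = "('v \<Rightarrow>\<^sub>0 nat) \<Rightarrow>\<^sub>0 'c"

definition pvar :: "'v \<Rightarrow> ('v, 'c::comm_ring_1) mpol" where
  "pvar v = Poly_Mapping.single (Poly_Mapping.single v 1) 1"

definition pconst :: "'c::comm_ring_1 \<Rightarrow> ('v, 'c) mpol" where
  "pconst c = Poly_Mapping.single 0 c"

definition mono_eval :: "('v \<Rightarrow> 'b::comm_ring_1) \<Rightarrow> ('v \<Rightarrow>\<^sub>0 nat) \<Rightarrow> 'b" where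
  "mono_eval a m = (\<Prod>v\<in>Poly_Mapping.keys m. a v ^ Poly_Mapping.lookup m v)"

definition poly_eval ::
  "('c::comm_ring_1 \<Rightarrow> 'b::comm_ring_1) \<Rightarrow> ('v \<Rightarrow> 'b) \<Rightarrow> ('v, 'c) mpol \<Rightarrow> 'b" where
  "poly_eval \<sigma> a f =
     (\<Sum>m\<in>Poly_Mapping.keys f. \<sigma> (Poly_Mapping.lookup f m) * mono_eval a m)"

lemma is_ring_hom_0: "is_ring_hom h \<Longrightarrow> h 0 = 0"
  unfolding is_ring_hom_def by (metis add_cancel_right_right)

lemma is_ring_hom_uminus: "is_ring_hom h \<Longrightarrow> h (- a) = - h a"
  using is_ring_hom_0[of h] unfolding is_ring_hom_def
  by (metis add.right_inverse add_eq_0_iff)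

lemma is_ring_hom_diff: "is_ring_hom h \<Longrightarrow> h (a - b) = h a - h b"
  using is_ring_hom_uminus[of h b] unfolding is_ring_hom_def
  by (metis diff_conv_add_uminus)

lemma is_ring_hom_sum: "is_ring_hom h \<Longrightarrow> h (sum f I) = (\<Sum>i\<in>I. h (f i))"
  by (induction I rule: infinite_finite_induct) (auto simp: is_ring_hom_0, auto simp: is_ring_hom_def)

lemma is_ring_hom_prod: "is_ring_hom h \<Longrightarrow> h (prod f I) = (\<Prod>i\<in>I. h (f i))"
  by (induction I rule: infinite_finite_induct) (auto simp: is_ring_hom_def)

lemma is_ring_hom_power: "is_ring_hom h \<Longrightarrow> h (a ^ k) = h a ^ k"
  by (induction k) (auto simp: is_ring_hom_def)

lemma is_ring_hom_of_nat: "is_ring_hom h \<Longrightarrow> h (of_nat k) = of_nat k"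
  by (induction k) (auto simp: is_ring_hom_0, auto simp: is_ring_hom_def)

lemma is_ring_hom_of_int: "is_ring_hom h \<Longrightarrow> h (of_int k) = of_int k"
  by (cases k rule: int_cases2) (auto simp: is_ring_hom_of_nat is_ring_hom_uminus)

lemma is_ring_hom_det:
  assumes "is_ring_hom h"
  shows "h (det A) = det (map_matrix h A)"
  using assms unfolding det_def
  by (simp add: is_ring_hom_sum is_ring_hom_prod is_ring_hom_of_int)
     (simp add: is_ring_hom_def is_ring_hom_prod is_ring_hom_of_int assms)

lemma mono_eval_superset:
  assumes "finite V" "Poly_Mapping.keys m \<subseteq> V"
  shows "mono_eval a m = (\<Prod>v\<in>V. a v ^ Poly_Mapping.lookup m v)"
  unfolding mono_eval_def using assms
  by (intro prod.mono_neutral_left) (auto simp: in_keys_iff)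

lemma mono_eval_0: "mono_eval a 0 = 1"
  by (simp add: mono_eval_def)

lemma mono_eval_add: "mono_eval a (m + m') = mono_eval a m * mono_eval a m'"
proof -
  let ?V = "Poly_Mapping.keys m \<union> Poly_Mapping.keys m'"
  have "mono_eval a (m + m') = (\<Prod>v\<in>?V. a v ^ Poly_Mapping.lookup (m + m') v)"
    by (rule mono_eval_superset) (simp_all add: Poly_Mapping.keys_add)
  also have "\<dots> = mono_eval a m * mono_eval a m'"
    by (simp add: mono_eval_superset[where V = ?V] lookup_add power_add prod.distrib)
  finally show ?thesis .
qed

lemma poly_eval_superset:
  assumes "is_ring_hom \<sigma>" "finite V" "Poly_Mapping.keys f \<subseteq> V"
  shows "poly_eval \<sigma> a f = (\<Sum>m\<in>V. \<sigma> (Poly_Mapping.lookup f m) * mono_eval a m)"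
  unfolding poly_eval_def using assms
  by (intro sum.mono_neutral_left) (auto simp: in_keys_iff is_ring_hom_0)

lemma poly_eval_0: "poly_eval \<sigma> a 0 = 0"
  by (simp add: poly_eval_def)

lemma poly_eval_single:
  assumes "is_ring_hom \<sigma>"
  shows "poly_eval \<sigma> a (Poly_Mapping.single m c) = \<sigma> c * mono_eval a m"
  using assms by (cases "c = 0") (auto simp: poly_eval_def is_ring_hom_0)

lemma poly_eval_add:
  assumes "is_ring_hom \<sigma>"
  shows "poly_eval \<sigma> a (f + g) = poly_eval \<sigma> a f + poly_eval \<sigma> a g"
proof -
  let ?V = "Poly_Mapping.keys f \<union> Poly_Mapping.keys g"
  have "poly_eval \<sigma> a (f + g) = (\<Sum>m\<in>?V. \<sigma> (Poly_Mapping.lookup (f + g) m) * mono_eval a m)"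
    by (rule poly_eval_superset[OF assms]) (simp_all add: Poly_Mapping.keys_add)
  also have "\<dots> = poly_eval \<sigma> a f + poly_eval \<sigma> a g"
    using assms
    by (simp add: poly_eval_superset[where V = ?V] lookup_add sum.distrib distrib_right
        is_ring_hom_def)
  finally show ?thesis .
qed

lemma poly_mapping_single_induct:
  fixes f :: "'a \<Rightarrow>\<^sub>0 'b::ab_group_add"
  assumes "P 0" "\<And>m c f. P f \<Longrightarrow> P (Poly_Mapping.single m c + f)"
  shows "P f"
proof (induction "card (Poly_Mapping.keys f)" arbitrary: f)
  case 0
  then show ?case
    using assms(1) by simp
next
  case (Suc k)
  then obtain m where m: "m \<in> Poly_Mapping.keys f"
    by (metis card.empty equals0I nat.distinct(1))
  let ?g = "f - Poly_Mapping.single m (Poly_Mapping.lookup f m)"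
  have "Poly_Mapping.keys ?g = Poly_Mapping.keys f - {m}"
    by (auto simp: in_keys_iff lookup_minus lookup_single when_def split: if_splits)
  with Suc(2) m have "k = card (Poly_Mapping.keys ?g)"
    by simp
  from assms(2)[OF Suc(1)[OF this], of m "Poly_Mapping.lookup f m"] show ?case
    by simp
qed

lemma poly_eval_mult:
  assumes "is_ring_hom \<sigma>"
  shows "poly_eval \<sigma> a (f * g) = poly_eval \<sigma> a f * poly_eval \<sigma> a g"
proof (induction f rule: poly_mapping_single_induct)
  case 1
  show ?case
    by (simp add: poly_eval_0)
next
  case (2 m c f)
  have "poly_eval \<sigma> a (Poly_Mapping.single m c * g) = \<sigma> c * mono_eval a m * poly_eval \<sigma> a g"
  proof (induction g rule: poly_mapping_single_induct)
    case 1
    show ?case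
      by (simp add: poly_eval_0)
  next
    case (2 m' c' g)
    then show ?case
      using assms
      by (simp add: distrib_left mult_single poly_eval_add poly_eval_single mono_eval_add)
         (simp add: is_ring_hom_def algebra_simps)
  qed
  with 2 show ?case
    using assms by (simp add: distrib_right poly_eval_add poly_eval_single)
qed

lemma is_ring_hom_poly_eval:
  assumes "is_ring_hom \<sigma>"
  shows "is_ring_hom (poly_eval \<sigma> a)"
proof -
  have "poly_eval \<sigma> a (Poly_Mapping.single 0 1) = 1"
    using assms by (simp only: poly_eval_single mono_eval_0) (simp add: is_ring_hom_def)
  then show ?thesis
    unfolding is_ring_hom_def single_one
    by (intro conjI allI poly_eval_add[OF assms] poly_eval_mult[OF assms])
qed

lemma poly_eval_pvar:
  assumes "is_ring_hom \<sigma>"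
  shows "poly_eval \<sigma> a (pvar v) = a v"
  using assms by (simp add: pvar_def poly_eval_single mono_eval_def) (simp add: is_ring_hom_def)

lemma poly_eval_comp:
  assumes "is_ring_hom \<sigma>" "is_ring_hom h"
  shows "h (poly_eval \<sigma> a f) = poly_eval (h \<circ> \<sigma>) (h \<circ> a) f"
  using assms(2) unfolding poly_eval_def mono_eval_def
  by (simp add: is_ring_hom_sum)
     (simp add: is_ring_hom_def flip: is_ring_hom_prod[OF assms(2)] is_ring_hom_power[OF assms(2)])

text \<open>
  All schemes below are obtained by base change from closed subschemes of affine spaces over the
  integers. Such a scheme is represented by a type \<open>'v\<close> of coordinates together with the set of
  its defining equations; the axiom asks for an integral point and only serves to make coordinate
  rings different from \<open>0\<close>.
\<close>

class affine_scheme =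
  fixes eqns :: "('a, int) mpol set"
  assumes integral_point: "\<exists>a. \<forall>e\<in>eqns. poly_eval id a e = 0"

definition gen_ideal :: "'a::comm_ring_1 set \<Rightarrow> 'a set" where
  "gen_ideal S = module.span (*) S"

lemma module_mult: "module ((*) :: 'a::comm_ring_1 \<Rightarrow> 'a \<Rightarrow> 'a)"
  by unfold_locales (simp_all add: algebra_simps)

definition scheme_ideal :: "('v::affine_scheme, 'r::comm_ring_1) mpol set" where
  "scheme_ideal = gen_ideal (poly_eval (\<lambda>k. pconst (of_int k)) pvar ` eqns)"

lemma scheme_ideal_0: "0 \<in> scheme_ideal"
  and scheme_ideal_add: "f \<in> scheme_ideal \<Longrightarrow> g \<in> scheme_ideal \<Longrightarrow> f + g \<in> scheme_ideal"
  and scheme_ideal_diff: "f \<in> scheme_ideal \<Longrightarrow> g \<in> scheme_ideal \<Longrightarrow> f - g \<in> scheme_ideal"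
  and scheme_ideal_uminus: "f \<in> scheme_ideal \<Longrightarrow> - f \<in> scheme_ideal"
  and scheme_ideal_mult: "f \<in> scheme_ideal \<Longrightarrow> h * f \<in> scheme_ideal"
  unfolding scheme_ideal_def gen_ideal_def
  by (simp_all add: module.span_zero[OF module_mult] module.span_add[OF module_mult]
      module.span_diff[OF module_mult] module.span_neg[OF module_mult]
      module.span_scale[OF module_mult])

lemma is_ring_hom_pconst: "is_ring_hom (\<lambda>k. pconst (of_int k))"
  by (simp add: is_ring_hom_def pconst_def single_add mult_single)

lemma scheme_ideal_vanishes:
  obtains a :: "'v::affine_scheme \<Rightarrow> 'r::comm_ring_1"
  where "\<And>f. f \<in> scheme_ideal \<Longrightarrow> poly_eval id a f = 0"
proof -
  obtain a :: "'v \<Rightarrow> int" where a: "\<And>e. e \<in> eqns \<Longrightarrow> poly_eval id a e = 0"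
    using integral_point by blast
  have id: "is_ring_hom (id :: 'r \<Rightarrow> 'r)"
    by (simp add: is_ring_hom_def)
  define b where "b = (\<lambda>v. of_int (a v) :: 'r)"
  have gen: "poly_eval id b g = 0"
    if g: "g \<in> poly_eval (\<lambda>k. pconst (of_int k)) pvar ` eqns" for g
  proof -
    obtain e where e: "e \<in> eqns" "g = poly_eval (\<lambda>k. pconst (of_int k)) pvar e"
      using g by blast
    have 1: "poly_eval id b \<circ> (\<lambda>k. pconst (of_int k)) = (of_int \<circ> id)"
      by (simp add: fun_eq_iff pconst_def poly_eval_single[OF id] mono_eval_0 del: single_of_int)
    have 2: "poly_eval id b \<circ> pvar = of_int \<circ> a"
      by (simp add: fun_eq_iff poly_eval_pvar[OF id] b_def)
    have "poly_eval id b g = poly_eval (of_int \<circ> id) (of_int \<circ> a) e"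
      unfolding e(2)
      by (subst poly_eval_comp[OF is_ring_hom_pconst is_ring_hom_poly_eval[OF id]]) (simp only: 1 2)
    also have "\<dots> = of_int (poly_eval id a e)"
      by (rule poly_eval_comp[symmetric]) (simp_all add: is_ring_hom_def)
    finally show ?thesis
      using a e(1) by simp
  qed
  have "poly_eval id b f = 0" if "f \<in> scheme_ideal" for f
    using that unfolding scheme_ideal_def gen_ideal_def
  proof (induction rule: module.span_induct_alt[OF module_mult, consumes 1])
    case 1
    show ?case
      by (simp add: poly_eval_0)
  next
    case (2 c x y)
    have "poly_eval id b (c * x + y) = poly_eval id b c * poly_eval id b x + poly_eval id b y"
      by (simp only: poly_eval_add[OF id] poly_eval_mult[OF id])
    then show ?case
      using gen[OF 2(1)] 2(2) by (simp add: id_def)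
  qed
  then show ?thesis
    using that by blast
qed

text \<open>\<open>('v, 'r) coord\<close> is the ring of functions on the scheme \<open>'v\<close> over \<open>'r\<close>.\<close>

definition coord_rel :: "('v::affine_scheme, 'r::comm_ring_1) mpol \<Rightarrow> ('v, 'r) mpol \<Rightarrow> bool" where
  "coord_rel f g \<longleftrightarrow> f - g \<in> scheme_ideal"

quotient_type (overloaded) ('v, 'r) coord = "('v::affine_scheme, 'r::comm_ring_1) mpol" / coord_rel
proof (rule equivpI)
  show "reflp (coord_rel :: ('v, 'r) mpol \<Rightarrow> _)"
    by (rule reflpI) (simp add: coord_rel_def scheme_ideal_0)
  show "symp (coord_rel :: ('v, 'r) mpol \<Rightarrow> _)"
  proof (rule sympI)
    fix f g :: "('v, 'r) mpol"
    assume "coord_rel f g"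
    then show "coord_rel g f"
      unfolding coord_rel_def using scheme_ideal_uminus by fastforce
  qed
  show "transp (coord_rel :: ('v, 'r) mpol \<Rightarrow> _)"
  proof (rule transpI)
    fix f g h :: "('v, 'r) mpol"
    assume "coord_rel f g" "coord_rel g h"
    then show "coord_rel f h"
      unfolding coord_rel_def using scheme_ideal_add by fastforce
  qed
qed

instantiation coord :: (affine_scheme, comm_ring_1) comm_ring_1
begin

lift_definition zero_coord :: "('a, 'b) coord" is 0 .

lift_definition one_coord :: "('a, 'b) coord" is 1 .

lift_definition plus_coord :: "('a, 'b) coord \<Rightarrow> ('a, 'b) coord \<Rightarrow> ('a, 'b) coord" is "(+)"
proof -
  fix f g f' g' :: "('a, 'b) mpol"
  assume "coord_rel f g" "coord_rel f' g'"
  then show "coord_rel (f + f') (g + g')"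
    unfolding coord_rel_def using scheme_ideal_add[of "f - g" "f' - g'"]
    by (simp add: algebra_simps)
qed

lift_definition uminus_coord :: "('a, 'b) coord \<Rightarrow> ('a, 'b) coord" is uminus
proof -
  fix f g :: "('a, 'b) mpol"
  assume "coord_rel f g"
  then show "coord_rel (- f) (- g)"
    unfolding coord_rel_def using scheme_ideal_uminus[of "f - g"] by simp
qed

lift_definition minus_coord :: "('a, 'b) coord \<Rightarrow> ('a, 'b) coord \<Rightarrow> ('a, 'b) coord" is "(-)"
proof -
  fix f g f' g' :: "('a, 'b) mpol"
  assume "coord_rel f g" "coord_rel f' g'"
  then show "coord_rel (f - f') (g - g')"
    unfolding coord_rel_def using scheme_ideal_diff[of "f - g" "f' - g'"]
    by (simp add: algebra_simps)
qed

lift_definition times_coord :: "('a, 'b) coord \<Rightarrow> ('a, 'b) coord \<Rightarrow> ('a, 'b) coord" is "(*)"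
proof -
  fix f g f' g' :: "('a, 'b) mpol"
  assume "coord_rel f g" "coord_rel f' g'"
  moreover have "f * f' - g * g' = f' * (f - g) + g * (f' - g')"
    by (simp add: algebra_simps)
  ultimately show "coord_rel (f * f') (g * g')"
    unfolding coord_rel_def by (simp add: scheme_ideal_add scheme_ideal_mult)
qed

instance
proof
  fix a b c :: "('a, 'b) coord"
  show "a * b * c = a * (b * c)"
    by transfer (simp add: coord_rel_def mult.assoc scheme_ideal_0)
  show "a * b = b * a"
    by transfer (simp add: coord_rel_def mult.commute scheme_ideal_0)
  show "1 * a = a"
    by transfer (simp add: coord_rel_def scheme_ideal_0)
  show "a + b + c = a + (b + c)"
    by transfer (simp add: coord_rel_def add.assoc scheme_ideal_0)
  show "a + b = b + a"
    by transfer (simp add: coord_rel_def add.commute scheme_ideal_0)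
  show "0 + a = a"
    by transfer (simp add: coord_rel_def scheme_ideal_0)
  show "- a + a = 0"
    by transfer (simp add: coord_rel_def scheme_ideal_0)
  show "a - b = a + - b"
    by transfer (simp add: coord_rel_def scheme_ideal_0)
  show "(a + b) * c = a * c + b * c"
    by transfer (simp add: coord_rel_def distrib_right scheme_ideal_0)
  show "(0 :: ('a, 'b) coord) \<noteq> 1"
  proof
    assume "(0 :: ('a, 'b) coord) = 1"
    then have *: "(0 - 1 :: ('a, 'b) mpol) \<in> scheme_ideal"
      by transfer (simp add: coord_rel_def)
    obtain x :: "'a \<Rightarrow> 'b" where "\<And>f. f \<in> scheme_ideal \<Longrightarrow> poly_eval id x f = 0"
      using scheme_ideal_vanishes by blast
    from this[OF *] have "poly_eval id x (0 - 1) = 0" .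
    moreover have hom: "is_ring_hom (poly_eval id x)"
      by (rule is_ring_hom_poly_eval) (simp add: is_ring_hom_def)
    moreover have "poly_eval id x (0 - 1) = 0 - 1"
      using hom is_ring_hom_diff[OF hom] is_ring_hom_0[OF hom]
      by (simp only: is_ring_hom_def)
    ultimately show False
      by simp
  qed
qed

end

lift_definition coord_const :: "'r::comm_ring_1 \<Rightarrow> ('v::affine_scheme, 'r) coord" is pconst .

lift_definition coord_var :: "'v \<Rightarrow> ('v::affine_scheme, 'r::comm_ring_1) coord" is pvar .

instantiation coord :: (affine_scheme, with_prime) with_prime
begin

definition base_prime_coord :: "('a, 'b) coord itself \<Rightarrow> nat" where
  "base_prime_coord _ = base_prime TYPE('b)"

lemma of_nat_coord: "(of_nat m :: ('a, 'b) coord) = abs_coord (of_nat m)"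
  by (induction m) (simp_all add: zero_coord_def one_coord_def plus_coord.abs_eq)

instance
proof
  show "\<not> of_nat (base_prime TYPE(('a, 'b) coord)) dvd (1 :: ('a, 'b) coord)"
  proof
    assume "of_nat (base_prime TYPE(('a, 'b) coord)) dvd (1 :: ('a, 'b) coord)"
    then obtain b :: "('a, 'b) coord" where b: "1 = of_nat (base_prime TYPE('b)) * b"
      unfolding base_prime_coord_def by (elim dvdE)
    obtain g where "b = abs_coord g"
      by (rule that[OF Quotient3_abs_rep[OF Quotient3_coord, symmetric]])
    with b have "abs_coord 1 = abs_coord (of_nat (base_prime TYPE('b)) * g)"
      by (simp add: of_nat_coord one_coord_def times_coord.abs_eq)
    then have *: "(1 :: ('a, 'b) mpol) - of_nat (base_prime TYPE('b)) * g \<in> scheme_ideal"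
      by (simp add: coord.abs_eq_iff coord_rel_def)
    obtain x :: "'a \<Rightarrow> 'b" where "\<And>f. f \<in> scheme_ideal \<Longrightarrow> poly_eval id x f = 0"
      using scheme_ideal_vanishes by blast
    from this[OF *] have "poly_eval id x (1 - of_nat (base_prime TYPE('b)) * g) = 0" .
    moreover have hom: "is_ring_hom (poly_eval id x)"
      by (rule is_ring_hom_poly_eval) (simp add: is_ring_hom_def)
    moreover have "poly_eval id x (1 - of_nat m * g) = 1 - of_nat m * poly_eval id x g" for m
      using hom is_ring_hom_diff[OF hom] is_ring_hom_of_nat[OF hom]
      by (simp only: is_ring_hom_def)
    ultimately have "(1 :: 'b) - pelt * poly_eval id x g = 0"
      by simp
    then have "(1 :: 'b) = pelt * poly_eval id x g"
      by simp
    then show False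
      using base_prime_not_unit[where 'a = 'b] by (metis dvd_triv_left)
  qed
qed

end

text \<open>The product of two schemes: disjoint union of coordinates and of equations.\<close>

instantiation sum :: (affine_scheme, affine_scheme) affine_scheme
begin

definition eqns_sum :: "('a + 'b, int) mpol set" where
  "eqns_sum = poly_eval pconst (pvar \<circ> Inl) ` eqns \<union> poly_eval pconst (pvar \<circ> Inr) ` eqns"

instance
proof
  obtain a :: "'a \<Rightarrow> int" where a: "\<And>e. e \<in> eqns \<Longrightarrow> poly_eval id a e = 0"
    using integral_point by blast
  obtain b :: "'b \<Rightarrow> int" where b: "\<And>e. e \<in> eqns \<Longrightarrow> poly_eval id b e = 0"
    using integral_point by blast
  have id: "is_ring_hom (id :: int \<Rightarrow> int)" and c: "is_ring_hom (pconst :: int \<Rightarrow> ('a + 'b, int) mpol)"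
    by (simp_all add: is_ring_hom_def pconst_def single_add mult_single)
  have 1: "poly_eval id (case_sum a b) \<circ> pconst = id"
    by (simp add: fun_eq_iff pconst_def poly_eval_single[OF id] mono_eval_0 del: single_of_int)
  have 2: "poly_eval id (case_sum a b) \<circ> (pvar \<circ> Inl) = a"
    "poly_eval id (case_sum a b) \<circ> (pvar \<circ> Inr) = b"
    by (simp_all add: fun_eq_iff poly_eval_pvar[OF id])
  have "\<forall>e\<in>eqns. poly_eval id (case_sum a b) e = 0"
    unfolding eqns_sum_def
    by (auto simp: poly_eval_comp[OF c is_ring_hom_poly_eval[OF id]] 1 2 a b)
  then show "\<exists>a. \<forall>e\<in>(eqns :: ('a + 'b, int) mpol set). poly_eval id a e = 0"
    by blast
qed

end

text \<open>The additive group, with one coordinate and no equation.\<close>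

instantiation unit :: affine_scheme
begin

definition eqns_unit :: "(unit, int) mpol set" where
  "eqns_unit = {}"

instance
  by standard (simp add: eqns_unit_def)

end

text \<open>The general linear group: a matrix and the inverse of its determinant.\<close>

datatype 'n gl_var = Entry 'n 'n | DetInv

instantiation gl_var :: (finite) affine_scheme
begin

definition eqns_gl_var :: "('a gl_var, int) mpol set" where
  "eqns_gl_var = {det (\<chi> i j. pvar (Entry i j) :: ('a gl_var, int) mpol ^ 'a ^ 'a) * pvar DetInv - 1}"

instance
proof
  define a :: "'a gl_var \<Rightarrow> int"
    where "a = case_gl_var (\<lambda>i j. if i = j then 1 else 0) 1"
  have id: "is_ring_hom (id :: int \<Rightarrow> int)"
    by (simp add: is_ring_hom_def)
  note hom = is_ring_hom_poly_eval[OF id, of a]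
  have mult: "poly_eval id a (f * g) = poly_eval id a f * poly_eval id a g"
    and one: "poly_eval id a 1 = 1" for f g
    using hom by (simp_all add: is_ring_hom_def)
  have "map_matrix (poly_eval id a) (\<chi> i j. pvar (Entry i j) :: ('a gl_var, int) mpol ^ 'a ^ 'a) = mat 1"
    by (simp add: vec_eq_iff mat_def poly_eval_pvar[OF id] a_def)
  then have "\<forall>e\<in>eqns. poly_eval id a e = 0"
    unfolding eqns_gl_var_def
    by (simp add: is_ring_hom_diff[OF hom] mult one is_ring_hom_det[OF hom] poly_eval_pvar[OF id])
       (simp add: a_def)
  then show "\<exists>a. \<forall>e\<in>(eqns :: ('a gl_var, int) mpol set). poly_eval id a e = 0"
    by blast
qed

end

text \<open>
  The group \<open>G = GL\<^sub>n'\<close>: the block matrices with blocks \<open>x\<close> and \<open>t\<close>, both invertible, satisfying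
  \<open>det(x)\<^sup>2 = t\<^sup>n\<close>.
\<close>

datatype 'n g_var = GEntry 'n 'n | GDetInv | GScal | GScalInv

instantiation g_var :: (finite) affine_scheme
begin

definition eqns_g_var :: "('a g_var, int) mpol set" where
  "eqns_g_var =
    (let d = det (\<chi> i j. pvar (GEntry i j) :: ('a g_var, int) mpol ^ 'a ^ 'a) in
     {d * pvar GDetInv - 1, pvar GScal * pvar GScalInv - 1, d\<^sup>2 - pvar GScal ^ CARD('a)})"

instance
proof
  define a :: "'a g_var \<Rightarrow> int"
    where "a = case_g_var (\<lambda>i j. if i = j then 1 else 0) 1 1 1"
  have id: "is_ring_hom (id :: int \<Rightarrow> int)"
    by (simp add: is_ring_hom_def)
  note hom = is_ring_hom_poly_eval[OF id, of a]
  have mult: "poly_eval id a (f * g) = poly_eval id a f * poly_eval id a g"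
    and one: "poly_eval id a 1 = 1" for f g
    using hom by (simp_all add: is_ring_hom_def)
  have "map_matrix (poly_eval id a) (\<chi> i j. pvar (GEntry i j) :: ('a g_var, int) mpol ^ 'a ^ 'a) = mat 1"
    by (simp add: vec_eq_iff mat_def poly_eval_pvar[OF id] a_def)
  then have "\<forall>e\<in>eqns. poly_eval id a e = 0"
    unfolding eqns_g_var_def Let_def
    by (simp add: is_ring_hom_diff[OF hom] mult one is_ring_hom_det[OF hom]
        is_ring_hom_power[OF hom] poly_eval_pvar[OF id])
       (simp add: a_def)
  then show "\<exists>a. \<forall>e\<in>(eqns :: ('a g_var, int) mpol set). poly_eval id a e = 0"
    by blast
qed

end


section \<open>Affine formal schemes, their points, and lifts of Frobenius\<close>

text \<open>\<open>('v, 'r) hat_ring\<close> is the \<open>p\<close>-adically completed ring of functions on the scheme \<open>'v\<close>.\<close>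

type_synonym ('v, 'r) hat_ring = "('v, 'r) coord padic"

definition cst :: "'r::with_prime \<Rightarrow> ('v::affine_scheme, 'r) hat_ring" where
  "cst c = to_hat (coord_const c)"

definition crd :: "'v::affine_scheme \<Rightarrow> ('v, 'r::with_prime) hat_ring" where
  "crd v = to_hat (coord_var v)"

text \<open>
  The ring homomorphism that restricts to \<open>\<sigma>\<close> on \<open>R\<close> and sends the coordinates to \<open>b\<close>. In a
  \<open>p\<close>-adically complete ring it exists, uniquely, as soon as \<open>\<sigma>\<close> is a ring homomorphism and \<open>b\<close>
  solves the defining equations.
\<close>

definition subst_hom ::
  "('r \<Rightarrow> 'b) \<Rightarrow> ('v \<Rightarrow> 'b) \<Rightarrow> ('v::affine_scheme, 'r::with_prime) hat_ring \<Rightarrow> 'b::with_prime"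
  where
  "subst_hom \<sigma> b = (THE h. is_ring_hom h \<and> (\<forall>c. h (cst c) = \<sigma> c) \<and> (\<forall>v. h (crd v) = b v))"

text \<open>An \<open>R\<close>-point, given by its coordinates, as a homomorphism to \<open>R\<close>.\<close>

definition point :: "('v \<Rightarrow> 'r) \<Rightarrow> ('v::affine_scheme, 'r::with_prime) hat_ring \<Rightarrow> 'r" where
  "point a = subst_hom id a"

definition frobenius_lift ::
  "(('v::affine_scheme, 'r::frobenius_dvr) hat_ring \<Rightarrow> ('v, 'r) hat_ring) \<Rightarrow> bool" where
  "frobenius_lift \<phi> \<longleftrightarrow> is_ring_hom \<phi> \<and> (\<forall>c. \<phi> (cst c) = cst (frob c)) \<and>
     (\<forall>f. pelt dvd \<phi> f - f ^ base_prime TYPE('r))"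

definition p_derivation ::
  "(('v::affine_scheme, 'r::frobenius_dvr) hat_ring \<Rightarrow> ('v, 'r) hat_ring) \<Rightarrow>
    ('v, 'r) hat_ring \<Rightarrow> ('v, 'r) hat_ring" where
  "p_derivation \<phi> f = pdiv (\<phi> f - f ^ base_prime TYPE('r))"

text \<open>The comorphisms of the two projections of a product, and of a morphism with components \<open>f\<close>, \<open>g\<close>.\<close>

definition proj1 ::
  "('v::affine_scheme, 'r::with_prime) hat_ring \<Rightarrow> ('v + 'w::affine_scheme, 'r) hat_ring" where
  "proj1 = subst_hom cst (\<lambda>v. crd (Inl v))"

definition proj2 ::
  "('w::affine_scheme, 'r::with_prime) hat_ring \<Rightarrow> ('v::affine_scheme + 'w, 'r) hat_ring" where
  "proj2 = subst_hom cst (\<lambda>v. crd (Inr v))"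

definition pairing ::
  "(('v, 'r) hat_ring \<Rightarrow> 'b) \<Rightarrow> (('w, 'r) hat_ring \<Rightarrow> 'b) \<Rightarrow>
    ('v::affine_scheme + 'w::affine_scheme, 'r::with_prime) hat_ring \<Rightarrow> 'b::with_prime" where
  "pairing f g = (THE h. is_ring_hom h \<and> h \<circ> proj1 = f \<and> h \<circ> proj2 = g)"

text \<open>
  A smooth closed subscheme \<open>Z\<close> is given by the set of its \<open>R\<close>-points. As \<open>R\<close> is henselian with
  algebraically closed residue field, these are dense in \<open>Z\<close>, and the ideal of \<open>Z\<close> consists of
  the functions vanishing at them. The ideal of the completion of \<open>Z\<close> is the kernel of the
  induced map of completions \<open>O(X)^ \<rightarrow> (O(X)/I)^\<close>.
\<close>

definition ideal_of :: "('v \<Rightarrow> 'r) set \<Rightarrow> ('v::affine_scheme, 'r::with_prime) coord set" where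
  "ideal_of Z = {f. \<forall>a\<in>Z. point a (to_hat f) = 0}"

definition hat_ideal_of :: "('v \<Rightarrow> 'r) set \<Rightarrow> ('v::affine_scheme, 'r::with_prime) hat_ring set" where
  "hat_ideal_of Z = {F. \<forall>k. \<exists>f\<in>ideal_of Z. pelt ^ k dvd F - to_hat f}"

definition horizontal ::
  "(('v::affine_scheme, 'r::frobenius_dvr) hat_ring \<Rightarrow> ('v, 'r) hat_ring) \<Rightarrow> ('v \<Rightarrow> 'r) set \<Rightarrow> bool"
  where
  "horizontal \<phi> Z \<longleftrightarrow> \<phi> ` hat_ideal_of Z \<subseteq> hat_ideal_of Z"

text \<open>
  \<open>\<psi>\<close> is the lift of Frobenius induced by \<open>\<phi>\<close> along the closed immersion with comorphism \<open>u\<close>.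
\<close>

definition induced_lift ::
  "(('v::affine_scheme, 'r::frobenius_dvr) hat_ring \<Rightarrow> ('w::affine_scheme, 'r) hat_ring) \<Rightarrow>
    (('v, 'r) hat_ring \<Rightarrow> ('v, 'r) hat_ring) \<Rightarrow> (('w, 'r) hat_ring \<Rightarrow> ('w, 'r) hat_ring) \<Rightarrow> bool"
  where
  "induced_lift u \<phi> \<psi> \<longleftrightarrow> frobenius_lift \<psi> \<and> \<psi> \<circ> u = u \<circ> \<phi>"


section \<open>Matrices\<close>

definition smat :: "'a::comm_ring_1 \<Rightarrow> 'a ^ 'n ^ 'm \<Rightarrow> 'a ^ 'n ^ 'm" where
  "smat c A = (\<chi> i j. c * A $ i $ j)"

text \<open>\<open>a\<^sup>(\<^sup>p\<^sup>)\<close>\<close>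

definition ppow_mat :: "'a::with_prime ^ 'n ^ 'm \<Rightarrow> 'a ^ 'n ^ 'm" where
  "ppow_mat A = map_matrix (\<lambda>c. c ^ base_prime TYPE('a)) A"

definition frob_mat :: "'r::frobenius_dvr ^ 'n ^ 'm \<Rightarrow> 'r ^ 'n ^ 'm" where
  "frob_mat A = map_matrix frob A"

definition delta_mat :: "'r::frobenius_dvr ^ 'n ^ 'm \<Rightarrow> 'r ^ 'n ^ 'm" where
  "delta_mat A = map_matrix (\<lambda>c. pdiv (frob c - c ^ base_prime TYPE('r))) A"

definition pdiv_mat :: "'a::with_prime ^ 'n ^ 'm \<Rightarrow> 'a ^ 'n ^ 'm" where
  "pdiv_mat A = map_matrix pdiv A"

definition plus_delta :: "'r::with_prime ^ 'n ^ 'n \<Rightarrow> 'r ^ 'n ^ 'n \<Rightarrow> 'r ^ 'n ^ 'n" where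
  "plus_delta a b = a + b + smat pelt (a ** b)"

definition GL :: "('r::comm_ring_1 ^ 'n ^ 'n) set" where
  "GL = {a. invertible a}"

definition SL :: "('r::comm_ring_1 ^ 'n ^ 'n) set" where
  "SL = {a. det a = 1}"

definition torus :: "('r::comm_ring_1 ^ 'n ^ 'n) set" where
  "torus = {a \<in> GL. \<forall>i j. i \<noteq> j \<longrightarrow> a $ i $ j = 0}"

definition torus_normalizer :: "('r::comm_ring_1 ^ 'n ^ 'n) set" where
  "torus_normalizer = {g \<in> GL. (\<lambda>a. g ** a ** matrix_inv g) ` torus = torus}"

text \<open>\<open>1 + \<mu> e\<^sub>i\<^sub>j\<close>\<close>

definition root_elem :: "'n \<Rightarrow> 'n \<Rightarrow> 'a::comm_ring_1 \<Rightarrow> 'a ^ 'n ^ 'n" where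
  "root_elem i j \<mu> = mat 1 + (\<chi> k l. if k = i \<and> l = j then \<mu> else 0)"

definition L_delta_SL :: "('r::with_prime ^ 'n ^ 'n) set" where
  "L_delta_SL = {\<alpha>. det (mat 1 + smat pelt \<alpha>) = 1}"


section \<open>Lifts of Frobenius on \<open>GL\<^sub>n\<close>\<close>

text \<open>The coordinates of an invertible matrix over any ring, as a point of \<open>GL\<^sub>n\<close>.\<close>

definition gl_coords :: "'b::comm_ring_1 ^ 'n ^ 'n \<Rightarrow> 'n gl_var \<Rightarrow> 'b" where
  "gl_coords A v = (case v of Entry i j \<Rightarrow> A $ i $ j | DetInv \<Rightarrow> ring_inv (det A))"

definition gl_univ :: "('n::finite gl_var, 'r::with_prime) hat_ring ^ 'n ^ 'n" where
  "gl_univ = (\<chi> i j. crd (Entry i j))"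

type_synonym ('n, 'r) gl_endo = "('n gl_var, 'r) hat_ring \<Rightarrow> ('n gl_var, 'r) hat_ring"

definition gl_frob0 :: "('n::finite, 'r::frobenius_dvr) gl_endo" where
  "gl_frob0 = (THE \<phi>. frobenius_lift \<phi> \<and> map_matrix \<phi> gl_univ = ppow_mat gl_univ)"

text \<open>The action \<open>P \<mapsto> \<phi>\<^sub>X \<circ> P \<circ> \<phi>\<^sup>-\<^sup>1\<close> on points, written with comorphisms.\<close>

definition gl_point_map ::
  "('n::finite, 'r::frobenius_dvr) gl_endo \<Rightarrow> 'r ^ 'n ^ 'n \<Rightarrow> 'r ^ 'n ^ 'n" where
  "gl_point_map \<phi> a = map_matrix (inv frob \<circ> point (gl_coords a) \<circ> \<phi>) gl_univ"

text \<open>\<open>\<Phi>(a)\<close>, where \<open>\<Phi>(x) = \<phi>(x)\<close>\<close>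

definition gl_value ::
  "('n::finite, 'r::frobenius_dvr) gl_endo \<Rightarrow> 'r ^ 'n ^ 'n \<Rightarrow> 'r ^ 'n ^ 'n" where
  "gl_value \<phi> a = map_matrix (point (gl_coords a)) (map_matrix \<phi> gl_univ)"

definition log_derivative ::
  "('n::finite, 'r::frobenius_dvr) gl_endo \<Rightarrow> 'r ^ 'n ^ 'n \<Rightarrow> 'r ^ 'n ^ 'n" where
  "log_derivative \<phi> a = pdiv_mat (frob_mat a ** matrix_inv (gl_value \<phi> a) - mat 1)"

definition gl_bracket ::
  "('n::finite, 'r::frobenius_dvr) gl_endo \<Rightarrow> 'r ^ 'n ^ 'n \<Rightarrow> 'r ^ 'n ^ 'n \<Rightarrow> 'r ^ 'n ^ 'n" where
  "gl_bracket \<phi> a b =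
     pdiv_mat (gl_value \<phi> a ** gl_value \<phi> b ** matrix_inv (gl_value \<phi> (a ** b)) - mat 1)"

text \<open>The comorphism of the multiplication of \<open>GL\<^sub>n\<close>.\<close>

definition gl_mult ::
  "('n::finite gl_var, 'r::with_prime) hat_ring \<Rightarrow> ('n gl_var + 'n gl_var, 'r) hat_ring" where
  "gl_mult = subst_hom cst (gl_coords (map_matrix proj1 gl_univ ** map_matrix proj2 gl_univ))"

text \<open>
  The comorphism of \<open>\<phi> \<times> \<phi>\<close> on the completed ring of \<open>GL\<^sub>n \<times> GL\<^sub>n\<close>. Modulo the ideal of
  the completion of \<open>H \<times> GL\<^sub>n\<close> (or \<open>GL\<^sub>n \<times> H\<close>) it is the comorphism of \<open>\<phi>\<^sub>H \<times> \<phi>\<close> (or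
  \<open>\<phi> \<times> \<phi>\<^sub>H\<close>), and equality of morphisms on this closed formal subscheme is congruence of
  comorphisms modulo its ideal.
\<close>

definition gl_square ::
  "('n::finite, 'r::frobenius_dvr) gl_endo \<Rightarrow>
    ('n gl_var + 'n gl_var, 'r) hat_ring \<Rightarrow> ('n gl_var + 'n gl_var, 'r) hat_ring" where
  "gl_square \<phi> = pairing (proj1 \<circ> \<phi>) (proj2 \<circ> \<phi>)"

definition gl_prod ::
  "('r ^ 'n ^ 'n) set \<Rightarrow> ('r ^ 'n ^ 'n) set \<Rightarrow> ('n gl_var + 'n gl_var \<Rightarrow> 'r::comm_ring_1) set" where
  "gl_prod A B = {case_sum (gl_coords a) (gl_coords b) | a b. a \<in> A \<and> b \<in> B}"

definition left_compatible ::
  "('n::finite, 'r::frobenius_dvr) gl_endo \<Rightarrow> ('r ^ 'n ^ 'n) set \<Rightarrow> bool" where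
  "left_compatible \<phi> H \<longleftrightarrow> horizontal \<phi> (gl_coords ` H) \<and>
     (\<forall>f. gl_mult (\<phi> f) - gl_square \<phi> (gl_mult f) \<in> hat_ideal_of (gl_prod H GL))"

definition right_compatible ::
  "('n::finite, 'r::frobenius_dvr) gl_endo \<Rightarrow> ('r ^ 'n ^ 'n) set \<Rightarrow> bool" where
  "right_compatible \<phi> H \<longleftrightarrow> horizontal \<phi> (gl_coords ` H) \<and>
     (\<forall>f. gl_mult (\<phi> f) - gl_square \<phi> (gl_mult f) \<in> hat_ideal_of (gl_prod GL H))"

definition bicompatible ::
  "('n::finite, 'r::frobenius_dvr) gl_endo \<Rightarrow> ('r ^ 'n ^ 'n) set \<Rightarrow> bool" where
  "bicompatible \<phi> H \<longleftrightarrow> left_compatible \<phi> H \<and> right_compatible \<phi> H"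

text \<open>The comorphism of \<open>z \<mapsto> 1 + z e\<^sub>i\<^sub>j\<close>, the embedding of a root subgroup.\<close>

definition root_embedding ::
  "'n \<Rightarrow> 'n \<Rightarrow> ('n::finite gl_var, 'r::with_prime) hat_ring \<Rightarrow> (unit, 'r) hat_ring" where
  "root_embedding i j = subst_hom cst (gl_coords (root_elem i j (crd ())))"


section \<open>The canonical involution\<close>

text \<open>
  Points of \<open>G\<close> with values in a ring are pairs \<open>(x, t)\<close>. The maps are given by the same formulas
  over every ring, and their comorphisms are read off from their values at universal points.
\<close>

type_synonym ('n, 'b) g_point = "('b ^ 'n ^ 'n) \<times> 'b"

definition g_times ::
  "('n::finite, 'b::comm_ring_1) g_point \<Rightarrow> ('n, 'b) g_point \<Rightarrow> ('n, 'b) g_point" where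
  "g_times g h = (fst g ** fst h, snd g * snd h)"

definition g_inverse :: "('n::finite, 'b::comm_ring_1) g_point \<Rightarrow> ('n, 'b) g_point" where
  "g_inverse g = (matrix_inv (fst g), ring_inv (snd g))"

definition g_tau :: "('n::finite, 'b::comm_ring_1) g_point \<Rightarrow> ('n, 'b) g_point" where
  "g_tau g = (smat (ring_inv (snd g)) (fst g), ring_inv (snd g))"

definition g_quadratic :: "('n::finite, 'b::comm_ring_1) g_point \<Rightarrow> ('n, 'b) g_point" where
  "g_quadratic g = g_times (g_inverse (g_tau g)) g"

definition g_bilinear ::
  "('n::finite, 'b::comm_ring_1) g_point \<Rightarrow> ('n, 'b) g_point \<Rightarrow> ('n, 'b) g_point" where
  "g_bilinear g h = g_times (g_inverse (g_tau g)) h"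

definition g_coords :: "('n::finite, 'b::comm_ring_1) g_point \<Rightarrow> 'n g_var \<Rightarrow> 'b" where
  "g_coords g v = (case v of GEntry i j \<Rightarrow> fst g $ i $ j | GDetInv \<Rightarrow> ring_inv (det (fst g))
     | GScal \<Rightarrow> snd g | GScalInv \<Rightarrow> ring_inv (snd g))"

definition g_univ :: "('n::finite, ('n g_var, 'r::with_prime) hat_ring) g_point" where
  "g_univ = (\<chi> i j. crd (GEntry i j), crd GScal)"

definition g_map :: "('a \<Rightarrow> 'b) \<Rightarrow> ('n::finite, 'a) g_point \<Rightarrow> ('n, 'b) g_point" where
  "g_map h g = (map_matrix h (fst g), h (snd g))"

text \<open>The comorphisms of \<open>\<H>\<close>, \<open>\<B>\<close> and of the projection \<open>(x, t) \<mapsto> x\<close>.\<close>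

definition H_comorphism ::
  "('n::finite g_var, 'r::with_prime) hat_ring \<Rightarrow> ('n g_var, 'r) hat_ring" where
  "H_comorphism = subst_hom cst (g_coords (g_quadratic g_univ))"

definition B_comorphism ::
  "('n::finite g_var, 'r::with_prime) hat_ring \<Rightarrow> ('n g_var + 'n g_var, 'r) hat_ring" where
  "B_comorphism = subst_hom cst (g_coords (g_bilinear (g_map proj1 g_univ) (g_map proj2 g_univ)))"

definition g_projection ::
  "('n::finite gl_var, 'r::with_prime) hat_ring \<Rightarrow> ('n g_var, 'r) hat_ring" where
  "g_projection = subst_hom cst (gl_coords (fst g_univ))"

definition g_extension ::
  "('n::finite, 'r::frobenius_dvr) gl_endo \<Rightarrow> ('n g_var, 'r) hat_ring \<Rightarrow> ('n g_var, 'r) hat_ring"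
  where
  "g_extension \<phi> = (THE \<psi>. frobenius_lift \<psi> \<and> \<psi> \<circ> g_projection = g_projection \<circ> \<phi>)"

text \<open>
  The conditions \<open>\<H> \<circ> \<phi>\<^sub>G = \<phi>\<^sub>G\<^sub>,\<^sub>0 \<circ> \<H>\<close> and
  \<open>\<B> \<circ> (\<phi>\<^sub>G\<^sub>,\<^sub>0 \<times> \<phi>\<^sub>G) = \<B> \<circ> (\<phi>\<^sub>G \<times> \<phi>\<^sub>G\<^sub>,\<^sub>0)\<close>. Composition of comorphisms is in the opposite order.
\<close>

definition H_horizontal ::
  "('n::finite, 'r::frobenius_dvr) gl_endo \<Rightarrow> ('n, 'r) gl_endo \<Rightarrow> bool" where
  "H_horizontal \<phi>0 \<phi> \<longleftrightarrow> g_extension \<phi> \<circ> H_comorphism = H_comorphism \<circ> g_extension \<phi>0"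

definition B_symmetric ::
  "('n::finite, 'r::frobenius_dvr) gl_endo \<Rightarrow> ('n, 'r) gl_endo \<Rightarrow> bool" where
  "B_symmetric \<phi>0 \<phi> \<longleftrightarrow>
     pairing (g_extension \<phi>0) (g_extension \<phi>) \<circ> B_comorphism =
     pairing (g_extension \<phi>) (g_extension \<phi>0) \<circ> B_comorphism"

text \<open>\<open>\<lambda>(x)\<close> and its values \<open>\<lambda>(a)\<close>\<close>

definition gl_lambda :: "('n::finite gl_var, 'r::frobenius_dvr) hat_ring" where
  "gl_lambda = principal_root (- int CARD('n))
     (det (ppow_mat gl_univ) * ring_inv (det gl_univ ^ base_prime TYPE('r)))"

definition gl_lambda_at :: "'r::frobenius_dvr ^ 'n::finite ^ 'n \<Rightarrow> 'r" where
  "gl_lambda_at a = point (gl_coords a) gl_lambda"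

end

theory Submission
  imports Defs
begin

text \<open>
  On \<open>G\<close> one has \<open>\<H>(x, t) = (t 1\<^sub>n, t\<^sup>2)\<close> and \<open>\<B>((x, t), (y, s)) = (t x\<^sup>-\<^sup>1 y, t s)\<close>. A lift is therefore
  \<open>\<H>\<close>-horizontal iff its extension sends \<open>t\<close> to \<open>t\<^sup>p\<close>, and \<open>\<B>\<close>-symmetry says that the square of the
  matrix \<open>W = (x\<^sup>(\<^sup>p\<^sup>))\<^sup>-\<^sup>1 \<phi>(x)\<close> is scalar; as \<open>W \<equiv> 1\<close> modulo \<open>p\<close> and \<open>p\<close> is odd, \<open>W\<close> is itself the scalar
  \<open>\<lambda>\<close> with \<open>\<lambda>\<^sup>n det(x\<^sup>(\<^sup>p\<^sup>)) = det(x)\<^sup>p\<close>. All statements about \<open>\<lambda>\<close> follow from one fact: in a \<open>p\<close>-adically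
  complete ring, two \<open>n\<close>-th roots that are units and congruent modulo \<open>p\<close> differ by an element of any
  ideal containing the difference of their \<open>n\<close>-th powers. For instance \<open>(a b)\<^sup>(\<^sup>p\<^sup>) = a\<^sup>(\<^sup>p\<^sup>) b\<^sup>(\<^sup>p\<^sup>)\<close> when one
  factor is monomial, so that \<open>\<lambda>(a b) = \<lambda>(a) \<lambda>(b)\<close>, and \<open>\<lambda> = 1\<close> on \<open>N\<close> and on the root subgroups.
\<close>

section \<open>Complete rings\<close>

text \<open>Nearly every object of the statement is a \<open>THE\<close>, so each formula rests on
  existence and uniqueness; the universal property of completed coordinate rings turns identities of
  morphisms into identities at universal points. Three obstacles shape the rest. The division by p
  inside the series of \<lambda> has a definite meaning only once the completed ring of
  \<open>GL_n\<close> is known to have no p-torsion. Uniqueness in i) is obtained on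
  \<open>G\<close> and descends because functions on \<open>GL_n\<close> embed into functions on
  \<open>G\<close> even after completion. Finally, the ideal of a closed subscheme consists of
  limits of functions before completion that vanish at points, whereas \<lambda> is only given in
  the completion; so points are used to test \<open>det(x^(p)) - det(x)^p\<close> and
  \<open>(x y)^(p) - x^(p) y^(p)\<close>, and uniqueness of roots modulo the ideal carries the
  result over to \<lambda>. The class below contains both the base ring and all completions, so that
  one argument about roots serves values and functions alike.\<close>

class padic_complete = with_prime +
  assumes padic_separated: "(\<And>k. of_nat (base_prime TYPE('a)) ^ k dvd a) \<Longrightarrow> a = 0"
    and padic_limit: "(\<And>k. of_nat (base_prime TYPE('a)) ^ k dvd s (Suc k) - s k) \<Longrightarrow>
      \<exists>l. \<forall>k. of_nat (base_prime TYPE('a)) ^ k dvd l - s k"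

lemma base_prime_padic [simp]: "base_prime TYPE('a::with_prime padic) = base_prime TYPE('a)"
  by (simp add: base_prime_padic_def)

lemma base_prime_coord [simp]:
  "base_prime TYPE(('v::affine_scheme, 'r::with_prime) coord) = base_prime TYPE('r)"
  by (simp add: base_prime_coord_def)

lemma dvd_diff_trans:
  fixes d :: "'a::comm_ring_1"
  assumes "d dvd a - b" "d dvd b - c"
  shows "d dvd a - c"
  using dvd_add[OF assms] by simp

lemma dvd_diff_sym: "d dvd a - b \<Longrightarrow> d dvd b - a" for d :: "'a::comm_ring_1"
  by (metis dvd_minus_iff minus_diff_eq)

lemma dvd_diff_power: "d dvd a - b \<Longrightarrow> d dvd a ^ n - b ^ n" for d :: "'a::comm_ring_1"
  by (induction n) (auto intro: dvd_diff_mult)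

lemma dvd_diff_sum:
  fixes d :: "'a::comm_ring_1"
  shows "(\<And>i. i \<in> I \<Longrightarrow> d dvd f i - g i) \<Longrightarrow> d dvd sum f I - sum g I"
  by (simp add: dvd_sum flip: sum_subtractf)

lemma coherent_le:
  assumes "coherent s" "j \<le> k"
  shows "pelt ^ j dvd s k - s j"
  using assms(2)
proof (induction rule: dec_induct)
  case (step k)
  have "pelt ^ j dvd s (Suc k) - s k"
    using assms(1) step(1) unfolding coherent_def by (meson dvd_trans le_imp_power_dvd)
  with step show ?case
    by (meson dvd_diff_trans)
qed simp

lemma padic_rel_self: "padic_rel s s \<longleftrightarrow> coherent s"
  by (auto simp: padic_rel_def)

lemma is_ring_hom_to_hat: "is_ring_hom (to_hat :: 'a::with_prime \<Rightarrow> 'a padic)"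
  unfolding is_ring_hom_def
  by (intro conjI allI; transfer; simp add: padic_rel_self coherent_const)

text \<open>The kernel of the projection to \<open>A/p^k\<close>. It is meant as a test for
  divisibility by \<open>p^k\<close> in the completion that inspects a single component.\<close>

lift_definition comp_dvd :: "nat \<Rightarrow> 'a::with_prime padic \<Rightarrow> bool" is "\<lambda>k s. pelt ^ k dvd s k"
proof -
  fix k and s t :: "nat \<Rightarrow> 'a"
  assume "padic_rel s t"
  then have "pelt ^ k dvd s k - t k"
    by (auto simp: padic_rel_def)
  then show "pelt ^ k dvd s k \<longleftrightarrow> pelt ^ k dvd t k"
    by (metis dvd_add_right_iff diff_add_cancel)
qed

lemma pelt_power_padic: "(pelt ^ k :: 'a::with_prime padic) = to_hat (pelt ^ k)"
  by (simp add: of_nat_padic is_ring_hom_power[OF is_ring_hom_to_hat])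

text \<open>As p may be a zero divisor, the quotients by \<open>p^k\<close> are not determined; a
  compatible choice is built recursively from the increments of \<open>s\<close>, which are
  divisible by \<open>p^(k+j)\<close>.\<close>

lemma coherent_shift_divide:
  assumes s: "coherent s" and dvd: "pelt ^ k dvd s k"
  shows "\<exists>t. coherent t \<and> (\<forall>j. s (k + j) = pelt ^ k * t j)"
proof -
  obtain t0 where t0: "s k = pelt ^ k * t0"
    using dvd by (elim dvdE)
  have "\<exists>r. s (Suc (k + j)) - s (k + j) = pelt ^ (k + j) * r" for j
    using s unfolding coherent_def dvd_def by blast
  then obtain r where r: "\<And>j. s (Suc (k + j)) - s (k + j) = pelt ^ (k + j) * r j"
    by metis
  define t where "t = rec_nat t0 (\<lambda>j x. x + pelt ^ j * r j)"
  have "s (k + j) = pelt ^ k * t j" for j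
  proof (induction j)
    case 0
    show ?case by (simp add: t_def t0)
  next
    case (Suc j)
    then show ?case
      using r[of j] by (simp add: t_def algebra_simps power_add)
  qed
  moreover have "coherent t"
    by (simp add: coherent_def t_def)
  ultimately show ?thesis
    by blast
qed

text \<open>The kernel of the map to \<open>A/p^k\<close> is generated by \<open>p^k\<close>: the
  terms with index shifted by k are \<open>p^k * t j\<close>, and the shift does not change the
  class of the sequence.\<close>

lemma pelt_power_dvd_iff: "pelt ^ k dvd F \<longleftrightarrow> comp_dvd k F"
proof
  assume "pelt ^ k dvd F"
  then obtain G where G: "F = to_hat (pelt ^ k) * G"
    unfolding pelt_power_padic by (elim dvdE)
  show "comp_dvd k F"
    unfolding G by transfer simp
next
  assume "comp_dvd k F"
  then have "\<exists>G. F = to_hat (pelt ^ k) * G"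
  proof transfer
    fix k and s :: "nat \<Rightarrow> 'a"
    assume "padic_rel s s" and dvd: "pelt ^ k dvd s k"
    then have s: "coherent s"
      by (simp add: padic_rel_self)
    obtain t where t: "coherent t" "\<And>j. s (k + j) = pelt ^ k * t j"
      using coherent_shift_divide[OF s dvd] by blast
    have "pelt ^ j dvd s j - pelt ^ k * t j" for j
      using coherent_le[OF s, of j "k + j"] by (metis dvd_diff_sym le_add2 t(2))
    moreover have "coherent (\<lambda>j. pelt ^ k * t j)"
      using t(1) by (simp add: coherent_def flip: right_diff_distrib)
    ultimately have "padic_rel s (\<lambda>j. pelt ^ k * t j)"
      using s by (simp add: padic_rel_def)
    then show "\<exists>G\<in>{x. padic_rel x x}. padic_rel s (\<lambda>j. pelt ^ k * G j)"
      using t(1) by (auto simp: padic_rel_self)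
  qed
  then show "pelt ^ k dvd F"
    unfolding pelt_power_padic by auto
qed

lemma to_hat_dvd_iff: "pelt ^ k dvd to_hat f \<longleftrightarrow> pelt ^ k dvd f"
  unfolding pelt_power_dvd_iff by transfer simp

lemma to_hat_approx: "\<exists>f. pelt ^ k dvd F - to_hat f"
  unfolding pelt_power_dvd_iff by transfer (metis cancel_comm_monoid_add_class.diff_cancel dvd_0_right)

lemma to_hat_limit: "coherent f \<Longrightarrow> \<exists>F. \<forall>k. pelt ^ k dvd F - to_hat (f k)"
  unfolding pelt_power_dvd_iff by transfer (auto simp: coherent_def padic_rel_def)

instance padic :: (with_prime) padic_complete
proof
  fix F :: "'a padic"
  assume "\<And>k. of_nat (base_prime TYPE('a padic)) ^ k dvd F"
  then have "\<And>k. comp_dvd k F"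
    by (simp add: pelt_power_dvd_iff[unfolded base_prime_padic])
  then show "F = 0"
    by transfer (simp add: padic_rel_def coherent_const)
next
  fix S :: "nat \<Rightarrow> 'a padic"
  assume S: "\<And>k. of_nat (base_prime TYPE('a padic)) ^ k dvd S (Suc k) - S k"
  \<comment> \<open>A diagonal choice: the k-th term is replaced by an element of the uncompleted
    ring modulo \<open>p^k\<close>. These are coherent because \<open>to_hat\<close> reflects
    divisibility by \<open>p^k\<close>.\<close>
  have "\<forall>k. \<exists>f. pelt ^ k dvd S k - to_hat f"
    using to_hat_approx by blast
  then obtain f where f: "\<And>k. pelt ^ k dvd S k - to_hat (f k)"
    by metis
  have "pelt ^ k dvd to_hat (f (Suc k) - f k)" for k
  proof -
    have "pelt ^ k dvd S (Suc k) - to_hat (f (Suc k))"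
      using f[of "Suc k"] by (meson dvd_trans le_imp_power_dvd le_SucI order_refl)
    then have "pelt ^ k dvd to_hat (f (Suc k)) - to_hat (f k)"
      using S[of k] f[of k] by (meson dvd_diff_sym dvd_diff_trans)
    then show ?thesis
      by (simp add: is_ring_hom_diff[OF is_ring_hom_to_hat])
  qed
  then have "coherent f"
    by (simp add: coherent_def to_hat_dvd_iff[unfolded base_prime_padic])
  then obtain F where "\<And>k. pelt ^ k dvd F - to_hat (f k)"
    using to_hat_limit by blast
  then show "\<exists>l. \<forall>k. of_nat (base_prime TYPE('a padic)) ^ k dvd l - S k"
    using f by (meson dvd_diff_sym dvd_diff_trans)
qed

section \<open>The base ring as a complete ring\<close>

lemma frob_hom: "is_ring_hom (frob :: 'r::frobenius_dvr \<Rightarrow> 'r)"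
  by (simp add: is_ring_hom_def frob_one frob_add frob_mult)

lemma pelt_power_Suc_not_dvd:
  fixes u :: "'r::frobenius_dvr"
  assumes "u dvd 1"
  shows "\<not> pelt ^ Suc k dvd u * pelt ^ k"
proof
  assume "pelt ^ Suc k dvd u * pelt ^ k"
  then have "pelt ^ k * pelt dvd pelt ^ k * u"
    by (simp add: mult.commute)
  then have "pelt dvd u"
    using pelt_nonzero by (subst (asm) dvd_mult_cancel_left) auto
  then show False
    using assms base_prime_not_unit dvd_trans by blast
qed

instance frobenius_dvr \<subseteq> padic_complete
proof
  fix a :: 'a
  assume a: "\<And>k. of_nat (base_prime TYPE('a)) ^ k dvd a"
  show "a = 0"
  proof (rule ccontr)
    assume "a \<noteq> 0"
    then obtain u k where "u dvd 1" "a = u * pelt ^ k"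
      using pelt_uniformizer by blast
    then show False
      using a pelt_power_Suc_not_dvd by blast
  qed
qed (rule padically_complete)

section \<open>Units and limits\<close>

lemma dvd_pelt_power_le: "pelt ^ k dvd a \<Longrightarrow> j \<le> k \<Longrightarrow> pelt ^ j dvd a"
  by (meson dvd_trans le_imp_power_dvd)

lemma ring_inv_eqI: "a * b = 1 \<Longrightarrow> ring_inv a = b" for a b :: "'a::comm_ring_1"
  unfolding ring_inv_def
proof (rule the_equality)
  fix c
  assume "a * b = 1" "a * c = 1"
  have "c = (a * b) * c"
    using \<open>a * b = 1\<close> by simp
  also have "\<dots> = (a * c) * b"
    by (simp only: ac_simps)
  finally show "c = b"
    using \<open>a * c = 1\<close> by simp
qed

lemma ring_inv_right: "a dvd 1 \<Longrightarrow> a * ring_inv a = 1" for a :: "'a::comm_ring_1"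
  by (metis dvdE ring_inv_eqI)

lemma ring_inv_left: "a dvd 1 \<Longrightarrow> ring_inv a * a = 1" for a :: "'a::comm_ring_1"
  by (metis ring_inv_right mult.commute)

lemma unit_ring_inv: "a dvd 1 \<Longrightarrow> ring_inv a dvd 1" for a :: "'a::comm_ring_1"
  by (metis ring_inv_left dvd_triv_left)

lemma unit_mult: "a dvd 1 \<Longrightarrow> b dvd 1 \<Longrightarrow> a * b dvd 1" for a :: "'a::comm_ring_1"
  using mult_dvd_mono[of a 1 b 1] by simp

lemma unit_power: "a dvd 1 \<Longrightarrow> a ^ n dvd 1" for a :: "'a::comm_ring_1"
  by (induction n) (auto intro: unit_mult)

lemma ring_inv_power: "a dvd 1 \<Longrightarrow> ring_inv (a ^ n) = ring_inv a ^ n"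
  for a :: "'a::comm_ring_1"
  by (rule ring_inv_eqI) (simp add: ring_inv_right flip: power_mult_distrib)

lemma ring_inv_ring_inv: "a dvd 1 \<Longrightarrow> ring_inv (ring_inv a) = a" for a :: "'a::comm_ring_1"
  by (rule ring_inv_eqI) (simp add: ring_inv_left)

lemma unit_cancel: "u dvd 1 \<Longrightarrow> u * a = u * b \<Longrightarrow> a = b" for u :: "'a::comm_ring_1"
  using ring_inv_left[of u] by (metis mult.assoc mult_1)

lemma is_ring_hom_1: "is_ring_hom h \<Longrightarrow> h 1 = 1"
  and is_ring_hom_add: "is_ring_hom h \<Longrightarrow> h (a + b) = h a + h b"
  and is_ring_hom_mult: "is_ring_hom h \<Longrightarrow> h (a * b) = h a * h b"
  by (simp_all add: is_ring_hom_def)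

lemmas is_ring_hom_simps = is_ring_hom_0 is_ring_hom_1 is_ring_hom_add is_ring_hom_mult is_ring_hom_diff
  is_ring_hom_power is_ring_hom_of_nat is_ring_hom_of_int is_ring_hom_sum is_ring_hom_det

lemma is_ring_hom_id: "is_ring_hom id"
  by (simp add: is_ring_hom_def)

lemma is_ring_hom_comp: "is_ring_hom g \<Longrightarrow> is_ring_hom h \<Longrightarrow> is_ring_hom (g \<circ> h)"
  by (simp add: is_ring_hom_def)

lemma is_ring_hom_dvd: "is_ring_hom h \<Longrightarrow> a dvd b \<Longrightarrow> h a dvd h b"
  by (auto simp: is_ring_hom_mult elim!: dvdE)

lemma is_ring_hom_unit: "is_ring_hom h \<Longrightarrow> a dvd 1 \<Longrightarrow> h a dvd 1"
  using is_ring_hom_dvd[of h a 1] by (simp add: is_ring_hom_1)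

lemma is_ring_hom_ring_inv: "is_ring_hom h \<Longrightarrow> a dvd 1 \<Longrightarrow> h (ring_inv a) = ring_inv (h a)"
  by (rule ring_inv_eqI[symmetric]) (metis is_ring_hom_1 is_ring_hom_mult ring_inv_right)

lemma is_ring_hom_dvd_diff:
  assumes "is_ring_hom h" "of_nat m ^ k dvd a - b"
  shows "of_nat m ^ k dvd h a - h b"
  using is_ring_hom_dvd[OF assms]
  by (simp add: is_ring_hom_simps[OF assms(1)])

lemma padic_eqI: "(\<And>k. pelt ^ k dvd a - b) \<Longrightarrow> a = b" for a b :: "'b::padic_complete"
  using padic_separated[of "a - b"] by simp

lemma padic_sums_unique:
  fixes s t :: "'b::padic_complete"
  assumes "padic_sums f s" "padic_sums f t"
  shows "s = t"
proof (rule padic_eqI)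
  fix k
  obtain M where "\<forall>m\<ge>M. pelt ^ k dvd s - (\<Sum>i<m. f i)"
    using assms(1) unfolding padic_sums_def by blast
  moreover obtain M' where "\<forall>m\<ge>M'. pelt ^ k dvd t - (\<Sum>i<m. f i)"
    using assms(2) unfolding padic_sums_def by blast
  ultimately show "pelt ^ k dvd s - t"
    by (meson dvd_diff_sym dvd_diff_trans max.cobounded1 max.cobounded2)
qed

text \<open>The second conjunct fixes the modulus: the first k terms already give the sum modulo
  \<open>p^k\<close>. The evaluation of power series relies on this sharper form.\<close>

lemma padic_sums_exists:
  fixes f :: "nat \<Rightarrow> 'b::padic_complete"
  assumes f: "\<And>m. pelt ^ m dvd f m"
  shows "\<exists>s. padic_sums f s \<and> (\<forall>k. pelt ^ k dvd s - (\<Sum>i<k. f i))"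
proof -
  have "\<exists>l. \<forall>k. pelt ^ k dvd l - (\<Sum>i<k. f i)"
    by (rule padic_limit) (simp add: f)
  then obtain l where l: "\<And>k. pelt ^ k dvd l - (\<Sum>i<k. f i)"
    by blast
  then have "padic_sums f l"
    unfolding padic_sums_def by (meson dvd_pelt_power_le)
  with l show ?thesis
    by blast
qed

text \<open>The inverse is the sum of the geometric series in \<open>pelt * x\<close>.\<close>

lemma unit_one_minus_pelt:
  fixes x :: "'b::padic_complete"
  shows "1 - pelt * x dvd 1"
proof -
  obtain s where s: "\<And>k. pelt ^ k dvd s - (\<Sum>i<k. (pelt * x) ^ i)"
    using padic_sums_exists[of "\<lambda>i. (pelt * x) ^ i"] by (auto simp: power_mult_distrib)
  have "(1 - pelt * x) * s = 1"
  proof (rule padic_eqI)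
    fix k
    have "pelt ^ k dvd (1 - pelt * x) * s - (1 - pelt * x) * (\<Sum>i<k. (pelt * x) ^ i)"
      using s by (simp flip: right_diff_distrib)
    also have "(1 - pelt * x) * (\<Sum>i<k. (pelt * x) ^ i) = 1 - (pelt * x) ^ k"
      by (simp add: one_diff_power_eq)
    finally have *: "pelt ^ k dvd (1 - pelt * x) * s - (1 - (pelt * x) ^ k)" .
    have "pelt ^ k dvd 1 - (pelt * x) ^ k - 1"
      by (simp add: power_mult_distrib)
    with * show "pelt ^ k dvd (1 - pelt * x) * s - 1"
      by (rule dvd_diff_trans)
  qed
  then show ?thesis
    by (metis dvd_triv_left)
qed

text \<open>In a complete ring p lies in the Jacobson radical, so being a unit depends only on the
  residue modulo p.\<close>

lemma unit_cong_pelt: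
  fixes u v :: "'b::padic_complete"
  assumes "u dvd 1" "pelt dvd v - u"
  shows "v dvd 1"
proof -
  obtain w where w: "v - u = pelt * w"
    using assms(2) by (elim dvdE)
  have "u * (1 - pelt * (- (ring_inv u * w))) = u + (u * ring_inv u) * (pelt * w)"
    by (simp add: algebra_simps)
  also have "\<dots> = v"
    using w by (simp add: ring_inv_right[OF assms(1)] algebra_simps)
  finally have "v = u * (1 - pelt * (- (ring_inv u * w)))" ..
  then show ?thesis
    by (metis assms(1) unit_mult unit_one_minus_pelt)
qed

lemma unit_of_int:
  assumes "coprime k (int (base_prime TYPE('b::padic_complete)))"
  shows "(of_int k :: 'b) dvd 1"
proof -
  obtain a b where "a * k + b * int (base_prime TYPE('b)) = 1"
    using assms by (metis bezout_int coprime_imp_gcd_eq_1)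
  then have "(of_int a :: 'b) * of_int k + of_int b * pelt = 1"
    by (metis of_int_1 of_int_add of_int_mult of_int_of_nat_eq)
  then have "of_int a * of_int k = (1 - pelt * of_int b :: 'b)"
    by (simp add: algebra_simps)
  then show ?thesis
    by (metis unit_one_minus_pelt dvd_mult_right dvd_trans dvd_refl)
qed

lemma unit_of_nat:
  assumes "coprime k (base_prime TYPE('b::padic_complete))"
  shows "(of_nat k :: 'b) dvd 1"
  using unit_of_int[of "int k", where 'b = 'b] assms by simp

section \<open>Congruences modulo ideals\<close>

text \<open>With ideals as sets, the same congruence lemmas cover reduction modulo p, reduction
  modulo the ideal of a subscheme, and equality (the ideal \<open>{0}\<close>).\<close>

definition is_ideal :: "'a::comm_ring_1 set \<Rightarrow> bool" where
  "is_ideal J \<longleftrightarrow> 0 \<in> J \<and> (\<forall>a\<in>J. \<forall>b\<in>J. a + b \<in> J) \<and> (\<forall>a. \<forall>b\<in>J. a * b \<in> J)"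

lemma is_ideal_dvd: "is_ideal {x. d dvd x}"
  by (simp add: is_ideal_def)

lemma is_ideal_zero: "is_ideal {0}"
  by (simp add: is_ideal_def)

context
  fixes J :: "'a::comm_ring_1 set"
  assumes J: "is_ideal J"
begin

lemma ideal_0: "0 \<in> J"
  and ideal_add: "a \<in> J \<Longrightarrow> b \<in> J \<Longrightarrow> a + b \<in> J"
  and ideal_mult: "b \<in> J \<Longrightarrow> a * b \<in> J"
  using J by (simp_all add: is_ideal_def)

lemma ideal_refl: "a - a \<in> J"
  by (simp add: ideal_0)

lemma ideal_cong_trans: "a - b \<in> J \<Longrightarrow> b - c \<in> J \<Longrightarrow> a - c \<in> J"
  using ideal_add[of "a - b" "b - c"] by simp

lemma ideal_cong_add: "a - b \<in> J \<Longrightarrow> c - d \<in> J \<Longrightarrow> (a + c) - (b + d) \<in> J"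
  using ideal_add[of "a - b" "c - d"] by (simp add: algebra_simps)

lemma ideal_cong_mult: "a - b \<in> J \<Longrightarrow> c - d \<in> J \<Longrightarrow> a * c - b * d \<in> J"
  using ideal_add[OF ideal_mult[of "a - b" c] ideal_mult[of "c - d" b]]
  by (simp add: algebra_simps)

lemma ideal_cong_power: "a - b \<in> J \<Longrightarrow> a ^ n - b ^ n \<in> J"
  by (induction n) (auto intro: ideal_0 ideal_cong_mult)

lemma ideal_cong_sum: "(\<And>i. i \<in> I \<Longrightarrow> f i - g i \<in> J) \<Longrightarrow> sum f I - sum g I \<in> J"
  by (induction I rule: infinite_finite_induct) (auto simp: ideal_0 ideal_cong_add)

lemma ideal_cong_prod: "(\<And>i. i \<in> I \<Longrightarrow> f i - g i \<in> J) \<Longrightarrow> prod f I - prod g I \<in> J"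
  by (induction I rule: infinite_finite_induct) (auto simp: ideal_0 ideal_cong_mult)

lemma ideal_cong_det: "(\<And>i j. A $ i $ j - B $ i $ j \<in> J) \<Longrightarrow> det A - det B \<in> J"
  unfolding det_def by (intro ideal_cong_sum ideal_cong_mult ideal_cong_prod ideal_refl)

lemma ideal_cong_inverse:
  assumes "a * a' = 1" "b * b' = 1" "a - b \<in> J"
  shows "a' - b' \<in> J"
proof -
  have "a' - b' = a' * (b * b') - b' * (a * a')"
    by (simp add: assms)
  also have "\<dots> = (- (a' * b')) * (a - b)"
    by (simp add: algebra_simps)
  finally show ?thesis
    by (simp only: ideal_mult[OF assms(3)])
qed

end

text \<open>An ideal closed in the p-adic topology. Homomorphisms are compared on polynomials first,
  and the comparison has to survive p-adic limits.\<close>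

definition closed_ideal :: "'b::with_prime set \<Rightarrow> bool" where
  "closed_ideal J \<longleftrightarrow> is_ideal J \<and> (\<forall>F. (\<forall>k. \<exists>G\<in>J. pelt ^ k dvd F - G) \<longrightarrow> F \<in> J)"

lemma closed_ideal_zero: "closed_ideal ({0} :: 'b::padic_complete set)"
  by (auto simp: closed_ideal_def is_ideal_zero intro: padic_separated)

section \<open>Homomorphisms out of completed coordinate rings\<close>

lemma is_ring_hom_eq_of_int: "is_ring_hom (of_int :: int \<Rightarrow> 'b::comm_ring_1)"
  by (simp add: is_ring_hom_def)

lemma mono_eval_pvar: "mono_eval pvar m = Poly_Mapping.single m (1 :: 'c::comm_ring_1)"
proof -
  have pow: "pvar v ^ k = Poly_Mapping.single (Poly_Mapping.single v k) (1 :: 'c)" for v :: 'a and k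
  proof (induction k)
    case (Suc k)
    then show ?case
      by (simp add: pvar_def mult_single flip: single_add)
  qed simp
  have "(\<Prod>v\<in>V. Poly_Mapping.single (Poly_Mapping.single v (Poly_Mapping.lookup m v)) 1)
      = Poly_Mapping.single (\<Sum>v\<in>V. Poly_Mapping.single v (Poly_Mapping.lookup m v)) (1 :: 'c)" for V
    by (induction V rule: infinite_finite_induct) (simp_all add: mult_single)
  moreover have "(\<Sum>v\<in>Poly_Mapping.keys m. Poly_Mapping.single v (Poly_Mapping.lookup m v)) = m"
    by (rule poly_mapping_eqI) (auto simp: lookup_sum lookup_single when_def in_keys_iff)
  ultimately show ?thesis
    unfolding mono_eval_def pow by simp
qed

lemma is_ring_hom_pconst': "is_ring_hom (pconst :: 'c::comm_ring_1 \<Rightarrow> ('v, 'c) mpol)"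
  by (simp add: is_ring_hom_def pconst_def single_add mult_single)

lemma poly_eval_pconst_pvar: "poly_eval pconst pvar f = f"
proof (induction f rule: poly_mapping_single_induct)
  case 1
  show ?case by (rule poly_eval_0)
next
  case (2 m c f)
  have "pconst c * Poly_Mapping.single m 1 = Poly_Mapping.single m c"
    by (simp add: pconst_def mult_single)
  with 2 show ?case
    by (simp add: poly_eval_add[OF is_ring_hom_pconst'] poly_eval_single[OF is_ring_hom_pconst']
        mono_eval_pvar)
qed

lemma poly_eval_pconst:
  assumes "is_ring_hom \<sigma>"
  shows "poly_eval \<sigma> a (pconst c) = \<sigma> c"
  by (simp add: pconst_def poly_eval_single[OF assms] mono_eval_0)

lemma poly_eval_base_change:
  assumes \<sigma>: "is_ring_hom \<sigma>"
  shows "poly_eval \<sigma> b (poly_eval (\<lambda>k. pconst (of_int k)) pvar e) = poly_eval of_int b e"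
proof -
  have "poly_eval \<sigma> b \<circ> (\<lambda>k. pconst (of_int k)) = of_int"
    by (simp add: fun_eq_iff poly_eval_pconst[OF \<sigma>] is_ring_hom_of_int[OF \<sigma>])
  moreover have "poly_eval \<sigma> b \<circ> pvar = b"
    by (simp add: fun_eq_iff poly_eval_pvar[OF \<sigma>])
  ultimately show ?thesis
    by (subst poly_eval_comp[OF is_ring_hom_pconst is_ring_hom_poly_eval[OF \<sigma>]]) simp
qed

text \<open>The points of the scheme with values in \<open>'b\<close>. The equations are integral,
  so the structure map from the base ring does not enter.\<close>

definition solves :: "('v::affine_scheme \<Rightarrow> 'b::comm_ring_1) \<Rightarrow> bool" where
  "solves b \<longleftrightarrow> (\<forall>e\<in>eqns. poly_eval of_int b e = 0)"

lemma poly_eval_scheme_ideal: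
  assumes \<sigma>: "is_ring_hom \<sigma>" and b: "solves b" and f: "f \<in> scheme_ideal"
  shows "poly_eval \<sigma> b f = 0"
proof -
  note hom = is_ring_hom_poly_eval[OF \<sigma>, of b]
  have gen: "poly_eval \<sigma> b g = 0" if "g \<in> poly_eval (\<lambda>k. pconst (of_int k)) pvar ` eqns" for g
    using that b by (auto simp: poly_eval_base_change[OF \<sigma>] solves_def)
  show ?thesis
    using f unfolding scheme_ideal_def gen_ideal_def
  proof (induction rule: module.span_induct_alt[OF module_mult, consumes 1])
    case 1
    show ?case
      by (rule poly_eval_0)
  next
    case (2 c x y)
    then show ?case
      by (simp add: gen is_ring_hom_simps[OF hom])
  qed
qed

lemma abs_coord_cases: obtains f where "F = abs_coord f"
  by (rule that[OF Quotient3_abs_rep[OF Quotient3_coord, symmetric]])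

lemma is_ring_hom_abs_coord:
  "is_ring_hom (abs_coord :: ('v::affine_scheme, 'r::comm_ring_1) mpol \<Rightarrow> ('v, 'r) coord)"
  by (simp add: is_ring_hom_def one_coord_def plus_coord.abs_eq times_coord.abs_eq)

text \<open>The representative is chosen by the quotient type; the value is independent of it when
  \<open>b\<close> solves the equations.\<close>

definition coord_eval ::
  "('r \<Rightarrow> 'b) \<Rightarrow> ('v \<Rightarrow> 'b) \<Rightarrow> ('v::affine_scheme, 'r::comm_ring_1) coord \<Rightarrow> 'b::comm_ring_1" where
  "coord_eval \<sigma> b F = poly_eval \<sigma> b (rep_coord F)"

lemma coord_eval_abs:
  assumes \<sigma>: "is_ring_hom \<sigma>" and b: "solves b"
  shows "coord_eval \<sigma> b (abs_coord f) = poly_eval \<sigma> b f"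
proof -
  have "rep_coord (abs_coord f) - f \<in> scheme_ideal"
    using Quotient3_rep_abs[OF Quotient3_coord, of f]
    by (simp add: coord_rel_def scheme_ideal_0)
  from poly_eval_scheme_ideal[OF \<sigma> b this] show ?thesis
    by (simp add: coord_eval_def is_ring_hom_diff[OF is_ring_hom_poly_eval[OF \<sigma>]])
qed

lemma is_ring_hom_coord_eval:
  assumes \<sigma>: "is_ring_hom \<sigma>" and b: "solves b"
  shows "is_ring_hom (coord_eval \<sigma> b)"
proof -
  note hom = is_ring_hom_poly_eval[OF \<sigma>, of b]
  have "coord_eval \<sigma> b (F + G) = coord_eval \<sigma> b F + coord_eval \<sigma> b G"
    "coord_eval \<sigma> b (F * G) = coord_eval \<sigma> b F * coord_eval \<sigma> b G" for F G
    by (cases F rule: abs_coord_cases; cases G rule: abs_coord_cases;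
        simp add: plus_coord.abs_eq times_coord.abs_eq coord_eval_abs[OF assms]
          is_ring_hom_simps[OF hom])+
  then show ?thesis
    by (simp add: is_ring_hom_def one_coord_def coord_eval_abs[OF assms] is_ring_hom_1[OF hom])
qed

lemma coord_eval_const:
  assumes "is_ring_hom \<sigma>" "solves b"
  shows "coord_eval \<sigma> b (coord_const c) = \<sigma> c"
  by (simp add: coord_const_def coord_eval_abs[OF assms] poly_eval_pconst[OF assms(1)])

lemma coord_eval_var:
  assumes "is_ring_hom \<sigma>" "solves b"
  shows "coord_eval \<sigma> b (coord_var v) = b v"
  by (simp add: coord_var_def coord_eval_abs[OF assms] poly_eval_pvar[OF assms(1)])

lemma abs_coord_eq_poly_eval: "abs_coord f = poly_eval coord_const coord_var f"
proof -
  have "abs_coord f = abs_coord (poly_eval pconst pvar f)"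
    by (simp add: poly_eval_pconst_pvar)
  also have "\<dots> = poly_eval (abs_coord \<circ> pconst) (abs_coord \<circ> pvar) f"
    by (rule poly_eval_comp[OF is_ring_hom_pconst' is_ring_hom_abs_coord])
  finally show ?thesis
    by (simp add: comp_def flip: coord_const.abs_eq coord_var.abs_eq)
qed

lemma is_ring_hom_coord_const: "is_ring_hom coord_const"
  using is_ring_hom_comp[OF is_ring_hom_abs_coord is_ring_hom_pconst']
  by (simp add: comp_def flip: coord_const.abs_eq)

lemma is_ring_hom_cst: "is_ring_hom cst"
  using is_ring_hom_comp[OF is_ring_hom_to_hat is_ring_hom_coord_const]
  by (simp add: comp_def flip: cst_def)

lemma to_hat_abs_coord: "to_hat (abs_coord f) = poly_eval cst crd f"
  unfolding abs_coord_eq_poly_eval poly_eval_comp[OF is_ring_hom_coord_const is_ring_hom_to_hat]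
  by (simp add: comp_def cst_def[abs_def] crd_def[abs_def])

text \<open>Polynomials in the coordinates are dense, so a property extends from them to the
  completion once it is stable under p-adic approximation, which is the case
  \<open>limit\<close>.\<close>

lemma hat_induct [case_names const var add mult limit]:
  fixes F :: "('v::affine_scheme, 'r::with_prime) hat_ring"
  assumes const: "\<And>c. P (cst c)" and var: "\<And>v. P (crd v)"
    and add: "\<And>F G. P F \<Longrightarrow> P G \<Longrightarrow> P (F + G)"
    and mult: "\<And>F G. P F \<Longrightarrow> P G \<Longrightarrow> P (F * G)"
    and limit: "\<And>F. (\<And>k. \<exists>G. P G \<and> pelt ^ k dvd F - G) \<Longrightarrow> P F"
  shows "P F"
proof (rule limit)
  fix k
  have one: "P 1" and zero: "P 0"
    using const[of 1] const[of 0]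
    by (simp_all add: is_ring_hom_simps[OF is_ring_hom_cst])
  have "P (a ^ j)" if "P a" for a and j :: nat
    by (induction j) (auto intro: one mult that)
  then have "P (\<Prod>v\<in>V. crd v ^ m v)" for V :: "'v set" and m :: "'v \<Rightarrow> nat"
    by (induction V rule: infinite_finite_induct) (auto intro: one mult var)
  then have summand: "P (cst c * mono_eval crd m)" for c and m :: "'v \<Rightarrow>\<^sub>0 nat"
    unfolding mono_eval_def by (intro mult const)
  have "P (\<Sum>m\<in>M. cst (c m) * mono_eval crd m)" for M and c :: "('v \<Rightarrow>\<^sub>0 nat) \<Rightarrow> 'r"
    by (induction M rule: infinite_finite_induct) (auto intro: zero add summand)
  then have "P (poly_eval cst crd f)" for f
    unfolding poly_eval_def .
  then have "P (to_hat f)" for f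
    by (cases f rule: abs_coord_cases) (simp add: to_hat_abs_coord)
  then show "\<exists>G. P G \<and> pelt ^ k dvd F - G"
    using to_hat_approx by blast
qed

text \<open>Ring homomorphisms preserve divisibility by powers of p and are therefore continuous; as
  \<open>J\<close> is closed, a congruence on generators passes to limits.\<close>

lemma hat_hom_cong:
  fixes h h' :: "('v::affine_scheme, 'r::with_prime) hat_ring \<Rightarrow> 'b::with_prime"
  assumes p: "base_prime TYPE('b) = base_prime TYPE('r)" and J: "closed_ideal J"
    and h: "is_ring_hom h" "is_ring_hom h'"
    and cong: "\<And>c. h (cst c) - h' (cst c) \<in> J" "\<And>v. h (crd v) - h' (crd v) \<in> J"
  shows "h F - h' F \<in> J"
proof (induction F rule: hat_induct)
  case (limit F)
  have "\<exists>G\<in>J. pelt ^ k dvd (h F - h' F) - G" for k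
  proof -
    obtain G where G: "h G - h' G \<in> J" "pelt ^ k dvd F - G"
      using limit by blast
    have "pelt ^ k dvd h F - h G" "pelt ^ k dvd h' F - h' G"
      using is_ring_hom_dvd_diff[OF h(1) G(2)] is_ring_hom_dvd_diff[OF h(2) G(2)] by (simp_all add: p)
    then have "pelt ^ k dvd (h F - h' F) - (h G - h' G)"
      by (rule dvd_diff_minus)
    with G(1) show ?thesis ..
  qed
  then show ?case
    using J unfolding closed_ideal_def by blast
next
  case (add F G)
  with J show ?case
    by (auto simp: h is_ring_hom_add closed_ideal_def intro: ideal_cong_add)
next
  case (mult F G)
  with J show ?case
    by (auto simp: h is_ring_hom_mult closed_ideal_def intro: ideal_cong_mult)
qed (rule cong)+

lemma hat_hom_eqI:
  fixes h h' :: "('v::affine_scheme, 'r::with_prime) hat_ring \<Rightarrow> 'b::padic_complete"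
  assumes p: "base_prime TYPE('b) = base_prime TYPE('r)"
    and h: "is_ring_hom h" "is_ring_hom h'"
    and eq: "\<And>c. h (cst c) = h' (cst c)" "\<And>v. h (crd v) = h' (crd v)"
  shows "h = h'"
  using hat_hom_cong[OF p closed_ideal_zero h] eq by (auto simp: fun_eq_iff)

text \<open>The universal property of the completion, by continuous extension of
  \<open>g\<close>.\<close>

lemma padic_hom_exists:
  fixes g :: "'a::with_prime \<Rightarrow> 'b::padic_complete"
  assumes p: "base_prime TYPE('b) = base_prime TYPE('a)" and g: "is_ring_hom g"
  shows "\<exists>h. is_ring_hom h \<and> (\<forall>a. h (to_hat a) = g a)"
proof -
  have cong: "pelt ^ k dvd g a - g b" if "pelt ^ k dvd F - to_hat a" "pelt ^ k dvd F - to_hat b" for F k a b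
  proof -
    have "pelt ^ k dvd to_hat (a - b)"
      using dvd_diff_trans[OF dvd_diff_sym[OF that(1)] that(2)]
      by (simp add: is_ring_hom_diff[OF is_ring_hom_to_hat])
    then have "pelt ^ k dvd a - b"
      by (simp only: to_hat_dvd_iff)
    from is_ring_hom_dvd_diff[OF g this] show ?thesis
      by (simp add: p)
  qed
  \<comment> \<open>The limit is related to all approximations of \<open>F\<close>, not to one
    chosen sequence, so that sums and products of approximations may be used below.\<close>
  have "\<exists>l. \<forall>k a. pelt ^ k dvd F - to_hat a \<longrightarrow> pelt ^ k dvd l - g a" for F
  proof -
    have "\<forall>k. \<exists>a. pelt ^ k dvd F - to_hat a"
      using to_hat_approx by blast
    then obtain a where a: "\<And>k. pelt ^ k dvd F - to_hat (a k)"
      by metis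
    have "pelt ^ k dvd g (a (Suc k)) - g (a k)" for k
      using cong dvd_pelt_power_le[OF a, of k "Suc k"] a by simp
    then obtain l where "\<And>k. pelt ^ k dvd l - g (a k)"
      using padic_limit[of "\<lambda>k. g (a k)"] by blast
    then have "pelt ^ k dvd l - g b" if "pelt ^ k dvd F - to_hat b" for k b
      using cong[OF a that] by (rule dvd_diff_trans)
    then show ?thesis
      by blast
  qed
  then obtain h where h: "\<And>F k a. pelt ^ k dvd F - to_hat a \<Longrightarrow> pelt ^ k dvd h F - g a"
    by metis
  \<comment> \<open>One suitable approximation for each k already determines
    \<open>h F\<close>.\<close>
  have *: "h F = l" if ex: "\<And>k. \<exists>a. pelt ^ k dvd F - to_hat a \<and> pelt ^ k dvd l - g a" for F l
  proof (rule padic_eqI)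
    fix k
    obtain a where "pelt ^ k dvd F - to_hat a" "pelt ^ k dvd l - g a"
      using ex by blast
    then show "pelt ^ k dvd h F - l"
      by (blast intro: dvd_diff_trans dvd_diff_sym h)
  qed
  have const: "h (to_hat a) = g a" for a
    by (rule *) (metis diff_self dvd_0_right)
  note th = is_ring_hom_to_hat
  have add: "h (F + G) = h F + h G" and mult: "h (F * G) = h F * h G" for F G
  proof -
    have ex: "\<exists>a b. pelt ^ k dvd F - to_hat a \<and> pelt ^ k dvd G - to_hat b" for k
      using to_hat_approx by blast
    show "h (F + G) = h F + h G"
    proof (rule *)
      fix k
      obtain a b where "pelt ^ k dvd F - to_hat a" "pelt ^ k dvd G - to_hat b"
        using ex by blast
      then show "\<exists>a. pelt ^ k dvd F + G - to_hat a \<and> pelt ^ k dvd h F + h G - g a"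
        by (intro exI[of _ "a + b"])
          (simp only: is_ring_hom_add[OF th] is_ring_hom_add[OF g] dvd_diff_add h simp_thms)
    qed
    show "h (F * G) = h F * h G"
    proof (rule *)
      fix k
      obtain a b where "pelt ^ k dvd F - to_hat a" "pelt ^ k dvd G - to_hat b"
        using ex by blast
      then show "\<exists>a. pelt ^ k dvd F * G - to_hat a \<and> pelt ^ k dvd h F * h G - g a"
        by (intro exI[of _ "a * b"])
          (simp only: is_ring_hom_mult[OF th] is_ring_hom_mult[OF g] dvd_diff_mult h simp_thms)
    qed
  qed
  have "h 1 = 1"
    using const[of 1] by (simp add: is_ring_hom_1[OF th] is_ring_hom_1[OF g])
  with add mult const show ?thesis
    unfolding is_ring_hom_def by blast
qed

lemma subst_hom:
  fixes b :: "'v::affine_scheme \<Rightarrow> 'b::padic_complete" and \<sigma> :: "'r::with_prime \<Rightarrow> 'b"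
  assumes p: "base_prime TYPE('b) = base_prime TYPE('r)"
    and \<sigma>: "is_ring_hom \<sigma>" and b: "solves b"
  shows is_ring_hom_subst_hom: "is_ring_hom (subst_hom \<sigma> b)"
    and subst_hom_cst: "subst_hom \<sigma> b (cst c) = \<sigma> c"
    and subst_hom_crd: "subst_hom \<sigma> b (crd v) = b v"
    and subst_hom_to_hat: "subst_hom \<sigma> b (to_hat f) = coord_eval \<sigma> b f"
proof -
  obtain h where h: "is_ring_hom h" "\<And>f. h (to_hat f) = coord_eval \<sigma> b f"
    using padic_hom_exists[OF _ is_ring_hom_coord_eval[OF \<sigma> b]] p by auto
  have "subst_hom \<sigma> b = h"
    unfolding subst_hom_def
  proof (rule the_equality)
    show "is_ring_hom h \<and> (\<forall>c. h (cst c) = \<sigma> c) \<and> (\<forall>v. h (crd v) = b v)"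
      by (simp add: h cst_def crd_def coord_eval_const[OF \<sigma> b] coord_eval_var[OF \<sigma> b])
    then show "h' = h"
      if "is_ring_hom h' \<and> (\<forall>c. h' (cst c) = \<sigma> c) \<and> (\<forall>v. h' (crd v) = b v)" for h'
      using that by (intro hat_hom_eqI[OF p]) auto
  qed
  with h show "is_ring_hom (subst_hom \<sigma> b)" "subst_hom \<sigma> b (cst c) = \<sigma> c"
    "subst_hom \<sigma> b (crd v) = b v" "subst_hom \<sigma> b (to_hat f) = coord_eval \<sigma> b f"
    by (simp_all add: cst_def crd_def coord_eval_const[OF \<sigma> b] coord_eval_var[OF \<sigma> b])
qed

section \<open>Points with values in a ring, for each of the schemes in use\<close>

lemma solves_hom:
  assumes h: "is_ring_hom h" and b: "solves b"
  shows "solves (\<lambda>v. h (b v))"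
proof -
  have "poly_eval of_int (\<lambda>v. h (b v)) e = h (poly_eval of_int b e)" for e
    unfolding poly_eval_comp[OF is_ring_hom_eq_of_int h]
    by (simp add: comp_def is_ring_hom_of_int[OF h])
  with b show ?thesis
    by (simp add: solves_def is_ring_hom_0[OF h])
qed

lemma solves_coord_var: "solves (coord_var :: 'v::affine_scheme \<Rightarrow> ('v, 'r::comm_ring_1) coord)"
  unfolding solves_def
proof
  fix e :: "('v, int) mpol"
  assume e: "e \<in> eqns"
  define g :: "('v, 'r) mpol" where "g = poly_eval (\<lambda>k. pconst (of_int k)) pvar e"
  have "g \<in> scheme_ideal"
    unfolding scheme_ideal_def gen_ideal_def g_def
    using e by (intro module.span_base[OF module_mult]) simp
  then have "abs_coord g = abs_coord 0"
    by (simp add: coord.abs_eq_iff coord_rel_def)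
  then have "abs_coord g = 0"
    by (simp add: is_ring_hom_0[OF is_ring_hom_abs_coord])
  moreover have "abs_coord g = poly_eval of_int coord_var e"
    unfolding g_def abs_coord_eq_poly_eval
    by (rule poly_eval_base_change[OF is_ring_hom_coord_const])
  ultimately show "poly_eval of_int coord_var e = (0 :: ('v, 'r) coord)"
    by simp
qed

lemma solves_crd: "solves (crd :: 'v::affine_scheme \<Rightarrow> ('v, 'r::with_prime) hat_ring)"
  using solves_hom[OF is_ring_hom_to_hat solves_coord_var] by (simp add: crd_def[abs_def])

lemma poly_eval_poly_eval:
  "poly_eval of_int b (poly_eval pconst a e) = poly_eval of_int (\<lambda>v. poly_eval of_int b (a v)) e"
  unfolding poly_eval_comp[OF is_ring_hom_pconst' is_ring_hom_poly_eval[OF is_ring_hom_eq_of_int]]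
  by (simp add: comp_def poly_eval_pconst[OF is_ring_hom_eq_of_int])

lemma solves_sum:
  "solves (b :: 'v::affine_scheme + 'w::affine_scheme \<Rightarrow> 'b::comm_ring_1) \<longleftrightarrow>
    solves (\<lambda>v. b (Inl v)) \<and> solves (\<lambda>w. b (Inr w))"
  by (simp add: solves_def eqns_sum_def ball_Un poly_eval_poly_eval poly_eval_pvar[OF is_ring_hom_eq_of_int])

lemma solves_unit: "solves (b :: unit \<Rightarrow> 'b::comm_ring_1)"
  by (simp add: solves_def eqns_unit_def)

lemma solves_gl:
  "solves (b :: 'n::finite gl_var \<Rightarrow> 'b::comm_ring_1) \<longleftrightarrow>
    det (\<chi> i j. b (Entry i j)) * b DetInv = 1"
proof -
  note hom = is_ring_hom_poly_eval[OF is_ring_hom_eq_of_int, of b]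
  have "map_matrix (poly_eval of_int b) (\<chi> i j. pvar (Entry i j)) = (\<chi> i j. b (Entry i j))"
    by (simp add: vec_eq_iff poly_eval_pvar[OF is_ring_hom_eq_of_int])
  then show ?thesis
    by (simp add: solves_def eqns_gl_var_def is_ring_hom_simps[OF hom] poly_eval_pvar[OF is_ring_hom_eq_of_int])
qed

lemma solves_g:
  "solves (b :: 'n::finite g_var \<Rightarrow> 'b::comm_ring_1) \<longleftrightarrow>
    det (\<chi> i j. b (GEntry i j)) * b GDetInv = 1 \<and> b GScal * b GScalInv = 1 \<and>
    (det (\<chi> i j. b (GEntry i j)))\<^sup>2 = b GScal ^ CARD('n)"
proof -
  note hom = is_ring_hom_poly_eval[OF is_ring_hom_eq_of_int, of b]
  have "map_matrix (poly_eval of_int b) (\<chi> i j. pvar (GEntry i j)) = (\<chi> i j. b (GEntry i j))"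
    by (simp add: vec_eq_iff poly_eval_pvar[OF is_ring_hom_eq_of_int])
  then show ?thesis
    by (simp add: solves_def eqns_g_var_def Let_def is_ring_hom_simps[OF hom]
        poly_eval_pvar[OF is_ring_hom_eq_of_int])
qed

section \<open>Principal roots\<close>

text \<open>For a prime p, the localization of the integers at p. The fraction need not be reduced,
  which keeps sums and products simple.\<close>

definition p_integral :: "nat \<Rightarrow> rat \<Rightarrow> bool" where
  "p_integral p r \<longleftrightarrow> (\<exists>a b. coprime b (int p) \<and> b \<noteq> 0 \<and> r = of_int a / of_int b)"

lemma p_integral_of_int: "p_integral p (of_int a)"
  unfolding p_integral_def by (rule exI[of _ a], rule exI[of _ 1]) simp

lemma p_integral_add: "p_integral p r \<Longrightarrow> p_integral p s \<Longrightarrow> p_integral p (r + s)"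
  unfolding p_integral_def
proof (elim exE conjE)
  fix a b c d
  assume "coprime b (int p)" "coprime d (int p)" "b \<noteq> 0" "d \<noteq> 0"
    "r = of_int a / of_int b" "s = of_int c / of_int d"
  then show "\<exists>a b. coprime b (int p) \<and> b \<noteq> 0 \<and> r + s = of_int a / of_int b"
    by (intro exI[of _ "a * d + c * b"] exI[of _ "b * d"]) (simp add: add_frac_eq)
qed

lemma p_integral_mult: "p_integral p r \<Longrightarrow> p_integral p s \<Longrightarrow> p_integral p (r * s)"
  unfolding p_integral_def
proof (elim exE conjE)
  fix a b c d
  assume "coprime b (int p)" "coprime d (int p)" "b \<noteq> 0" "d \<noteq> 0"
    "r = of_int a / of_int b" "s = of_int c / of_int d"
  then show "\<exists>a b. coprime b (int p) \<and> b \<noteq> 0 \<and> r * s = of_int a / of_int b"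
    by (intro exI[of _ "a * c"] exI[of _ "b * d"]) simp
qed

lemma p_integral_0: "p_integral p 0" and p_integral_1: "p_integral p 1"
  using p_integral_of_int[of p 0] p_integral_of_int[of p 1] by simp_all

lemma p_integral_sum: "(\<And>i. i \<in> I \<Longrightarrow> p_integral p (f i)) \<Longrightarrow> p_integral p (sum f I)"
  by (induction I rule: infinite_finite_induct) (auto intro: p_integral_0 p_integral_add)

lemma p_integral_inverse_of_nat:
  assumes "coprime n p" "n > 0"
  shows "p_integral p (1 / of_nat n)"
  unfolding p_integral_def
  by (rule exI[of _ 1], rule exI[of _ "int n"]) (use assms in simp)

text \<open>Integrality of the coefficients of a root is read off from the coefficients of the power:
  the coefficient of index \<open>m\<close> of \<open>F\<^sup>n\<close> is \<open>n\<close> times that of \<open>F\<close> plus an integral polynomial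
  in the preceding ones.\<close>

lemma fps_power_nth_integral:
  assumes F0: "fps_nth F 0 = 1" and m: "m > 0" and F: "\<And>i. i < m \<Longrightarrow> p_integral p (fps_nth F i)"
  shows "(\<forall>i<m. p_integral p (fps_nth (F ^ n) i)) \<and>
    (\<exists>r. p_integral p r \<and> fps_nth (F ^ n) m = of_nat n * fps_nth F m + r)"
proof (induction n)
  case 0
  show ?case
    using m p_integral_0 by (auto simp: p_integral_1 p_integral_0)
next
  case (Suc n)
  then obtain r where r: "p_integral p r" "fps_nth (F ^ n) m = of_nat n * fps_nth F m + r"
    and low: "\<And>i. i < m \<Longrightarrow> p_integral p (fps_nth (F ^ n) i)"
    by blast
  have "p_integral p (fps_nth (F ^ Suc n) i)" if "i < m" for i
    unfolding power_Suc fps_mult_nth using that F low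
    by (intro p_integral_sum p_integral_mult) auto
  moreover
  \<comment> \<open>The convolution without its two end terms. As both constant terms are 1, these
    ends contribute the coefficients of index \<open>m\<close> of \<open>F ^ n\<close> and of
    \<open>F\<close>.\<close>
  define q where "q = (\<Sum>i\<in>{1..<m}. fps_nth F i * fps_nth (F ^ n) (m - i))"
  have "p_integral p q"
    unfolding q_def using m by (intro p_integral_sum p_integral_mult F low) auto
  moreover have "fps_nth (F ^ Suc n) m = of_nat (Suc n) * fps_nth F m + (r + q)"
  proof -
    have "{0..m} = insert 0 (insert m {1..<m})"
      using m by auto
    then have "fps_nth (F ^ Suc n) m = fps_nth (F ^ n) m + (fps_nth F m * fps_nth (F ^ n) 0 + q)"
      using m F0 by (simp add: fps_mult_nth q_def)
    also have "fps_nth (F ^ n) 0 = 1"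
      using F0 by (rule fps_power_zeroth_eq_one)
    finally show ?thesis
      by (simp add: r(2) algebra_simps)
  qed
  ultimately show ?case
    using p_integral_add[OF r(1)] by blast
qed

text \<open>The relation between the two coefficients of index \<open>m\<close> is solved by
  dividing by \<open>n\<close> only, which is prime to p.\<close>

lemma fps_root_integral:
  assumes n: "coprime n p" "n > 0" and F0: "fps_nth F 0 = 1"
    and pow: "\<And>m. p_integral p (fps_nth (F ^ n) m)"
  shows "p_integral p (fps_nth F m)"
proof (induction m rule: less_induct)
  case (less m)
  show ?case
  proof (cases "m = 0")
    case True
    then show ?thesis by (simp add: F0 p_integral_1)
  next
    case False
    then obtain r where r: "p_integral p r" "fps_nth (F ^ n) m = of_nat n * fps_nth F m + r"
      using fps_power_nth_integral[OF F0 _ less, of m n] by blast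
    have "fps_nth F m = 1 / of_nat n * (fps_nth (F ^ n) m + of_int (- 1) * r)"
      using n(2) by (simp add: r(2))
    then show ?thesis
      by (metis pow r(1) n p_integral_add p_integral_mult p_integral_inverse_of_nat p_integral_of_int)
  qed
qed

lemma fps_binomial_root:
  assumes "n > 0"
  shows "fps_binomial (1 / of_int (- int n) :: rat) ^ n * (1 + fps_X) = 1"
proof -
  have "of_nat n * (1 / of_int (- int n)) = (- 1 :: rat)"
    using assms by simp
  then have "fps_binomial (1 / of_int (- int n) :: rat) ^ n = fps_binomial (- 1)"
    by (simp only: fps_binomial_power)
  then show ?thesis
    by (simp add: fps_binomial_minus_one inverse_mult_eq_1)
qed

text \<open>The n-th power of the binomial series with exponent \<open>-1/n\<close> is
  \<open>(1 + X)^(-1)\<close>, whose coefficients are \<open>(-1)^m\<close>.\<close>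

lemma p_integral_gchoose:
  assumes "coprime n p" "n > 0"
  shows "p_integral p ((1 / of_int (- int n)) gchoose m)"
proof -
  have int: "p_integral p (fps_nth (fps_binomial (- 1)) m)" for m
    using p_integral_of_int[of p "(- 1) ^ m"] gbinomial_minus[of "1 :: rat" m]
    by (simp flip: binomial_gbinomial)
  have "of_nat n * (1 / of_int (- int n)) = (- 1 :: rat)"
    using assms(2) by simp
  then have "fps_binomial (1 / of_int (- int n) :: rat) ^ n = fps_binomial (- 1)"
    by (simp only: fps_binomial_power)
  with fps_root_integral[OF assms, of "fps_binomial (1 / of_int (- int n))" m] int show ?thesis
    by simp
qed

text \<open>\<open>rat_in\<close> inverts the denominator of the reduced fraction. This denominator
  divides \<open>b\<close>, so it is prime to p and a unit.\<close>

lemma rat_in_quotient: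
  fixes a b :: int
  assumes b: "coprime b (int (base_prime TYPE('b::padic_complete)))" "b \<noteq> 0"
  shows "rat_in (of_int a / of_int b) * of_int b = (of_int a :: 'b)"
proof -
  obtain c d where cd: "quotient_of (of_int a / of_int b) = (c, d)"
    by fastforce
  then have d: "d > 0" "coprime c d" and "of_int a / of_int b = (of_int c / of_int d :: rat)"
    by (simp_all add: quotient_of_denom_pos quotient_of_coprime quotient_of_div)
  then have eq: "a * d = c * b"
    using b(2) by (simp add: frac_eq_eq flip: of_int_mult)
  then have "d dvd b"
    using d(2) by (metis coprime_commute coprime_dvd_mult_right_iff dvd_triv_right)
  then have "coprime d (int (base_prime TYPE('b)))"
    using b(1) coprime_divisors dvd_refl by blast
  then have inv: "ring_inv (of_int d) * of_int d = (1 :: 'b)"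
    by (intro ring_inv_left unit_of_int)
  obtain e where e: "b = d * e"
    using \<open>d dvd b\<close> by (elim dvdE)
  then have "a = c * e"
    using eq d(1) by simp
  then have "rat_in (of_int a / of_int b) * of_int b
      = of_int (c * e) * (ring_inv (of_int d) * of_int d :: 'b)"
    unfolding rat_in_def cd by (simp add: e algebra_simps)
  then show ?thesis
    using \<open>a = c * e\<close> by (simp add: inv)
qed

lemma rat_in_eqI:
  fixes a b :: int
  assumes b: "coprime b (int (base_prime TYPE('b::padic_complete)))" "b \<noteq> 0"
    and x: "x * of_int b = (of_int a :: 'b)"
  shows "rat_in (of_int a / of_int b) = x"
proof (rule unit_cancel[OF unit_of_int[OF b(1)]])
  show "of_int b * rat_in (of_int a / of_int b) = of_int b * x"
    using rat_in_quotient[OF b, of a] x by (simp add: mult.commute)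
qed

lemma rat_in_of_int: "rat_in (of_int a) = (of_int a :: 'b::padic_complete)"
  using rat_in_eqI[of 1 "of_int a :: 'b" a] by simp

lemma
  assumes "p_integral (base_prime TYPE('b::padic_complete)) r" "p_integral (base_prime TYPE('b)) s"
  shows rat_in_add: "rat_in (r + s) = (rat_in r + rat_in s :: 'b)"
    and rat_in_mult: "rat_in (r * s) = (rat_in r * rat_in s :: 'b)"
proof -
  obtain a b where r: "coprime b (int (base_prime TYPE('b)))" "b \<noteq> 0" "r = of_int a / of_int b"
    using assms(1) unfolding p_integral_def by blast
  obtain c d where s: "coprime d (int (base_prime TYPE('b)))" "d \<noteq> 0" "s = of_int c / of_int d"
    using assms(2) unfolding p_integral_def by blast
  have ra: "rat_in r * of_int b = (of_int a :: 'b)" and sc: "rat_in s * of_int d = (of_int c :: 'b)"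
    unfolding r(3) s(3) by (rule rat_in_quotient; fact)+
  have rs: "r + s = of_int (a * d + c * b) / of_int (b * d)" "r * s = of_int (a * c) / of_int (b * d)"
    using r s by (simp_all add: add_frac_eq)
  have "coprime (b * d) (int (base_prime TYPE('b)))" "b * d \<noteq> 0"
    using r s by simp_all
  note eqI = rat_in_eqI[OF this]
  have "(rat_in r + rat_in s) * of_int (b * d)
      = (rat_in r * of_int b) * of_int d + (rat_in s * of_int d) * (of_int b :: 'b)"
    by (simp add: algebra_simps)
  then show "rat_in (r + s) = (rat_in r + rat_in s :: 'b)"
    unfolding rs by (intro eqI) (simp add: ra sc)
  have "(rat_in r * rat_in s) * of_int (b * d)
      = (rat_in r * of_int b) * (rat_in s * of_int d :: 'b)"
    by (simp add: algebra_simps)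
  then show "rat_in (r * s) = (rat_in r * rat_in s :: 'b)"
    unfolding rs by (intro eqI) (simp add: ra sc)
qed

lemma rat_in_sum:
  assumes "\<And>i. i \<in> I \<Longrightarrow> p_integral (base_prime TYPE('b::padic_complete)) (f i)"
  shows "rat_in (sum f I) = (\<Sum>i\<in>I. rat_in (f i) :: 'b)"
  using assms
proof (induction I rule: infinite_finite_induct)
  case (insert i I)
  then show ?case
    by (simp add: rat_in_add p_integral_sum)
qed (simp_all add: rat_in_of_int[of 0, simplified])

section \<open>Evaluation of power series at multiples of p\<close>

definition fps_rat_in :: "rat fps \<Rightarrow> 'b::comm_ring_1 fps" where
  "fps_rat_in F = Abs_fps (\<lambda>m. rat_in (fps_nth F m))"

lemma fps_rat_in_mult:
  assumes "\<And>m. p_integral (base_prime TYPE('b::padic_complete)) (fps_nth F m)"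
    "\<And>m. p_integral (base_prime TYPE('b)) (fps_nth G m)"
  shows "fps_rat_in (F * G) = (fps_rat_in F * fps_rat_in G :: 'b fps)"
  by (rule fps_ext) (simp add: fps_rat_in_def fps_mult_nth rat_in_sum rat_in_mult
      p_integral_mult assms)

lemma fps_rat_in_1: "fps_rat_in 1 = (1 :: 'b::padic_complete fps)"
  by (rule fps_ext) (simp add: fps_rat_in_def rat_in_of_int[of 0, simplified]
      rat_in_of_int[of 1, simplified])

lemma fps_rat_in_1_plus_X: "fps_rat_in (1 + fps_X) = (1 + fps_X :: 'b::padic_complete fps)"
  by (rule fps_ext) (simp add: fps_rat_in_def fps_X_def rat_in_of_int[of 0, simplified]
      rat_in_of_int[of 1, simplified])

lemma fps_rat_in_power:
  assumes "\<And>m. p_integral (base_prime TYPE('b::padic_complete)) (fps_nth F m)"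
  shows "fps_rat_in (F ^ n) = (fps_rat_in F ^ n :: 'b fps)"
    and "p_integral (base_prime TYPE('b)) (fps_nth (F ^ n) m)"
proof -
  have "fps_rat_in (F ^ n) = (fps_rat_in F ^ n :: 'b fps) \<and>
    (\<forall>m. p_integral (base_prime TYPE('b)) (fps_nth (F ^ n) m))"
  proof (induction n)
    case 0
    show ?case
      by (simp add: fps_rat_in_1 p_integral_0 p_integral_1)
  next
    case (Suc n)
    then show ?case
      using assms by (auto simp: fps_rat_in_mult) 
        (simp add: fps_mult_nth p_integral_sum p_integral_mult)
  qed
  then show "fps_rat_in (F ^ n) = (fps_rat_in F ^ n :: 'b fps)"
    "p_integral (base_prime TYPE('b)) (fps_nth (F ^ n) m)"
    by auto
qed

text \<open>Convergence with a prescribed rate, natural for an argument divisible by p: k terms give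
  the value modulo \<open>p^k\<close>.\<close>

definition padic_eval :: "'b::with_prime fps \<Rightarrow> 'b \<Rightarrow> 'b \<Rightarrow> bool" where
  "padic_eval F w s \<longleftrightarrow> (\<forall>k. pelt ^ k dvd s - (\<Sum>i<k. fps_nth F i * w ^ i))"

text \<open>The product of two partial sums exceeds the partial sum of the Cauchy product by terms
  with \<open>i + j >= k\<close>; these contain \<open>w^(i+j)\<close> and are divisible by
  \<open>p^k\<close>.\<close>

lemma padic_eval_mult:
  assumes w: "pelt dvd w" and F: "padic_eval F w s" and G: "padic_eval G w t"
  shows "padic_eval (F * G) w (s * t)"
  unfolding padic_eval_def
proof
  fix k :: nat
  define a b where "a i = fps_nth F i * w ^ i" and "b i = fps_nth G i * w ^ i" for i
  define D where "D = {(i, j). i + j < k}"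
  have D: "D \<subseteq> {..<k} \<times> {..<k}"
    by (auto simp: D_def)
  have "(\<Sum>m<k. fps_nth (F * G) m * w ^ m) = (\<Sum>m<k. \<Sum>i\<le>m. a i * b (m - i))"
  proof (rule sum.cong[OF refl])
    fix m
    have "fps_nth F i * fps_nth G (m - i) * w ^ m = a i * b (m - i)" if "i \<le> m" for i
    proof -
      have "w ^ m = w ^ i * w ^ (m - i)"
        using that by (simp flip: power_add)
      then show ?thesis
        by (simp add: a_def b_def)
    qed
    then show "fps_nth (F * G) m * w ^ m = (\<Sum>i\<le>m. a i * b (m - i))"
      by (simp add: fps_mult_nth sum_distrib_right atMost_atLeast0)
  qed
  also have "\<dots> = (\<Sum>(i, j)\<in>D. a i * b j)"
    unfolding D_def by (rule sum.triangle_reindex[symmetric])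
  finally have low: "(\<Sum>m<k. fps_nth (F * G) m * w ^ m) = (\<Sum>(i, j)\<in>D. a i * b j)" .
  have "(\<Sum>i<k. a i) * (\<Sum>j<k. b j) = (\<Sum>(i, j)\<in>{..<k} \<times> {..<k}. a i * b j)"
    by (simp add: sum_product sum.cartesian_product)
  also have "\<dots> = (\<Sum>(i, j)\<in>{..<k} \<times> {..<k} - D. a i * b j) + (\<Sum>(i, j)\<in>D. a i * b j)"
    by (rule sum.subset_diff[OF D]) simp
  finally have all: "(\<Sum>i<k. a i) * (\<Sum>j<k. b j) - (\<Sum>m<k. fps_nth (F * G) m * w ^ m)
      = (\<Sum>(i, j)\<in>{..<k} \<times> {..<k} - D. a i * b j)"
    by (simp add: low)
  have "pelt ^ k dvd a i * b j" if "\<not> i + j < k" for i j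
  proof -
    have "pelt ^ k dvd w ^ (i + j)"
      using that w by (metis dvd_power_same dvd_trans le_imp_power_dvd not_less)
    then show ?thesis
      by (simp add: a_def b_def power_add ac_simps)
  qed
  then have *: "pelt ^ k dvd (\<Sum>i<k. a i) * (\<Sum>j<k. b j) - (\<Sum>m<k. fps_nth (F * G) m * w ^ m)"
    unfolding all by (intro dvd_sum) (auto simp: D_def)
  have "pelt ^ k dvd s * t - (\<Sum>i<k. a i) * (\<Sum>j<k. b j)"
    using F G unfolding padic_eval_def a_def b_def by (intro dvd_diff_mult) auto
  from dvd_diff_trans[OF this *]
  show "pelt ^ k dvd s * t - (\<Sum>m<k. fps_nth (F * G) m * w ^ m)" .
qed

lemma padic_eval_unique:
  fixes s t :: "'b::padic_complete"
  shows "padic_eval F w s \<Longrightarrow> padic_eval F w t \<Longrightarrow> s = t"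
  unfolding padic_eval_def by (rule padic_eqI) (blast intro: dvd_diff_trans dvd_diff_sym)

lemma padic_eval_1: "padic_eval 1 w 1"
  unfolding padic_eval_def
proof
  fix k
  show "pelt ^ k dvd 1 - (\<Sum>i<k. fps_nth 1 i * w ^ i)"
    by (cases k) (simp_all add: sum.lessThan_Suc_shift del: sum.lessThan_Suc)
qed

lemma padic_eval_power:
  assumes "pelt dvd w" "padic_eval F w s"
  shows "padic_eval (F ^ n) w (s ^ n)"
  by (induction n) (auto intro: padic_eval_1 padic_eval_mult assms)

lemma padic_eval_1_plus_X:
  assumes "pelt dvd w"
  shows "padic_eval (1 + fps_X) w (1 + w)"
  unfolding padic_eval_def
proof
  fix k
  have "(\<Sum>i<Suc (Suc j). fps_nth (1 + fps_X) i * w ^ i) = 1 + w" for j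
    by (simp add: sum.lessThan_Suc_shift fps_X_def del: sum.lessThan_Suc)
  note two = this
  \<comment> \<open>Only partial sums of length at least two are equal to \<open>1 + w\<close>; at
    length one the error is \<open>w\<close>, which p divides.\<close>
  consider "k = 0" | "k = 1" | j where "k = Suc (Suc j)"
    by (metis One_nat_def not0_implies_Suc)
  then show "pelt ^ k dvd 1 + w - (\<Sum>i<k. fps_nth (1 + fps_X) i * w ^ i)"
  proof cases
    case 3
    then show ?thesis
      by (simp only: two) simp
  qed (use assms in \<open>simp_all add: fps_X_def\<close>)
qed

text \<open>The formal identity \<open>F ^ n * (1 + X) = 1\<close> evaluated at
  \<open>pelt * v\<close>. The series is displayed exactly as in \<open>principal_root\<close>, so
  that its sum can be identified with \<lambda>.\<close>

lemma principal_root_series: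
  fixes v :: "'b::padic_complete"
  assumes n: "coprime n (base_prime TYPE('b))" "n > 0"
  obtains s where
    "padic_sums (\<lambda>m. rat_in ((1 / of_int (- int n)) gchoose m) * pelt ^ m * v ^ m) s"
    "s ^ n * (1 + pelt * v) = 1" "pelt dvd s - 1"
proof -
  define F where "F = fps_binomial (1 / of_int (- int n) :: rat)"
  have int: "p_integral (base_prime TYPE('b)) (fps_nth F m)" for m
    unfolding F_def using p_integral_gchoose[OF n] by simp
  have intX: "p_integral (base_prime TYPE('b)) (fps_nth (1 + fps_X) m)" for m
    by (simp add: fps_X_def p_integral_0 p_integral_1)
  define f where "f m = rat_in ((1 / of_int (- int n)) gchoose m) * pelt ^ m * v ^ m" for m
  have f: "f m = fps_nth (fps_rat_in F :: 'b fps) m * (pelt * v) ^ m" for m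
    by (simp add: f_def F_def fps_rat_in_def power_mult_distrib mult.assoc)
  obtain s where s: "padic_sums f s" "\<And>k. pelt ^ k dvd s - (\<Sum>i<k. f i)"
    using padic_sums_exists[of f] by (auto simp: f_def)
  have w: "pelt dvd pelt * v"
    by simp
  have "padic_eval (fps_rat_in F) (pelt * v) s"
    unfolding padic_eval_def f[symmetric] using s(2) by blast
  from padic_eval_mult[OF w padic_eval_power[OF w this] padic_eval_1_plus_X[OF w], of n]
  have "padic_eval (fps_rat_in (F ^ n * (1 + fps_X))) (pelt * v) (s ^ n * (1 + pelt * v))"
    by (simp add: fps_rat_in_mult[OF fps_rat_in_power(2)[OF int] intX] fps_rat_in_power(1)[OF int]
        fps_rat_in_1_plus_X)
  then have "padic_eval 1 (pelt * v) (s ^ n * (1 + pelt * v))"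
    unfolding F_def fps_binomial_root[OF n(2)] fps_rat_in_1 .
  then have "s ^ n * (1 + pelt * v) = 1"
    using padic_eval_1 padic_eval_unique by blast
  moreover have "pelt dvd s - 1"
    using s(2)[of 1] by (simp add: f_def rat_in_of_int[of 1, simplified])
  ultimately show ?thesis
    using that s(1) unfolding f_def by blast
qed

text \<open>The series yields an n-th root of the inverse of \<open>V\<close>; its inverse is the
  root sought.\<close>

lemma root_exists:
  fixes V :: "'b::padic_complete"
  assumes n: "coprime n (base_prime TYPE('b))" "n > 0" and V: "pelt dvd V - 1"
  obtains s where "s ^ n = V" "pelt dvd s - 1"
proof -
  obtain v where v: "V = 1 + pelt * v"
    using V by (metis diff_add_cancel add.commute dvdE)
  obtain s where s: "s ^ n * (1 + pelt * v) = 1" "pelt dvd s - 1"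
    by (rule principal_root_series[OF n])
  have unit: "s dvd 1"
    by (rule unit_cong_pelt[OF _ s(2)]) simp
  have "ring_inv s ^ n = V"
    using s(1) unit by (metis ring_inv_eqI ring_inv_power v)
  moreover have "ring_inv s - 1 = ring_inv s * (1 - s)"
    using unit by (simp add: right_diff_distrib ring_inv_left)
  then have "pelt dvd ring_inv s - 1"
    using dvd_diff_sym[OF s(2)] by simp
  ultimately show ?thesis
    using that by blast
qed

text \<open>In \<open>a^n - b^n = (a - b) S\<close> the cofactor \<open>S\<close> is congruent to
  \<open>n b^(n-1)\<close> modulo p, hence a unit.\<close>

lemma root_unique_mod:
  fixes a b :: "'b::padic_complete"
  assumes J: "\<And>x y. x \<in> J \<Longrightarrow> y * x \<in> J"
    and n: "coprime n (base_prime TYPE('b))"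
    and b: "b dvd 1" and cong: "pelt dvd a - b" and pow: "a ^ n - b ^ n \<in> J"
  shows "a - b \<in> J"
proof -
  define S where "S = (\<Sum>i<n. b ^ (n - Suc i) * a ^ i)"
  have "(\<Sum>i<n. b ^ (n - Suc i) * b ^ i) = of_nat n * b ^ (n - 1)"
    by (simp flip: power_add)
  moreover have "pelt dvd S - (\<Sum>i<n. b ^ (n - Suc i) * b ^ i)"
    unfolding S_def by (intro dvd_diff_sum dvd_diff_mult dvd_diff_power) (simp_all add: cong)
  ultimately have "pelt dvd S - of_nat n * b ^ (n - 1)"
    by simp
  moreover have "of_nat n * b ^ (n - 1) dvd 1"
    by (intro unit_mult unit_of_nat unit_power b n)
  ultimately have "S dvd 1"
    by (rule unit_cong_pelt[rotated])
  then have "ring_inv S * S * (a - b) = a - b"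
    by (simp add: ring_inv_left)
  then have "a - b = ring_inv S * (a ^ n - b ^ n)"
    unfolding power_diff_sumr2 S_def[symmetric] by (simp only: ac_simps)
  then show ?thesis
    using J[OF pow] by simp
qed

lemma root_unique:
  fixes a b :: "'b::padic_complete"
  assumes "coprime n (base_prime TYPE('b))" "b dvd 1" "pelt dvd a - b" "a ^ n = b ^ n"
  shows "a = b"
  using root_unique_mod[of "{0}" n b a] assms by simp

section \<open>Matrices over commutative rings\<close>

text \<open>Cramer's rule over a commutative ring. \<open>C\<close> is the adjugate: its entry is
  the determinant of \<open>A\<close> with row \<open>i\<close> replaced by a unit vector, so
  \<open>A ** C\<close> has as entries the determinants of \<open>A\<close> with row
  \<open>i\<close> replaced by row \<open>l\<close>.\<close>

lemma matrix_right_inverse_exists: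
  fixes A :: "'a::comm_ring_1 ^ 'n ^ 'n"
  assumes "det A dvd 1"
  shows "\<exists>B. A ** B = mat 1"
proof -
  define C where "C = (\<chi> j i. det (\<chi> k. if k = i then axis j 1 else A $ k))"
  have "(A ** C) $ l $ i = (if l = i then det A else 0)" for l i
  proof -
    have "A $ l = (\<Sum>j\<in>UNIV. A $ l $ j *s axis j 1)"
      by (simp add: vec_eq_iff axis_def if_distrib[of "(*) _"] cong: if_cong)
    then have "(\<chi> k. if k = i then A $ l else A $ k)
        = (\<chi> k. if k = i then (\<Sum>j\<in>UNIV. A $ l $ j *s axis j 1) else A $ k)"
      by (rule arg_cong[where f = "\<lambda>x. \<chi> k. if k = i then x else A $ k"])
    then have "det (\<chi> k. if k = i then A $ l else A $ k)
        = (\<Sum>j\<in>UNIV. det (\<chi> k. if k = i then A $ l $ j *s axis j 1 else A $ k))"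
      by (simp only: det_linear_row_sum[OF finite, where a = "\<lambda>_ j. A $ l $ j *s axis j 1"])
    also have "\<dots> = (A ** C) $ l $ i"
      by (simp add: det_row_mul[where a = "\<lambda>_. axis _ 1"] C_def matrix_matrix_mult_def)
    finally have eq: "(A ** C) $ l $ i = det (\<chi> k. if k = i then A $ l else A $ k)" ..
    show ?thesis
    proof (cases "l = i")
      case True
      then have "(\<chi> k. if k = i then A $ l else A $ k) = A"
        by (simp add: vec_eq_iff)
      then show ?thesis
        using True eq by simp
    next
      case False
      then have "det (\<chi> k. if k = i then A $ l else A $ k) = 0"
        by (intro det_identical_rows[of l i]) (auto simp: row_def)
      then show ?thesis
        using False eq by simp
    qed
  qed
  then have "A ** (\<chi> j i. ring_inv (det A) * C $ j $ i) = mat 1"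
    using ring_inv_left[OF assms]
    by (simp add: vec_eq_iff matrix_matrix_mult_def mat_def mult.left_commute[of _ "ring_inv _"]
        flip: sum_distrib_left)
  then show ?thesis ..
qed

lemma right_inverse_imp_det_unit:
  fixes A :: "'a::comm_ring_1 ^ 'n ^ 'n"
  assumes "A ** B = mat 1"
  shows "det A dvd 1"
  using assms by (metis det_I det_mul dvd_triv_left)

text \<open>\<open>B\<close> has unit determinant and thus a right inverse of its own, which must be
  \<open>A\<close>.\<close>

lemma right_inverse_imp_left_inverse:
  fixes A :: "'a::comm_ring_1 ^ 'n ^ 'n"
  assumes "A ** B = mat 1"
  shows "B ** A = mat 1"
proof -
  have "det B dvd 1"
    using assms by (metis det_I det_mul dvd_triv_right)
  then obtain C where C: "B ** C = mat 1"
    using matrix_right_inverse_exists by blast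
  have "A = A ** (B ** C)"
    by (simp add: C)
  also have "\<dots> = C"
    by (simp add: matrix_mul_assoc assms)
  finally show ?thesis
    using C by simp
qed

lemma invertible_iff_det_unit:
  fixes A :: "'a::comm_ring_1 ^ 'n ^ 'n"
  shows "invertible A \<longleftrightarrow> det A dvd 1"
  unfolding invertible_def
  using matrix_right_inverse_exists right_inverse_imp_det_unit right_inverse_imp_left_inverse by blast

lemma matrix_inv_eqI:
  fixes A :: "'a::comm_ring_1 ^ 'n ^ 'n"
  assumes "A ** B = mat 1"
  shows "matrix_inv A = B"
proof -
  have "A ** matrix_inv A = mat 1 \<and> matrix_inv A ** A = mat 1"
    unfolding matrix_inv_def
    by (rule someI[of _ B]) (simp add: assms right_inverse_imp_left_inverse)
  then have "matrix_inv A = matrix_inv A ** (A ** B)" "matrix_inv A ** A = mat 1"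
    by (simp_all add: assms)
  then show ?thesis
    by (simp add: matrix_mul_assoc)
qed

lemma
  fixes A :: "'a::comm_ring_1 ^ 'n ^ 'n"
  assumes "det A dvd 1"
  shows matrix_inv_right': "A ** matrix_inv A = mat 1"
    and matrix_inv_left': "matrix_inv A ** A = mat 1"
proof -
  obtain B where "A ** B = mat 1"
    using matrix_right_inverse_exists[OF assms] by blast
  then show "A ** matrix_inv A = mat 1" "matrix_inv A ** A = mat 1"
    using matrix_inv_eqI right_inverse_imp_left_inverse by metis+
qed

lemma GL_iff: "A \<in> GL \<longleftrightarrow> det A dvd 1"
  by (simp add: GL_def invertible_iff_det_unit)

lemma det_matrix_inv:
  fixes A :: "'a::comm_ring_1 ^ 'n ^ 'n"
  assumes "det A dvd 1"
  shows "det (matrix_inv A) = ring_inv (det A)" "det (matrix_inv A) dvd 1"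
proof -
  have "det A * det (matrix_inv A) = 1"
    using matrix_inv_right'[OF assms] by (metis det_I det_mul)
  then show "det (matrix_inv A) = ring_inv (det A)" "det (matrix_inv A) dvd 1"
    by (metis ring_inv_eqI, metis dvd_triv_right)
qed

section \<open>Scalar multiples, and matrices under ring homomorphisms\<close>

lemma smat_nth [simp]: "smat c A $ i $ j = c * A $ i $ j"
  by (simp add: smat_def)

lemma smat_1 [simp]: "smat 1 A = A"
  by (simp add: vec_eq_iff)

lemma smat_smat [simp]: "smat c (smat d A) = smat (c * d) A"
  by (simp add: vec_eq_iff mult.assoc)

lemma smat_add: "smat c (A + B) = smat c A + smat c B"
  and smat_diff: "smat c (A - B) = smat c A - smat c B"
  and smat_diff_scalar: "smat (c - d) A = smat c A - smat d A"
  by (simp_all add: vec_eq_iff algebra_simps)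

lemma smat_mult_left [simp]: "smat c A ** B = smat c (A ** B)"
  and smat_mult_right [simp]: "A ** smat c B = smat c (A ** B)"
  by (simp_all add: vec_eq_iff matrix_matrix_mult_def sum_distrib_left mult.assoc
      mult.left_commute)

lemma matrix_diff_rdistrib: "(A - B) ** C = A ** C - B ** C"
  for A B C :: "'a::comm_ring_1 ^ 'n ^ 'n"
  by (simp add: vec_eq_iff matrix_matrix_mult_def sum_subtractf algebra_simps)

lemma matrix_add_rdistrib: "(A + B) ** C = A ** C + B ** C"
  for A B C :: "'a::comm_ring_1 ^ 'n ^ 'n"
  by (simp add: vec_eq_iff matrix_matrix_mult_def sum.distrib distrib_right)

lemma matrix_inv_smat:
  fixes A :: "'a::comm_ring_1 ^ 'n ^ 'n"
  assumes "c dvd 1" "det A dvd 1"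
  shows "matrix_inv (smat c A) = smat (ring_inv c) (matrix_inv A)"
  by (rule matrix_inv_eqI) (simp add: matrix_inv_right' assms ring_inv_left ring_inv_right)

lemma smat_mat_1_inject:
  assumes "smat c (mat 1 :: 'a::comm_ring_1 ^ 'n ^ 'n) = smat d (mat 1)"
  shows "c = d"
proof -
  have "smat c (mat 1 :: 'a ^ 'n ^ 'n) $ i $ i = smat d (mat 1) $ i $ i" for i
    by (simp only: assms)
  then show ?thesis
    by (simp add: mat_def)
qed

lemma det_smat: "det (smat c (A :: 'a::comm_ring_1 ^ 'n ^ 'n)) = c ^ CARD('n) * det A"
proof -
  have "smat c A = (\<chi> i. c *s A $ i)"
    by (simp add: vec_eq_iff)
  then show ?thesis
    by (simp add: det_rows_mul[of "\<lambda>_. c" "($) A"])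
qed

lemma map_matrix_mat:
  assumes "is_ring_hom h"
  shows "map_matrix h (mat 1) = mat 1"
  by (simp add: vec_eq_iff mat_def is_ring_hom_simps[OF assms])

lemma map_matrix_mult:
  assumes "is_ring_hom h"
  shows "map_matrix h (A ** B) = map_matrix h A ** map_matrix h B"
  by (simp add: vec_eq_iff matrix_matrix_mult_def is_ring_hom_simps[OF assms])

lemma map_matrix_smat:
  assumes "is_ring_hom h"
  shows "map_matrix h (smat c A) = smat (h c) (map_matrix h A)"
  by (simp add: vec_eq_iff is_ring_hom_mult[OF assms])

lemma map_matrix_diff:
  assumes "is_ring_hom h"
  shows "map_matrix h (A - B) = map_matrix h A - map_matrix h B"
  by (simp add: vec_eq_iff is_ring_hom_diff[OF assms])

lemma map_matrix_comp: "map_matrix f (map_matrix g A) = map_matrix (f \<circ> g) A"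
  by (simp add: vec_eq_iff)

lemma map_matrix_inv:
  assumes h: "is_ring_hom h" and A: "det A dvd 1"
  shows "map_matrix h (matrix_inv A) = matrix_inv (map_matrix h A)"
  by (rule matrix_inv_eqI[symmetric])
    (simp add: matrix_inv_right'[OF A] map_matrix_mat[OF h] flip: map_matrix_mult[OF h])

lemma map_matrix_ppow:
  fixes h :: "'a::with_prime \<Rightarrow> 'b::with_prime"
  assumes "is_ring_hom h" "base_prime TYPE('b) = base_prime TYPE('a)"
  shows "map_matrix h (ppow_mat A) = ppow_mat (map_matrix h A)"
  by (simp add: vec_eq_iff ppow_mat_def is_ring_hom_power[OF assms(1)] assms(2))

section \<open>The Frobenius endomorphism modulo \<open>p\<close>\<close>

text \<open>Kept apart from completeness, so that the congruences of this part hold in coordinate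
  rings before completion as well.\<close>

class odd_prime = with_prime +
  assumes prime_base_prime: "prime (base_prime TYPE('a))"
    and odd_base_prime: "odd (base_prime TYPE('a))"

instance frobenius_dvr \<subseteq> odd_prime
  by standard (rule base_prime_prime, rule base_prime_odd)

instance padic :: (odd_prime) odd_prime
  by standard (simp_all add: prime_base_prime odd_base_prime)

instance coord :: (affine_scheme, odd_prime) odd_prime
  by standard (simp_all add: prime_base_prime odd_base_prime)

lemma base_prime_pos [simp]: "0 < base_prime TYPE('a::odd_prime)"
  by (rule prime_gt_0_nat[OF prime_base_prime])

lemma frobenius_cong_add:
  fixes a b :: "'a::odd_prime"
  shows "pelt dvd (a + b) ^ base_prime TYPE('a) - (a ^ base_prime TYPE('a) + b ^ base_prime TYPE('a))"
proof -
  define p where "p = base_prime TYPE('a)"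
  have p: "prime p"
    by (simp add: p_def prime_base_prime)
  then have "p > 0"
    by (rule prime_gt_0_nat)
  then have "{..p} = insert 0 (insert p {1..<p})"
    by auto
  then have "(a + b) ^ p - (a ^ p + b ^ p) = (\<Sum>k\<in>{1..<p}. of_nat (p choose k) * a ^ k * b ^ (p - k))"
    using \<open>p > 0\<close> by (simp add: binomial_ring)
  moreover have "(of_nat p :: 'a) dvd of_nat (p choose k)" if "k \<in> {1..<p}" for k
    using dvd_choose_prime[OF _ _ _ p, of k] that by (auto simp: dvd_def)
  ultimately show ?thesis
    unfolding p_def[symmetric] by (auto intro!: dvd_sum)
qed

lemma frobenius_cong_sum:
  fixes f :: "'i \<Rightarrow> 'a::odd_prime"
  shows "pelt dvd (sum f I) ^ base_prime TYPE('a) - (\<Sum>i\<in>I. f i ^ base_prime TYPE('a))"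
proof (induction I rule: infinite_finite_induct)
  case (insert i I)
  then show ?case
    using dvd_diff_trans[OF frobenius_cong_add dvd_diff_add[OF _ insert(3)]]
    by simp
qed (simp_all add: zero_power)

lemma of_int_sign_power: "odd m \<Longrightarrow> of_int (sign q) ^ m = (of_int (sign q) :: 'a::comm_ring_1)"
  by (simp add: sign_def)

text \<open>The Leibniz formula raised to the p-th power term by term; since p is odd, signs are
  their own p-th powers.\<close>

lemma frobenius_cong_det:
  fixes A :: "'a::odd_prime ^ 'n ^ 'n"
  shows "pelt dvd det (ppow_mat A) - det A ^ base_prime TYPE('a)"
proof -
  have "det (ppow_mat A) = (\<Sum>q\<in>{q. q permutes UNIV}.
      (of_int (sign q) * (\<Prod>i\<in>UNIV. A $ i $ q i)) ^ base_prime TYPE('a))"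
    unfolding det_def ppow_mat_def
    by (simp add: power_mult_distrib prod_power_distrib of_int_sign_power odd_base_prime)
  then show ?thesis
    using dvd_diff_sym[OF frobenius_cong_sum] unfolding det_def by simp
qed

section \<open>The Frobenius lift of the base ring\<close>

lemma frob_of_nat: "frob (of_nat m :: 'r::frobenius_dvr) = of_nat m"
  by (rule is_ring_hom_of_nat[OF frob_hom])

text \<open>A nonzero element is a unit times a power of p, and \<open>frob\<close> fixes p and
  preserves units.\<close>

lemma inj_frob: "inj (frob :: 'r::frobenius_dvr \<Rightarrow> 'r)"
proof (rule injI, rule ccontr)
  fix a b :: 'r
  assume eq: "frob a = frob b" and "a \<noteq> b"
  then obtain u k where u: "u dvd 1" "a - b = u * pelt ^ k"
    using pelt_uniformizer[of "a - b"] by auto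
  have "frob (a - b) = 0"
    by (simp add: is_ring_hom_diff[OF frob_hom] eq)
  then have "frob u * pelt ^ k = 0"
    unfolding u(2) by (simp add: frob_mult is_ring_hom_power[OF frob_hom] frob_of_nat)
  then have "frob u = 0"
    by (simp add: pelt_nonzero)
  then show False
    using is_ring_hom_unit[OF frob_hom u(1)] by simp
qed

text \<open>The residue field has p-th roots, so every element is a value of \<open>frob\<close> up
  to a multiple of p; iterating on the remainder gives a convergent preimage.\<close>

lemma surj_frob: "surj (frob :: 'r::frobenius_dvr \<Rightarrow> 'r)"
proof -
  have approx: "\<exists>a c. b = frob a + pelt * c" for b :: 'r
  proof -
    let ?p = "base_prime TYPE('r)"
    have p: "?p > 0"
      by (rule base_prime_pos)
    \<comment> \<open>The monic polynomial is \<open>X^p - b\<close>, with all of its lower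
      coefficients zero except the constant one.\<close>
    obtain x where x: "pelt dvd x ^ ?p + (\<Sum>k<?p. (if k = 0 then - b else 0) * x ^ k)"
      using residue_field_alg_closed[OF p, of "\<lambda>k. if k = 0 then - b else 0"] by blast
    have "(\<Sum>k<?p. (if k = 0 then - b else 0) * x ^ k) = (\<Sum>k<?p. if k = 0 then - b else 0)"
      by (intro sum.cong) auto
    also have "\<dots> = - b"
      using p by simp
    finally have "pelt dvd x ^ ?p - b"
      using x by simp
    with frob_lift[of x] have "pelt dvd frob x - b"
      by (rule dvd_diff_trans)
    then obtain c where "b - frob x = pelt * c"
      by (metis dvd_diff_sym dvdE)
    then show ?thesis
      by (intro exI[of _ x] exI[of _ c]) (simp add: algebra_simps)
  qed
  then obtain r q :: "'r \<Rightarrow> 'r" where rq: "\<And>b. b = frob (r b) + pelt * q b"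
    by metis
  have "\<exists>a. frob a = b" for b :: 'r
  proof -
    \<comment> \<open>\<open>q\<close> iterated m times is the remainder after m rounds, and
      \<open>r\<close> of it is the next digit of the preimage.\<close>
    define f where "f m = pelt ^ m * r ((q ^^ m) b)" for m
    obtain s where s: "\<And>k. pelt ^ k dvd s - (\<Sum>i<k. f i)"
      using padic_sums_exists[of f] by (auto simp: f_def)
    have rest: "b = frob (\<Sum>i<k. f i) + pelt ^ k * (q ^^ k) b" for k
    proof (induction k)
      case 0
      show ?case by (simp add: is_ring_hom_0[OF frob_hom])
    next
      case (Suc k)
      have "pelt ^ k * (q ^^ k) b = pelt ^ k * (frob (r ((q ^^ k) b)) + pelt * q ((q ^^ k) b))"
        by (subst rq[of "(q ^^ k) b"]) simp
      then show ?case
        by (subst Suc) (simp add: f_def frob_add frob_mult is_ring_hom_power[OF frob_hom]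
            frob_of_nat algebra_simps)
    qed
    have "frob s = b"
    proof (rule padic_eqI)
      fix k
      have "pelt ^ k dvd frob s - frob (\<Sum>i<k. f i)"
        by (rule is_ring_hom_dvd_diff[OF frob_hom s])
      moreover have "pelt ^ k dvd frob (\<Sum>i<k. f i) - b"
      proof (rule dvd_diff_sym)
        show "pelt ^ k dvd b - frob (\<Sum>i<k. f i)"
          using rest[of k] by (metis add_diff_cancel_left' dvd_triv_left)
      qed
      ultimately show "pelt ^ k dvd frob s - b"
        by (rule dvd_diff_trans)
    qed
    then show ?thesis ..
  qed
  then show ?thesis
    by (metis surjI surj_def)
qed

lemma frob_inv_frob: "frob (inv frob a) = (a :: 'r::frobenius_dvr)"
  by (rule surj_f_inv_f[OF surj_frob])

lemma inv_frob_frob: "inv frob (frob a) = (a :: 'r::frobenius_dvr)"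
  by (rule inv_f_f[OF inj_frob])

lemma is_ring_hom_inv_frob: "is_ring_hom (inv frob :: 'r::frobenius_dvr \<Rightarrow> 'r)"
  unfolding is_ring_hom_def
proof (intro conjI allI)
  fix a b :: 'r
  show "inv frob (a + b) = inv frob a + inv frob b" "inv frob (a * b) = inv frob a * inv frob b"
    "inv frob 1 = (1 :: 'r)"
    using inv_frob_frob[of "inv frob a + inv frob b"] inv_frob_frob[of "inv frob a * inv frob b"]
      inv_frob_frob[of 1]
    by (simp_all add: frob_add frob_mult frob_inv_frob frob_one)
qed

section \<open>Coordinates on \<open>GL\<^sub>n\<close> and \<open>G\<close>\<close>

type_synonym ('n, 'r) gl_hat = "('n gl_var, 'r) hat_ring"
type_synonym ('n, 'r) gl_mat = "('n gl_var, 'r) hat_ring ^ 'n ^ 'n"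
type_synonym ('n, 'r) gl2_hat = "('n gl_var + 'n gl_var, 'r) hat_ring"
type_synonym ('n, 'r) g_hat = "('n g_var, 'r) hat_ring"
type_synonym ('n, 'r) g_mat = "('n g_var, 'r) hat_ring ^ 'n ^ 'n"
type_synonym ('n, 'r) g_upoint = "('n, ('n g_var, 'r) hat_ring) g_point"

lemma gl_coords_simps [simp]:
  "gl_coords A (Entry i j) = A $ i $ j" "gl_coords A DetInv = ring_inv (det A)"
  by (simp_all add: gl_coords_def)

lemma g_coords_simps [simp]:
  "g_coords g (GEntry i j) = fst g $ i $ j" "g_coords g GDetInv = ring_inv (det (fst g))"
  "g_coords g GScal = snd g" "g_coords g GScalInv = ring_inv (snd g)"
  by (simp_all add: g_coords_def)

lemma solves_gl_coords: "det A dvd 1 \<Longrightarrow> solves (gl_coords A)"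
  by (simp add: solves_gl ring_inv_right)

lemma solves_g_coords:
  fixes g :: "('n::finite, 'b::comm_ring_1) g_point"
  assumes "det (fst g) dvd 1" "snd g dvd 1" "(det (fst g))\<^sup>2 = snd g ^ CARD('n)"
  shows "solves (g_coords g)"
  using assms by (simp add: solves_g ring_inv_right)

lemma det_gl_univ: "det gl_univ * crd DetInv = (1 :: ('n::finite, 'r::with_prime) gl_hat)"
  using solves_crd[where 'v = "'n gl_var" and 'r = 'r] by (simp add: solves_gl gl_univ_def)

lemma unit_det_gl_univ [simp]: "det (gl_univ :: ('n::finite, 'r::with_prime) gl_mat) dvd 1"
  by (metis det_gl_univ dvd_triv_left)

lemma g_univ_relations:
  fixes g :: "('n::finite, 'r::with_prime) g_upoint"
  assumes "g = g_univ"
  shows "det (fst g) * crd GDetInv = 1" "snd g * crd GScalInv = 1"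
    "(det (fst g))\<^sup>2 = snd g ^ CARD('n)"
  using solves_crd[where 'v = "'n g_var" and 'r = 'r] unfolding assms
  by (simp_all add: solves_g g_univ_def)

lemma unit_g_univ [simp]:
  "det (fst (g_univ :: ('n::finite, 'r::with_prime) g_upoint)) dvd 1"
  "snd (g_univ :: ('n::finite, 'r::with_prime) g_upoint) dvd 1"
  by (metis g_univ_relations(1) dvd_triv_left, metis g_univ_relations(2) dvd_triv_left)

section \<open>Absence of \<open>p\<close>-torsion on \<open>GL\<^sub>n\<close>\<close>

lemma lookup_of_nat_mult:
  "Poly_Mapping.lookup (of_nat k * f) m = of_nat k * Poly_Mapping.lookup f m"
  for f :: "('v, 'c::comm_ring_1) mpol"
  by (induction k) (simp_all add: lookup_add algebra_simps)

lemma of_nat_dvd_mpol: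
  fixes f :: "('v, 'c::comm_ring_1) mpol"
  assumes "\<And>m. of_nat k dvd Poly_Mapping.lookup f m"
  shows "of_nat k dvd f"
proof -
  obtain q where q: "\<And>m. Poly_Mapping.lookup f m = of_nat k * q m"
    using assms unfolding dvd_def by metis
  have "f = of_nat k * Poly_Mapping.mapp (\<lambda>m _. q m) f"
    by (rule poly_mapping_eqI)
      (simp add: lookup_of_nat_mult lookup_mapp when_def in_keys_iff flip: q)
  then show ?thesis
    by (metis dvd_triv_left)
qed

lemma lookup_pvar_power_mult:
  assumes "Poly_Mapping.lookup m v < N"
  shows "Poly_Mapping.lookup (pvar v ^ N * f) m = (0 :: 'c::comm_ring_1)"
proof (induction f rule: poly_mapping_single_induct)
  case (2 m' c f)
  have "pvar v ^ N = Poly_Mapping.single (Poly_Mapping.single v N) (1 :: 'c)" for N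
    by (induction N) (simp_all add: pvar_def mult_single flip: single_add)
  then have "pvar v ^ N * Poly_Mapping.single m' c = Poly_Mapping.single (Poly_Mapping.single v N + m') c"
    by (simp add: mult_single)
  moreover have "Poly_Mapping.single v N + m' \<noteq> m"
    using assms by (auto simp: lookup_add)
  ultimately show ?case
    using 2 by (simp add: distrib_left lookup_add lookup_single)
qed simp

text \<open>If \<open>p\<close> divides \<open>g (1 - y D)\<close> then \<open>g\<close> is congruent to \<open>g y\<^sup>N D\<^sup>N\<close> for every \<open>N\<close>, and all
  monomials of the latter have degree at least \<open>N\<close> in \<open>y\<close>.\<close>

lemma dvd_mpol_cancel:
  fixes g D :: "('v, 'c::comm_ring_1) mpol"
  assumes dvd: "of_nat k dvd g * (D * pvar v - 1)"
  shows "of_nat k dvd g"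
proof (rule of_nat_dvd_mpol)
  fix m
  \<comment> \<open>A bound above the degree in \<open>v\<close> of every monomial of
    \<open>g\<close>.\<close>
  define N where "N = Suc (\<Sum>m\<in>Poly_Mapping.keys g. Poly_Mapping.lookup m v)"
  have step: "of_nat k dvd g * (D * pvar v) ^ N - g" for N
  proof (induction N)
    case (Suc N)
    have "of_nat k dvd (g * (D * pvar v - 1)) * (D * pvar v) ^ N"
      using dvd by (rule dvd_mult2)
    also have "(g * (D * pvar v - 1)) * (D * pvar v) ^ N = g * (D * pvar v) ^ Suc N - g * (D * pvar v) ^ N"
      by (simp add: algebra_simps)
    finally show ?case
      using Suc by (rule dvd_diff_trans)
  qed simp
  obtain q where "g * (D * pvar v) ^ N - g = of_nat k * q"
    using step[of N] by (elim dvdE)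
  then have q: "g = pvar v ^ N * (g * D ^ N) - of_nat k * q"
    by (simp add: algebra_simps power_mult_distrib)
  show "of_nat k dvd Poly_Mapping.lookup g m"
  proof (cases "m \<in> Poly_Mapping.keys g")
    case True
    then have "Poly_Mapping.lookup m v < N"
      unfolding N_def less_Suc_eq_le by (intro member_le_sum) auto
    then show ?thesis
      by (subst q) (simp add: lookup_minus lookup_pvar_power_mult lookup_of_nat_mult)
  qed (simp add: in_keys_iff)
qed

lemma gl_scheme_ideal:
  "f \<in> (scheme_ideal :: ('n::finite gl_var, 'r::comm_ring_1) mpol set) \<longleftrightarrow>
    (\<exists>g. f = g * (det (\<chi> i j. pvar (Entry i j)) * pvar DetInv - 1))"
proof -
  let ?e = "det (\<chi> i j. pvar (Entry i j) :: ('n gl_var, 'r) mpol ^ 'n ^ 'n) * pvar DetInv - 1"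
  note hom = is_ring_hom_poly_eval[OF is_ring_hom_pconst, of pvar]
  have "map_matrix (poly_eval (\<lambda>k. pconst (of_int k)) pvar) (\<chi> i j. pvar (Entry i j))
      = (\<chi> i j. pvar (Entry i j) :: ('n gl_var, 'r) mpol ^ 'n ^ 'n)"
    by (simp add: vec_eq_iff poly_eval_pvar[OF is_ring_hom_pconst])
  then have "poly_eval (\<lambda>k. pconst (of_int k)) pvar ` eqns = {?e}"
    by (simp add: eqns_gl_var_def is_ring_hom_simps[OF hom] poly_eval_pvar[OF is_ring_hom_pconst])
  then have ideal: "scheme_ideal = module.span (*) {?e}"
    by (simp add: scheme_ideal_def gen_ideal_def)
  have "\<exists>g. f = g * ?e" if "f \<in> module.span (*) {?e}"
    using that
  proof (induction rule: module.span_induct_alt[OF module_mult, consumes 1])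
    case 1
    show ?case
      by (rule exI[of _ 0]) simp
  next
    case (2 c x y)
    then obtain g where "y = g * ?e"
      by blast
    with 2(1) show ?case
      by (intro exI[of _ "c + g"]) (simp add: distrib_right)
  qed
  moreover have "g * ?e \<in> module.span (*) {?e}" for g
    by (intro module.span_scale[OF module_mult] module.span_base[OF module_mult]) simp
  ultimately show ?thesis
    unfolding ideal by blast
qed

text \<open>If \<open>p f = g e\<close> with the equation \<open>e\<close>, then p divides
  \<open>g\<close>, because \<open>e\<close> is not a zero divisor modulo p; cancelling p in the
  polynomial ring puts \<open>f\<close> in the ideal.\<close>

lemma gl_coord_cancel:
  fixes F :: "('n::finite gl_var, 'r::frobenius_dvr) coord"
  assumes "pelt * F = 0"
  shows "F = 0"
proof -
  let ?p = "base_prime TYPE('r)"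
  let ?e = "det (\<chi> i j. pvar (Entry i j) :: ('n gl_var, 'r) mpol ^ 'n ^ 'n) * pvar DetInv - 1"
  obtain f where f: "F = abs_coord f"
    by (rule abs_coord_cases)
  have "abs_coord (of_nat ?p * f) = abs_coord 0"
    using assms unfolding f
    by (simp add: is_ring_hom_simps[OF is_ring_hom_abs_coord])
  then have "of_nat ?p * f \<in> scheme_ideal"
    by (simp add: coord.abs_eq_iff coord_rel_def)
  then obtain g where g: "of_nat ?p * f = g * ?e"
    using gl_scheme_ideal by blast
  then have "of_nat ?p dvd g * ?e"
    by (metis dvd_triv_left)
  then obtain h where h: "g = of_nat ?p * h"
    using dvd_mpol_cancel by (metis dvdE)
  have "of_nat ?p * (f - h * ?e) = 0"
    using g unfolding h by (simp add: algebra_simps)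
  then have "Poly_Mapping.lookup (of_nat ?p * (f - h * ?e)) m = 0" for m
    by simp
  then have "f - h * ?e = 0"
    using pelt_nonzero[where 'a = 'r] by (intro poly_mapping_eqI) (simp add: lookup_of_nat_mult)
  then have "f - 0 \<in> scheme_ideal"
    unfolding gl_scheme_ideal by (intro exI[of _ h]) simp
  then have "abs_coord f = abs_coord 0"
    by (simp only: coord.abs_eq_iff coord_rel_def)
  then show ?thesis
    by (simp add: f is_ring_hom_0[OF is_ring_hom_abs_coord])
qed

text \<open>Cancelling p costs one power: an approximation modulo \<open>p^(k+1)\<close> is needed
  to conclude modulo \<open>p^k\<close>.\<close>

lemma padic_cancel:
  fixes F :: "'a::with_prime padic"
  assumes cancel: "\<And>a :: 'a. pelt * a = 0 \<Longrightarrow> a = 0" and F: "pelt * F = 0"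
  shows "F = 0"
proof (rule padic_separated)
  fix k
  obtain f where f: "pelt ^ Suc k dvd F - to_hat f"
    using to_hat_approx by blast
  have "pelt ^ Suc k dvd pelt * F - pelt * to_hat f"
    using dvd_mult[OF f, of pelt] by (simp only: right_diff_distrib)
  then have "pelt ^ Suc k dvd pelt * to_hat f"
    by (simp only: F) simp
  also have "pelt * to_hat f = to_hat (pelt * f)"
    by (simp add: is_ring_hom_simps[OF is_ring_hom_to_hat])
  finally have "pelt ^ Suc k dvd pelt * f"
    by (simp only: to_hat_dvd_iff)
  then obtain c where "pelt * f = pelt ^ Suc k * c"
    by (elim dvdE)
  then have "pelt * (f - pelt ^ k * c) = 0"
    by (simp add: algebra_simps)
  then have "f = pelt ^ k * c"
    using cancel by fastforce
  then have "pelt ^ k dvd to_hat f - 0"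
    by (simp add: to_hat_dvd_iff[unfolded base_prime_padic])
  with dvd_pelt_power_le[OF f, of k] show "of_nat (base_prime TYPE('a padic)) ^ k dvd F"
    by (metis base_prime_padic diff_zero dvd_diff_trans le_SucI order_refl)
qed

lemma gl_hat_cancel:
  fixes F :: "('n::finite, 'r::frobenius_dvr) gl_hat"
  shows "pelt * F = 0 \<Longrightarrow> F = 0"
  by (rule padic_cancel) (rule gl_coord_cancel)

lemma pdiv_eqI:
  assumes "\<And>a :: 'a::with_prime. pelt * a = 0 \<Longrightarrow> a = 0" and "pelt * b = (a :: 'a)"
  shows "pdiv a = b"
  unfolding pdiv_def
proof (rule the_equality)
  fix c
  assume "pelt * c = a"
  with assms(2) have "pelt * (c - b) = 0"
    by (simp add: algebra_simps)
  then show "c = b"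
    using assms(1) by fastforce
qed (rule assms(2))

section \<open>Functions on \<open>GL\<^sub>n\<close> inside functions on \<open>G\<close>\<close>

text \<open>The ring of functions on \<open>G\<close> is \<open>O(GL\<^sub>n)[t]/(t\<^sup>n - det\<^sup>2)\<close>. It is written as a quotient of Laurent
  polynomials in \<open>t\<close>, and the coefficient of \<open>t\<^sup>0\<close> modulo \<open>t\<^sup>n = det\<^sup>2\<close> is a retraction.\<close>

type_synonym ('n, 'r) laurent = "int \<Rightarrow>\<^sub>0 ('n gl_var, 'r) coord"

definition gl_det_power :: "int \<Rightarrow> ('n::finite gl_var, 'r::comm_ring_1) coord" where
  "gl_det_power k = (if k \<ge> 0 then det (\<chi> i j. coord_var (Entry i j)) ^ nat k
     else coord_var DetInv ^ nat (- k))"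

lemma gl_det_coord:
  "det (\<chi> i j. coord_var (Entry i j)) * coord_var DetInv = (1 :: ('n::finite gl_var, 'r::comm_ring_1) coord)"
  using solves_coord_var[where 'v = "'n gl_var" and 'r = 'r] by (simp add: solves_gl)

lemma gl_det_power_0: "gl_det_power 0 = 1"
  by (simp add: gl_det_power_def)

lemma gl_det_power_Suc:
  "gl_det_power (k + 1) = det (\<chi> i j. coord_var (Entry i j)) * (gl_det_power k :: ('n::finite gl_var, 'r::comm_ring_1) coord)"
proof (cases "k \<ge> 0")
  case True
  then show ?thesis
    by (simp add: gl_det_power_def nat_add_distrib)
next
  case False
  have neg: "gl_det_power l = (coord_var DetInv ^ nat (- l) :: ('n gl_var, 'r) coord)" if "l \<le> 0" for l
    using that by (auto simp: gl_det_power_def)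
  have "nat (- k) = Suc (nat (- (k + 1)))"
    using False by linarith
  then have "gl_det_power k = coord_var DetInv * (gl_det_power (k + 1) :: ('n gl_var, 'r) coord)"
    using False by (simp only: neg) simp
  then show ?thesis
    by (simp add: gl_det_coord flip: mult.assoc)
qed

text \<open>The image of \<open>t^k\<close>: it is \<open>det^(2k/n)\<close> if n divides k.
  Otherwise the reduction by \<open>t^n = det^2\<close> ends at a power of t other than
  \<open>t^0\<close>, which the retraction kills.\<close>

definition laurent_weight :: "int \<Rightarrow> ('n::finite gl_var, 'r::comm_ring_1) coord" where
  "laurent_weight k = (if int CARD('n) dvd k then gl_det_power (2 * (k div int CARD('n))) else 0)"

definition laurent_retract :: "('n::finite, 'r::comm_ring_1) laurent \<Rightarrow> ('n gl_var, 'r) coord" where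
  "laurent_retract h = (\<Sum>k\<in>Poly_Mapping.keys h. laurent_weight k * Poly_Mapping.lookup h k)"

lemma laurent_weight_shift:
  "laurent_weight (k + int CARD('n)) =
    (det (\<chi> i j. coord_var (Entry i j)))\<^sup>2 * (laurent_weight k :: ('n::finite gl_var, 'r::comm_ring_1) coord)"
proof -
  have "gl_det_power (j + 2) = (det (\<chi> i j. coord_var (Entry i j)))\<^sup>2 * (gl_det_power j :: ('n gl_var, 'r) coord)" for j
    using gl_det_power_Suc[of "j + 1", where 'n = 'n and 'r = 'r]
      gl_det_power_Suc[of j, where 'n = 'n and 'r = 'r]
    by (simp add: power2_eq_square mult.assoc add.assoc)
  then show ?thesis
    by (simp add: laurent_weight_def distrib_left)
qed

lemma laurent_retract_single: "laurent_retract (Poly_Mapping.single k c) = laurent_weight k * c"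
  by (simp add: laurent_retract_def)

lemma laurent_retract_0: "laurent_retract 0 = 0"
  by (simp add: laurent_retract_def)

lemma laurent_retract_add: "laurent_retract (g + h) = laurent_retract g + laurent_retract h"
proof -
  have *: "laurent_retract h = (\<Sum>k\<in>V. laurent_weight k * Poly_Mapping.lookup h k)"
    if "finite V" "Poly_Mapping.keys h \<subseteq> V" for V and h :: "('n::finite, 'r::comm_ring_1) laurent"
    unfolding laurent_retract_def using that
    by (intro sum.mono_neutral_left) (auto simp: in_keys_iff)
  let ?V = "Poly_Mapping.keys g \<union> Poly_Mapping.keys h"
  show ?thesis
    using Poly_Mapping.keys_add[of g h]
    by (simp add: *[of ?V] lookup_add distrib_left sum.distrib)
qed

text \<open>Raising the exponent of t by n multiplies the weight by \<open>det^2\<close>, so the two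
  terms of the relation cancel.\<close>

lemma laurent_retract_relation:
  fixes h :: "('n::finite, 'r::comm_ring_1) laurent"
  shows "laurent_retract (h * (Poly_Mapping.single 0 ((det (\<chi> i j. coord_var (Entry i j)))\<^sup>2)
    - Poly_Mapping.single (int CARD('n)) 1)) = 0"
proof (induction h rule: poly_mapping_single_induct)
  case 1
  show ?case
    by (simp add: laurent_retract_0)
next
  case (2 k c h)
  let ?D = "(det (\<chi> i j. coord_var (Entry i j)))\<^sup>2 :: ('n gl_var, 'r) coord"
  let ?z = "Poly_Mapping.single 0 ?D - Poly_Mapping.single (int CARD('n)) 1"
  have "Poly_Mapping.single k c * ?z
      = Poly_Mapping.single k (c * ?D) + Poly_Mapping.single (k + int CARD('n)) (- c)"
    by (simp add: right_diff_distrib mult_single single_uminus)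
  then have "laurent_retract (Poly_Mapping.single k c * ?z) = 0"
    by (simp only: laurent_retract_add laurent_retract_single laurent_weight_shift)
      (simp add: ac_simps)
  with 2 show ?case
    by (simp only: distrib_right laurent_retract_add add_0_left)
qed

definition laurent_coords :: "'n g_var \<Rightarrow> ('n::finite, 'r::comm_ring_1) laurent" where
  "laurent_coords v = (case v of GEntry i j \<Rightarrow> Poly_Mapping.single 0 (coord_var (Entry i j))
     | GDetInv \<Rightarrow> Poly_Mapping.single 0 (coord_var DetInv)
     | GScal \<Rightarrow> Poly_Mapping.single 1 1 | GScalInv \<Rightarrow> Poly_Mapping.single (- 1) 1)"

definition laurent_eval :: "('n::finite g_var, 'r::comm_ring_1) mpol \<Rightarrow> ('n, 'r) laurent" where
  "laurent_eval = poly_eval (Poly_Mapping.single 0 \<circ> coord_const) laurent_coords"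

lemma is_ring_hom_single_0: "is_ring_hom (Poly_Mapping.single 0 :: 'a::comm_ring_1 \<Rightarrow> int \<Rightarrow>\<^sub>0 'a)"
  by (simp add: is_ring_hom_def single_add mult_single)

lemma is_ring_hom_laurent_eval:
  "is_ring_hom (laurent_eval :: ('n::finite g_var, 'r::comm_ring_1) mpol \<Rightarrow> _)"
  unfolding laurent_eval_def
  by (intro is_ring_hom_poly_eval is_ring_hom_comp is_ring_hom_single_0 is_ring_hom_coord_const)

lemma single_1_power: "Poly_Mapping.single k (1 :: 'a::comm_ring_1) ^ m = Poly_Mapping.single (int m * k) 1"
  by (induction m) (simp_all add: mult_single algebra_simps)

lemma laurent_retract_scheme_ideal:
  fixes f :: "('n::finite g_var, 'r::comm_ring_1) mpol"
  assumes "f \<in> scheme_ideal"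
  shows "laurent_retract (laurent_eval f) = 0"
proof -
  let ?D = "det (\<chi> i j. coord_var (Entry i j)) :: ('n gl_var, 'r) coord"
  note hom = is_ring_hom_laurent_eval[where 'n = 'n and 'r = 'r]
  have eval: "laurent_eval (poly_eval (\<lambda>k. pconst (of_int k)) pvar e) = poly_eval of_int laurent_coords e"
    for e :: "('n g_var, int) mpol"
    unfolding laurent_eval_def
    by (intro poly_eval_base_change is_ring_hom_comp is_ring_hom_single_0 is_ring_hom_coord_const)
  note ev = is_ring_hom_poly_eval[OF is_ring_hom_eq_of_int, of "laurent_coords :: 'n g_var \<Rightarrow> ('n, 'r) laurent"]
  have "map_matrix (poly_eval of_int laurent_coords) (\<chi> i j. pvar (GEntry i j))
      = map_matrix (Poly_Mapping.single (0 :: int)) (\<chi> i j. coord_var (Entry i j) :: ('n gl_var, 'r) coord ^ 'n ^ 'n)"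
    by (simp add: vec_eq_iff poly_eval_pvar[OF is_ring_hom_eq_of_int] laurent_coords_def)
  then have det: "poly_eval of_int laurent_coords (det (\<chi> i j. pvar (GEntry i j)))
      = Poly_Mapping.single (0 :: int) ?D"
    by (simp add: is_ring_hom_det[OF ev] is_ring_hom_det[OF is_ring_hom_single_0])
  \<comment> \<open>The two invertibility equations already hold for Laurent polynomials; only
    \<open>det^2 = t^n\<close> leaves a nonzero element.\<close>
  have "poly_eval of_int laurent_coords e \<in>
      {0, Poly_Mapping.single 0 (?D\<^sup>2) - Poly_Mapping.single (int CARD('n)) 1}"
    if "e \<in> eqns" for e :: "('n g_var, int) mpol"
    using that unfolding eqns_g_var_def Let_def
    by (auto simp: is_ring_hom_simps(1-6)[OF ev] det poly_eval_pvar[OF is_ring_hom_eq_of_int]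
        laurent_coords_def mult_single gl_det_coord single_1_power
        is_ring_hom_power[OF is_ring_hom_single_0])
  \<comment> \<open>The retraction is additive but not multiplicative, so a generator has to be
    treated together with an arbitrary multiplier.\<close>
  then have "laurent_retract (h * poly_eval of_int laurent_coords e) = 0"
    if "e \<in> eqns" for h :: "('n, 'r) laurent" and e
    using that laurent_retract_relation[of h] laurent_retract_0
    by (metis (no_types, lifting) empty_iff insert_iff mult_zero_right)
  then have gen: "laurent_retract (h * laurent_eval x) = 0"
    if "x \<in> poly_eval (\<lambda>k. pconst (of_int k)) pvar ` eqns" for h and x :: "('n g_var, 'r) mpol"
    using that by (auto simp: eval)
  show ?thesis
    using assms unfolding scheme_ideal_def gen_ideal_def
  proof (induction rule: module.span_induct_alt[OF module_mult, consumes 1])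
    case 1
    show ?case
      by (simp add: is_ring_hom_0[OF hom] laurent_retract_0)
  next
    case (2 c x y)
    then show ?case
      by (simp add: is_ring_hom_simps[OF hom] laurent_retract_add gen)
  qed
qed

definition g_retract :: "('n::finite g_var, 'r::comm_ring_1) coord \<Rightarrow> ('n gl_var, 'r) coord" where
  "g_retract F = laurent_retract (laurent_eval (rep_coord F))"

lemma g_retract_abs: "g_retract (abs_coord f) = laurent_retract (laurent_eval f)"
proof -
  have "f - rep_coord (abs_coord f) \<in> scheme_ideal"
    using Quotient3_rep_abs[OF Quotient3_coord, of f] scheme_ideal_uminus
    by (fastforce simp: coord_rel_def scheme_ideal_0)
  from laurent_retract_scheme_ideal[OF this]
  have "laurent_retract (laurent_eval (rep_coord (abs_coord f)) + laurent_eval (f - rep_coord (abs_coord f)))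
      = laurent_retract (laurent_eval (rep_coord (abs_coord f)))"
    by (simp only: laurent_retract_add add_0_right)
  then show ?thesis
    unfolding g_retract_def by (simp add: is_ring_hom_diff[OF is_ring_hom_laurent_eval])
qed

lemma g_retract_add: "g_retract (F + G) = g_retract F + g_retract G"
  by (cases F rule: abs_coord_cases; cases G rule: abs_coord_cases)
    (simp add: g_retract_abs is_ring_hom_add[OF is_ring_hom_laurent_eval] laurent_retract_add
      flip: is_ring_hom_add[OF is_ring_hom_abs_coord])

lemma g_retract_0: "g_retract 0 = 0"
  using g_retract_add[of 0 0] by simp

lemma g_retract_of_nat_mult: "g_retract (of_nat m * F) = of_nat m * g_retract F"
  by (induction m) (simp_all add: g_retract_0 distrib_right g_retract_add)

definition g_inclusion :: "('n::finite gl_var, 'r::comm_ring_1) coord \<Rightarrow> ('n g_var, 'r) coord" where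
  "g_inclusion = coord_eval coord_const (case_gl_var (\<lambda>i j. coord_var (GEntry i j)) (coord_var GDetInv))"

lemma solves_g_inclusion:
  "solves (case_gl_var (\<lambda>i j. coord_var (GEntry i j)) (coord_var GDetInv)
    :: 'n::finite gl_var \<Rightarrow> ('n g_var, 'r::comm_ring_1) coord)"
  using solves_coord_var[where 'v = "'n g_var" and 'r = 'r] by (simp add: solves_gl solves_g)

lemma g_retract_inclusion: "g_retract (g_inclusion F) = (F :: ('n::finite gl_var, 'r::comm_ring_1) coord)"
proof -
  obtain f where f: "F = abs_coord f"
    by (rule abs_coord_cases)
  define b :: "'n gl_var \<Rightarrow> ('n g_var, 'r) mpol"
    where "b = case_gl_var (\<lambda>i j. pvar (GEntry i j)) (pvar GDetInv)"
  have b: "(\<lambda>v. abs_coord (b v)) = case_gl_var (\<lambda>i j. coord_var (GEntry i j)) (coord_var GDetInv)"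
    by (simp add: fun_eq_iff b_def coord_var.abs_eq split: gl_var.split)
  have single: "is_ring_hom (Poly_Mapping.single 0 \<circ> coord_const :: 'r \<Rightarrow> ('n, 'r) laurent)"
    by (intro is_ring_hom_comp is_ring_hom_single_0 is_ring_hom_coord_const)
  have lb: "(\<lambda>v. laurent_eval (b v)) = (\<lambda>v. Poly_Mapping.single 0 (coord_var v))"
    by (simp add: fun_eq_iff b_def laurent_eval_def poly_eval_pvar[OF single] laurent_coords_def
        split: gl_var.split)
  have "g_inclusion F = abs_coord (poly_eval pconst b f)"
    unfolding g_inclusion_def f coord_eval_abs[OF is_ring_hom_coord_const solves_g_inclusion]
      poly_eval_comp[OF is_ring_hom_pconst' is_ring_hom_abs_coord]
    by (simp add: comp_def b flip: coord_const.abs_eq)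
  then have "g_retract (g_inclusion F) = laurent_retract (laurent_eval (poly_eval pconst b f))"
    by (simp add: g_retract_abs)
  also have "laurent_eval (poly_eval pconst b f)
      = poly_eval (Poly_Mapping.single 0 \<circ> coord_const) (\<lambda>v. Poly_Mapping.single 0 (coord_var v)) f"
    unfolding poly_eval_comp[OF is_ring_hom_pconst' is_ring_hom_laurent_eval]
    by (simp add: comp_def lb) (simp add: laurent_eval_def poly_eval_pconst[OF single, unfolded comp_def] comp_def)
  also have "\<dots> = Poly_Mapping.single 0 F"
    unfolding f abs_coord_eq_poly_eval poly_eval_comp[OF is_ring_hom_coord_const is_ring_hom_single_0]
    by (simp add: comp_def)
  finally show ?thesis
    by (simp add: laurent_retract_single laurent_weight_def gl_det_power_0)
qed

lemma g_projection_to_hat: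
  "g_projection (to_hat F) = to_hat (g_inclusion (F :: ('n::finite gl_var, 'r::with_prime) coord))"
proof -
  have b: "gl_coords (fst g_univ)
      = (\<lambda>v. to_hat (case_gl_var (\<lambda>i j. coord_var (GEntry i j)) (coord_var GDetInv) v) :: ('n, 'r) g_hat)"
  proof
    fix v :: "'n gl_var"
    show "gl_coords (fst g_univ) v
      = (to_hat (case_gl_var (\<lambda>i j. coord_var (GEntry i j)) (coord_var GDetInv) v) :: ('n, 'r) g_hat)"
      using ring_inv_eqI[OF g_univ_relations(1)[OF refl, where 'n = 'n and 'r = 'r]]
      by (cases v) (simp_all add: g_univ_def crd_def)
  qed
  obtain f where f: "F = abs_coord f"
    by (rule abs_coord_cases)
  have "g_projection (to_hat F) = coord_eval cst (gl_coords (fst g_univ)) F"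
    unfolding g_projection_def
    by (rule subst_hom_to_hat) (simp_all add: is_ring_hom_cst solves_gl_coords)
  also have "\<dots> = poly_eval cst (gl_coords (fst g_univ)) f"
    unfolding f by (rule coord_eval_abs) (simp_all add: is_ring_hom_cst solves_gl_coords)
  also have "\<dots> = to_hat (g_inclusion F)"
    unfolding g_inclusion_def f coord_eval_abs[OF is_ring_hom_coord_const solves_g_inclusion] b
      poly_eval_comp[OF is_ring_hom_coord_const is_ring_hom_to_hat]
    by (simp add: comp_def cst_def[abs_def])
  finally show ?thesis .
qed

lemma is_ring_hom_g_projection:
  "is_ring_hom (g_projection :: ('n::finite, 'r::with_prime) gl_hat \<Rightarrow> _)"
  unfolding g_projection_def
  by (rule is_ring_hom_subst_hom) (simp_all add: is_ring_hom_cst solves_gl_coords)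

lemma g_projection_cst: "g_projection (cst c) = cst c"
  unfolding g_projection_def
  by (rule subst_hom_cst) (simp_all add: is_ring_hom_cst solves_gl_coords)

lemma g_projection_gl_univ:
  "map_matrix g_projection (gl_univ :: ('n::finite, 'r::with_prime) gl_mat) = fst g_univ"
proof -
  have "(g_projection (crd (Entry i j)) :: ('n, 'r) g_hat) = gl_coords (fst g_univ) (Entry i j)" for i j
    unfolding g_projection_def
    by (rule subst_hom_crd) (simp_all add: is_ring_hom_cst solves_gl_coords)
  then show ?thesis
    by (simp add: vec_eq_iff gl_univ_def)
qed

text \<open>The additive retraction shows that \<open>p^k\<close> divides a function on
  \<open>GL_n\<close> as soon as it divides its image. This, and not mere injectivity before
  completion, is what passes to the limit.\<close>

lemma inj_g_projection:
  fixes F G :: "('n::finite, 'r::with_prime) gl_hat"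
  assumes "g_projection F = g_projection G"
  shows "F = G"
proof -
  note hom = is_ring_hom_g_projection[where 'n = 'n and 'r = 'r]
  have "F - G = 0"
  proof (rule padic_separated)
    fix k
    obtain f where f: "pelt ^ k dvd (F - G) - to_hat f"
      using to_hat_approx by blast
    have "of_nat (base_prime TYPE('r)) ^ k dvd g_projection (F - G) - g_projection (to_hat f)"
      by (rule is_ring_hom_dvd_diff[OF hom]) (use f in simp)
    then have "of_nat (base_prime TYPE('r)) ^ k dvd to_hat (g_inclusion f)"
      by (simp add: is_ring_hom_diff[OF hom] assms g_projection_to_hat)
    then have "of_nat (base_prime TYPE('r)) ^ k dvd g_inclusion f"
      using to_hat_dvd_iff[of k "g_inclusion f"] by simp
    then obtain q where "g_inclusion f = of_nat (base_prime TYPE('r) ^ k) * q"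
      by (auto elim: dvdE)
    then have "f = of_nat (base_prime TYPE('r) ^ k) * g_retract q"
      by (metis g_retract_inclusion g_retract_of_nat_mult)
    then have "pelt ^ k dvd f"
      by simp
    then have "pelt ^ k dvd to_hat f - 0"
      using to_hat_dvd_iff[of k f] by simp
    with f show "of_nat (base_prime TYPE(('n, 'r) gl_hat)) ^ k dvd F - G"
      by (metis dvd_diff_trans diff_zero)
  qed
  then show ?thesis
    by simp
qed

section \<open>Lifts of Frobenius\<close>

lemma frobenius_lift_hom: "frobenius_lift \<phi> \<Longrightarrow> is_ring_hom \<phi>"
  and frobenius_lift_cst: "frobenius_lift \<phi> \<Longrightarrow> \<phi> (cst c) = cst (frob c)"
  by (simp_all add: frobenius_lift_def)

lemma frobenius_lift_cong:
  fixes \<phi> :: "('v::affine_scheme, 'r::frobenius_dvr) hat_ring \<Rightarrow> ('v, 'r) hat_ring"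
  shows "frobenius_lift \<phi> \<Longrightarrow> of_nat (base_prime TYPE('r)) dvd \<phi> f - f ^ base_prime TYPE('r)"
  by (simp add: frobenius_lift_def)

text \<open>Modulo p the p-th power map is itself a ring homomorphism, so comparing it with \<phi>
  on constants and coordinates is enough.\<close>

lemma frobenius_liftI:
  fixes \<phi> :: "('v::affine_scheme, 'r::frobenius_dvr) hat_ring \<Rightarrow> ('v, 'r) hat_ring"
  assumes \<phi>: "is_ring_hom \<phi>" and cst: "\<And>c. \<phi> (cst c) = cst (frob c)"
    and crd: "\<And>v. of_nat (base_prime TYPE('r)) dvd \<phi> (crd v) - crd v ^ base_prime TYPE('r)"
  shows "frobenius_lift \<phi>"
proof -
  let ?p = "base_prime TYPE('r)"
  have "of_nat ?p dvd \<phi> f - f ^ ?p" for f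
  proof (induction f rule: hat_induct)
    case (const c)
    have "of_nat ?p dvd cst (frob c - c ^ ?p)"
      using is_ring_hom_dvd[OF is_ring_hom_cst frob_lift[of c]]
      by (simp add: is_ring_hom_of_nat[OF is_ring_hom_cst])
    then show ?case
      by (simp add: cst is_ring_hom_simps[OF is_ring_hom_cst])
  next
    case (add f g)
    have "of_nat ?p dvd (f ^ ?p + g ^ ?p) - (f + g) ^ ?p"
      using dvd_diff_sym[OF frobenius_cong_add[of f g]] by simp
    with dvd_diff_add[OF add] show ?case
      unfolding is_ring_hom_add[OF \<phi>] by (rule dvd_diff_trans)
  next
    case (mult f g)
    show ?case
      unfolding is_ring_hom_mult[OF \<phi>] power_mult_distrib by (rule dvd_diff_mult[OF mult])
  next
    case (limit f)
    \<comment> \<open>The claim is a congruence modulo p, so a single approximation modulo p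
      suffices.\<close>
    from limit[of 1] obtain g where g: "of_nat ?p dvd \<phi> g - g ^ ?p" "of_nat ?p dvd f - g"
      by auto
    have "of_nat ?p dvd \<phi> f - \<phi> g"
      using is_ring_hom_dvd_diff[OF \<phi>, of ?p 1] g(2) by simp
    with g show ?case
      by (meson dvd_diff_power dvd_diff_sym dvd_diff_trans)
  qed (rule crd)
  with \<phi> cst show ?thesis
    by (simp add: frobenius_lift_def)
qed

lemma frobenius_lift_eqI:
  fixes \<phi> \<psi> :: "('v::affine_scheme, 'r::frobenius_dvr) hat_ring \<Rightarrow> ('v, 'r) hat_ring"
  assumes "frobenius_lift \<phi>" "frobenius_lift \<psi>" "\<And>v. \<phi> (crd v) = \<psi> (crd v)"
  shows "\<phi> = \<psi>"
  by (rule hat_hom_eqI) (simp_all add: assms frobenius_lift_hom frobenius_lift_cst)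

lemma is_ring_hom_cst_frob: "is_ring_hom (\<lambda>c. cst (frob c))"
  using is_ring_hom_comp[OF is_ring_hom_cst frob_hom] by (simp add: comp_def)

lemma frobenius_lift_exists:
  fixes b :: "'v::affine_scheme \<Rightarrow> ('v, 'r::frobenius_dvr) hat_ring"
  assumes "solves b" "\<And>v. of_nat (base_prime TYPE('r)) dvd b v - crd v ^ base_prime TYPE('r)"
  obtains \<phi> where "frobenius_lift \<phi>" "\<And>v. \<phi> (crd v) = b v"
proof
  let ?\<phi> = "subst_hom (\<lambda>c. cst (frob c)) b"
  have eq: "?\<phi> (crd v) = b v" for v
    by (rule subst_hom_crd) (simp_all add: is_ring_hom_cst_frob assms(1))
  then show "?\<phi> (crd v) = b v" for v .
  show "frobenius_lift ?\<phi>"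
  proof (rule frobenius_liftI)
    show "is_ring_hom ?\<phi>"
      by (rule is_ring_hom_subst_hom) (simp_all add: is_ring_hom_cst_frob assms(1))
    show "?\<phi> (cst c) = cst (frob c)" for c
      by (rule subst_hom_cst) (simp_all add: is_ring_hom_cst_frob assms(1))
  qed (simp add: eq assms(2))
qed

section \<open>Homomorphisms on the completed ring of \<open>GL_n\<close>, determined by a
  matrix\<close>

lemma hom_gl_univ_det:
  assumes "is_ring_hom h"
  shows "det (map_matrix h gl_univ) * h (crd DetInv) = 1"
  using det_gl_univ is_ring_hom_simps[OF assms]
  by metis

lemma gl_hom_cong:
  fixes h h' :: "('n::finite, 'r::with_prime) gl_hat \<Rightarrow> 'b::with_prime"
  assumes p: "base_prime TYPE('b) = base_prime TYPE('r)" and J: "closed_ideal J"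
    and h: "is_ring_hom h" "is_ring_hom h'" and cst: "\<And>c. h (cst c) - h' (cst c) \<in> J"
    and univ: "\<And>i j. map_matrix h gl_univ $ i $ j - map_matrix h' gl_univ $ i $ j \<in> J"
  shows "h F - h' F \<in> J"
proof (rule hat_hom_cong[OF p J h cst])
  fix v :: "'n gl_var"
  have J': "is_ideal J"
    using J by (simp add: closed_ideal_def)
  show "h (crd v) - h' (crd v) \<in> J"
  proof (cases v)
    case (Entry i j)
    then show ?thesis
      using univ[of i j] by (simp add: gl_univ_def)
  next
    case DetInv
    have "det (map_matrix h gl_univ) - det (map_matrix h' gl_univ) \<in> J"
      by (rule ideal_cong_det[OF J' univ])
    with ideal_cong_inverse[OF J' hom_gl_univ_det[OF h(1)] hom_gl_univ_det[OF h(2)]] show ?thesis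
      by (simp add: DetInv)
  qed
qed

lemma gl_hom_eqI:
  fixes h h' :: "('n::finite, 'r::with_prime) gl_hat \<Rightarrow> 'b::padic_complete"
  assumes p: "base_prime TYPE('b) = base_prime TYPE('r)"
    and h: "is_ring_hom h" "is_ring_hom h'" and cst: "\<And>c. h (cst c) = h' (cst c)"
    and univ: "map_matrix h gl_univ = map_matrix h' gl_univ"
  shows "h = h'"
  using gl_hom_cong[OF p closed_ideal_zero h] cst univ by (auto simp: fun_eq_iff)

lemma gl_lift_eqI:
  fixes \<phi> \<psi> :: "('n::finite, 'r::frobenius_dvr) gl_endo"
  assumes "frobenius_lift \<phi>" "frobenius_lift \<psi>" "map_matrix \<phi> gl_univ = map_matrix \<psi> gl_univ"
  shows "\<phi> = \<psi>"
  by (rule gl_hom_eqI) (simp_all add: assms frobenius_lift_hom frobenius_lift_cst)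

lemma unit_det_ppow:
  fixes A :: "'b::{padic_complete, odd_prime} ^ 'n ^ 'n"
  assumes "det A dvd 1"
  shows "det (ppow_mat A) dvd 1"
  using unit_cong_pelt[OF unit_power[OF assms] frobenius_cong_det] .

text \<open>A matrix congruent to \<open>x^(p)\<close> modulo p has determinant congruent to
  \<open>det(x)^p\<close>, hence is invertible, and the inverse of its determinant has the right
  residue too.\<close>

lemma gl_lift_exists:
  fixes M :: "('n::finite, 'r::frobenius_dvr) gl_mat"
  assumes M: "\<And>i j. of_nat (base_prime TYPE('r)) dvd M $ i $ j - gl_univ $ i $ j ^ base_prime TYPE('r)"
  obtains \<phi> where "frobenius_lift \<phi>" "map_matrix \<phi> gl_univ = M"
proof -
  let ?p = "base_prime TYPE('r)"
  let ?J = "{x. of_nat ?p dvd (x :: ('n, 'r) gl_hat)}"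
  have J: "is_ideal ?J"
    by (rule is_ideal_dvd)
  have "det M - det (ppow_mat gl_univ) \<in> ?J"
    using M by (intro ideal_cong_det[OF J]) (simp add: ppow_mat_def)
  moreover have "det (ppow_mat gl_univ) - det gl_univ ^ ?p \<in> ?J"
    using frobenius_cong_det[of gl_univ] by simp
  ultimately have det: "det M - det gl_univ ^ ?p \<in> ?J"
    by (rule ideal_cong_trans[OF J])
  then have unit: "det M dvd 1"
    using unit_cong_pelt[OF unit_power[OF unit_det_gl_univ], of "det M" ?p] by simp
  have "det gl_univ ^ ?p * crd DetInv ^ ?p = 1"
    by (simp add: det_gl_univ flip: power_mult_distrib)
  from ideal_cong_inverse[OF J ring_inv_right[OF unit] this det]
  have inv: "of_nat ?p dvd ring_inv (det M) - crd DetInv ^ ?p"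
    by simp
  have "of_nat ?p dvd gl_coords M v - crd v ^ ?p" for v
  proof (cases v)
    case (Entry i j)
    then show ?thesis
      using M[of i j] by (simp add: gl_univ_def)
  qed (simp add: inv)
  then obtain \<phi> where \<phi>: "frobenius_lift \<phi>" "\<And>v. \<phi> (crd v) = gl_coords M v"
    using frobenius_lift_exists[OF solves_gl_coords[OF unit]] by blast
  then have "map_matrix \<phi> gl_univ = M"
    by (simp add: vec_eq_iff gl_univ_def)
  with \<phi>(1) show ?thesis
    by (rule that)
qed

lemma gl_frob0:
  shows frobenius_lift_gl_frob0: "frobenius_lift (gl_frob0 :: ('n::finite, 'r::frobenius_dvr) gl_endo)"
    and gl_frob0_univ: "map_matrix (gl_frob0 :: ('n, 'r) gl_endo) gl_univ = ppow_mat gl_univ"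
proof -
  obtain \<phi> :: "('n, 'r) gl_endo" where \<phi>: "frobenius_lift \<phi>" "map_matrix \<phi> gl_univ = ppow_mat gl_univ"
    by (rule gl_lift_exists[of "ppow_mat gl_univ"]) (simp add: ppow_mat_def)
  then have "(gl_frob0 :: ('n, 'r) gl_endo) = \<phi>"
    unfolding gl_frob0_def by (intro the_equality) (auto intro: gl_lift_eqI)
  with \<phi> show "frobenius_lift (gl_frob0 :: ('n, 'r) gl_endo)"
    "map_matrix (gl_frob0 :: ('n, 'r) gl_endo) gl_univ = ppow_mat gl_univ"
    by simp_all
qed

section \<open>Points\<close>

lemma
  fixes a :: "'v::affine_scheme \<Rightarrow> 'r::frobenius_dvr"
  assumes "solves a"
  shows is_ring_hom_point: "is_ring_hom (point a)"
    and point_cst: "point a (cst c) = c"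
    and point_crd: "point a (crd v) = a v"
  unfolding point_def
  using subst_hom[OF refl is_ring_hom_id assms] by simp_all

lemma point_gl_univ:
  fixes a :: "'r::frobenius_dvr ^ 'n::finite ^ 'n"
  assumes "a \<in> GL"
  shows "map_matrix (point (gl_coords a)) gl_univ = a"
  using assms by (simp add: vec_eq_iff gl_univ_def point_crd solves_gl_coords GL_iff)

section \<open>The factor \<open>\<lambda>\<close>\<close>

text \<open>Over a \<open>p\<close>-adically complete ring, for \<open>p\<close> not dividing \<open>n\<close> and \<open>X\<close> invertible, at most one \<open>s\<close> has
  this property; so \<open>\<lambda>(X)\<close> is determined by it, without the series.\<close>

definition is_lambda :: "'b::with_prime ^ 'n ^ 'n \<Rightarrow> 'b \<Rightarrow> bool" where
  "is_lambda X s \<longleftrightarrow>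
    pelt dvd s - 1 \<and> s ^ CARD('n) * det (ppow_mat X) = det X ^ base_prime TYPE('b)"

lemma is_lambda_unit: "is_lambda X s \<Longrightarrow> s dvd 1" for s :: "'b::padic_complete"
  unfolding is_lambda_def by (rule unit_cong_pelt[of 1]) simp_all

lemma is_lambda_hom:
  fixes h :: "'a::with_prime \<Rightarrow> 'b::with_prime"
  assumes h: "is_ring_hom h" and p: "base_prime TYPE('b) = base_prime TYPE('a)"
    and s: "is_lambda X s"
  shows "is_lambda (map_matrix h X) (h s)"
proof -
  have "h (s ^ CARD('c) * det (ppow_mat X)) = h (det X ^ base_prime TYPE('a))"
    using s by (simp add: is_lambda_def)
  moreover have "pelt dvd h s - h 1"
    using is_ring_hom_dvd_diff[OF h, of "base_prime TYPE('a)" 1 s 1] s by (simp add: p is_lambda_def)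
  ultimately show ?thesis
    by (simp add: is_lambda_def is_ring_hom_simps[OF h] map_matrix_ppow[OF h p] p)
qed

text \<open>The hypothesis rewrites \<open>(a^n - b^n) d\<close> as \<open>- b^n (d - e)\<close>;
  dividing by the unit \<open>d\<close> reduces to plain n-th roots.\<close>

lemma weighted_root_unique_mod:
  fixes a b d e :: "'b::padic_complete"
  assumes n: "coprime n (base_prime TYPE('b))" and J: "is_ideal J"
    and cong: "pelt dvd a - 1" "pelt dvd b - 1" and d: "d dvd 1" "d - e \<in> J"
    and eq: "a ^ n * d = b ^ n * e"
  shows "a - b \<in> J"
proof (rule root_unique_mod[OF ideal_mult[OF J] n])
  show "b dvd 1"
    using unit_cong_pelt[of 1 b] cong(2) by simp
  show "pelt dvd a - b"
    using dvd_diff_trans[OF cong(1) dvd_diff_sym[OF cong(2)]] .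
  have "ring_inv d * (- (b ^ n) * (d - e)) \<in> J"
    by (intro ideal_mult[OF J] d)
  also have "- (b ^ n) * (d - e) = (a ^ n - b ^ n) * d"
    using eq by (simp add: algebra_simps)
  also have "ring_inv d * ((a ^ n - b ^ n) * d) = (ring_inv d * d) * (a ^ n - b ^ n)"
    by (simp only: ac_simps)
  finally show "a ^ n - b ^ n \<in> J"
    by (simp add: ring_inv_left[OF d(1)])
qed

text \<open>Both weighted powers, of \<open>w\<close> and of \<open>s * t\<close>, are equal to
  \<open>det(X Y)^p\<close>.\<close>

lemma is_lambda_mult_mod:
  fixes X Y :: "'b::{padic_complete, odd_prime} ^ 'n ^ 'n"
  assumes n: "coprime CARD('n) (base_prime TYPE('b))" and J: "is_ideal J"
    and unit: "det X dvd 1" "det Y dvd 1"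
    and s: "is_lambda X s" and t: "is_lambda Y t" and w: "is_lambda (X ** Y) w"
    and cong: "\<And>i j. ppow_mat (X ** Y) $ i $ j - (ppow_mat X ** ppow_mat Y) $ i $ j \<in> J"
  shows "w - s * t \<in> J"
proof (rule weighted_root_unique_mod[OF n J _ _ _ ideal_cong_det[OF J cong]])
  show "pelt dvd w - 1"
    using w by (simp add: is_lambda_def)
  have "pelt dvd s * t - 1 * 1"
    using s t by (intro dvd_diff_mult) (simp_all add: is_lambda_def)
  then show "pelt dvd s * t - 1"
    by simp
  show "det (ppow_mat (X ** Y)) dvd 1"
    by (intro unit_det_ppow) (simp add: det_mul unit_mult unit)
  have "w ^ CARD('n) * det (ppow_mat (X ** Y))
      = (s ^ CARD('n) * det (ppow_mat X)) * (t ^ CARD('n) * det (ppow_mat Y))"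
    using s t w by (simp add: is_lambda_def det_mul power_mult_distrib)
  then show "w ^ CARD('n) * det (ppow_mat (X ** Y)) = (s * t) ^ CARD('n) * det (ppow_mat X ** ppow_mat Y)"
    by (simp add: det_mul power_mult_distrib ac_simps)
qed

lemma is_lambda_one_mod:
  fixes X :: "'b::{padic_complete, odd_prime} ^ 'n ^ 'n"
  assumes n: "coprime CARD('n) (base_prime TYPE('b))" and J: "is_ideal J"
    and unit: "det X dvd 1" and s: "is_lambda X s"
    and cong: "det (ppow_mat X) - det X ^ base_prime TYPE('b) \<in> J"
  shows "s - 1 \<in> J"
  by (rule weighted_root_unique_mod[OF n J _ _ unit_det_ppow[OF unit] cong])
    (use s in \<open>simp_all add: is_lambda_def\<close>)

lemma coprime_base_prime:
  "\<not> base_prime TYPE('r::odd_prime) dvd m \<Longrightarrow> coprime m (base_prime TYPE('r))"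
  using prime_imp_coprime[OF prime_base_prime] coprime_commute by blast

text \<open>The link between the defining series and the characterization; afterwards only
  \<open>is_lambda\<close> is used.\<close>

lemma gl_lambda:
  assumes "\<not> base_prime TYPE('r::frobenius_dvr) dvd CARD('n::finite)"
  shows "is_lambda gl_univ (gl_lambda :: ('n, 'r) gl_hat)"
proof -
  let ?p = "base_prime TYPE('r)"
  let ?x = "gl_univ :: ('n, 'r) gl_mat"
  define U where "U = det (ppow_mat ?x) * ring_inv (det ?x ^ ?p)"
  have unit: "det ?x ^ ?p dvd 1"
    by (rule unit_power) simp
  have n: "coprime CARD('n) (base_prime TYPE(('n, 'r) gl_hat))"
    using coprime_base_prime[OF assms] by simp
  have "U - 1 = ring_inv (det ?x ^ ?p) * (det (ppow_mat ?x) - det ?x ^ ?p)"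
    using ring_inv_left[OF unit] by (simp add: U_def right_diff_distrib mult.commute)
  moreover have "of_nat ?p dvd det (ppow_mat ?x) - det ?x ^ ?p"
    using frobenius_cong_det[of ?x] by simp
  ultimately have "of_nat ?p dvd U - 1"
    by simp
  then obtain v where v: "U - 1 = of_nat ?p * v"
    by (elim dvdE)
  \<comment> \<open>Absence of p-torsion makes the quotient unique, so that the \<open>THE\<close>
    inside \<open>pdiv\<close> denotes it.\<close>
  then have pdiv: "pdiv (U - 1) = v"
    by (intro pdiv_eqI) (auto intro: gl_hat_cancel)
  obtain s where s: "padic_sums (\<lambda>m. rat_in ((1 / of_int (- int CARD('n))) gchoose m) * pelt ^ m * v ^ m) s"
    "s ^ CARD('n) * (1 + pelt * v) = 1" "pelt dvd s - 1"
    by (rule principal_root_series[OF n]) simp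
  have "gl_lambda = s"
    unfolding gl_lambda_def U_def[symmetric] principal_root_def pdiv
    using s(1) by (intro the_equality) (auto intro: padic_sums_unique)
  moreover have "s ^ CARD('n) * U = 1"
    using s(2) v by (simp add: algebra_simps)
  then have "s ^ CARD('n) * det (ppow_mat ?x) * (ring_inv (det ?x ^ ?p) * det ?x ^ ?p) = det ?x ^ ?p"
    by (simp add: U_def flip: mult.assoc)
  ultimately show ?thesis
    using s(3) by (simp add: is_lambda_def ring_inv_left[OF unit])
qed

section \<open>Horizontal subschemes of \<open>GL\<^sub>n\<close>\<close>

lemma is_ideal_ideal_of:
  fixes Z :: "('v::affine_scheme \<Rightarrow> 'r::frobenius_dvr) set"
  assumes "\<And>a. a \<in> Z \<Longrightarrow> solves a"
  shows "is_ideal (ideal_of Z)"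
  using assms by (simp add: is_ideal_def ideal_of_def is_ring_hom_0 is_ring_hom_add is_ring_hom_mult
      is_ring_hom_to_hat is_ring_hom_point)

lemma closed_ideal_hat_ideal_of:
  fixes Z :: "('v::affine_scheme \<Rightarrow> 'r::frobenius_dvr) set"
  assumes "\<And>a. a \<in> Z \<Longrightarrow> solves a"
  shows "closed_ideal (hat_ideal_of Z)"
proof -
  note I = is_ideal_ideal_of[OF assms]
  note th = is_ring_hom_to_hat
  have "0 \<in> hat_ideal_of Z"
    unfolding hat_ideal_of_def using ideal_0[OF I]
    by (auto intro!: bexI[of _ 0] simp: is_ring_hom_0[OF th])
  moreover have "F + G \<in> hat_ideal_of Z" if FG: "F \<in> hat_ideal_of Z" "G \<in> hat_ideal_of Z" for F G
    unfolding hat_ideal_of_def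
  proof (intro CollectI allI)
    fix k
    obtain f g where "f \<in> ideal_of Z" "g \<in> ideal_of Z" "pelt ^ k dvd F - to_hat f" "pelt ^ k dvd G - to_hat g"
      using FG unfolding hat_ideal_of_def by blast
    then show "\<exists>f\<in>ideal_of Z. pelt ^ k dvd F + G - to_hat f"
      by (intro bexI[of _ "f + g"])
        (simp_all only: is_ring_hom_add[OF th] dvd_diff_add ideal_add[OF I])
  qed
  moreover have "H * F \<in> hat_ideal_of Z" if F: "F \<in> hat_ideal_of Z" for F H
    unfolding hat_ideal_of_def
  proof (intro CollectI allI)
    fix k
    obtain f where f: "f \<in> ideal_of Z" "pelt ^ k dvd F - to_hat f"
      using F unfolding hat_ideal_of_def by blast
    obtain h where h: "pelt ^ k dvd H - to_hat h"
      using to_hat_approx by blast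
    show "\<exists>f\<in>ideal_of Z. pelt ^ k dvd H * F - to_hat f"
      by (rule bexI[of _ "h * f"])
        (simp_all only: is_ring_hom_mult[OF th] dvd_diff_mult ideal_mult[OF I] f h)
  qed
  moreover have "F \<in> hat_ideal_of Z" if F: "\<forall>k. \<exists>G\<in>hat_ideal_of Z. pelt ^ k dvd F - G" for F
    unfolding hat_ideal_of_def
  proof (intro CollectI allI)
    fix k
    obtain G where "G \<in> hat_ideal_of Z" "pelt ^ k dvd F - G"
      using F by blast
    then show "\<exists>f\<in>ideal_of Z. pelt ^ k dvd F - to_hat f"
      unfolding hat_ideal_of_def by (blast intro: dvd_diff_trans)
  qed
  ultimately show ?thesis
    unfolding closed_ideal_def is_ideal_def by blast
qed

text \<open>Vanishing at points is the definition of the ideal before completion only. Functions to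
  be tested at points are therefore first written in the form \<open>to_hat f\<close>.\<close>

lemma to_hat_in_hat_ideal_of:
  assumes "\<And>a. a \<in> Z \<Longrightarrow> point a (to_hat f) = 0"
  shows "to_hat f \<in> hat_ideal_of Z"
  unfolding hat_ideal_of_def
proof (intro CollectI allI)
  fix k
  show "\<exists>g\<in>ideal_of Z. pelt ^ k dvd to_hat f - to_hat g"
    using assms by (intro bexI[of _ f]) (simp_all add: ideal_of_def)
qed

lemma ideal_cong_poly_eval:
  assumes J: "is_ideal J" and cong: "\<And>v. a v - b v \<in> J"
  shows "poly_eval \<sigma> a f - poly_eval \<sigma> b f \<in> J"
  unfolding poly_eval_def mono_eval_def
  by (intro ideal_cong_sum[OF J] ideal_cong_mult[OF J] ideal_cong_prod[OF J]
      ideal_cong_power[OF J] ideal_refl[OF J] cong)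

lemma solves_gl_image: "Z \<subseteq> GL \<Longrightarrow> a \<in> gl_coords ` Z \<Longrightarrow> solves a"
  by (auto simp: GL_iff subset_iff intro: solves_gl_coords)

definition gl_univ0 :: "('n::finite gl_var, 'r::comm_ring_1) coord ^ 'n ^ 'n" where
  "gl_univ0 = (\<chi> i j. coord_var (Entry i j))"

lemma gl_univ_to_hat: "gl_univ = map_matrix to_hat gl_univ0"
  by (simp add: vec_eq_iff gl_univ_def gl_univ0_def crd_def)

text \<open>The test at points is applied to \<open>det(x^(p)) - det(x)^p\<close>, which lives
  before completion; root uniqueness modulo the ideal then gives \<lambda>.\<close>

lemma lambda_minus_1_in_hat_ideal:
  fixes Z :: "('r::frobenius_dvr ^ 'n::finite ^ 'n) set"
  assumes p: "\<not> base_prime TYPE('r) dvd CARD('n)" and Z: "Z \<subseteq> GL"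
    and det: "\<And>a. a \<in> Z \<Longrightarrow> det (ppow_mat a) = det a ^ base_prime TYPE('r)"
  shows "gl_lambda - 1 \<in> hat_ideal_of (gl_coords ` Z)"
proof (rule is_lambda_one_mod[OF _ _ unit_det_gl_univ gl_lambda[OF p]])
  let ?p = "base_prime TYPE('r)"
  let ?x = "gl_univ :: ('n, 'r) gl_mat"
  show "coprime CARD('n) (base_prime TYPE(('n, 'r) gl_hat))"
    using coprime_base_prime[OF p] by simp
  show "is_ideal (hat_ideal_of (gl_coords ` Z))"
    using closed_ideal_hat_ideal_of[OF solves_gl_image[OF Z]] by (simp add: closed_ideal_def)
  have th: "det (ppow_mat ?x) - det ?x ^ ?p = to_hat (det (ppow_mat gl_univ0) - det gl_univ0 ^ ?p)"
    unfolding gl_univ_to_hat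
    by (simp add: is_ring_hom_simps[OF is_ring_hom_to_hat] map_matrix_ppow[OF is_ring_hom_to_hat])
  have "point (gl_coords a) (det (ppow_mat ?x) - det ?x ^ ?p) = 0" if "a \<in> Z" for a
  proof -
    have a: "a \<in> GL"
      using Z that by blast
    then have hom: "is_ring_hom (point (gl_coords a))"
      by (intro is_ring_hom_point solves_gl_coords) (simp add: GL_iff)
    show ?thesis
      by (simp add: is_ring_hom_simps[OF hom]
          map_matrix_ppow[OF hom] point_gl_univ[OF a] det[OF that])
  qed
  then have "det (ppow_mat ?x) - det ?x ^ ?p \<in> hat_ideal_of (gl_coords ` Z)"
    unfolding th by (intro to_hat_in_hat_ideal_of) auto
  then show "det (ppow_mat ?x) - det ?x ^ base_prime TYPE(('n, 'r) gl_hat) \<in> hat_ideal_of (gl_coords ` Z)"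
    by simp
qed

text \<open>The factor \<lambda> is made for this: its n-th power corrects \<open>det(x^(p))\<close>
  to \<open>det(x)^p\<close>.\<close>

lemma lambda_lift_det:
  fixes \<phi> :: "('n::finite, 'r::frobenius_dvr) gl_endo"
  assumes p: "\<not> base_prime TYPE('r) dvd CARD('n)" and \<phi>: "is_ring_hom \<phi>"
    and univ: "map_matrix \<phi> gl_univ = smat gl_lambda (ppow_mat gl_univ)"
  shows "\<phi> (det gl_univ) = det gl_univ ^ base_prime TYPE('r)"
  using gl_lambda[OF p] by (simp add: is_ring_hom_det[OF \<phi>] univ det_smat is_lambda_def)

text \<open>On \<open>Z\<close> the factor \<open>\<lambda>\<close> is \<open>1\<close>, so that modulo the ideal of \<open>Z\<close> the lift is \<open>x \<mapsto> x\<^sup>(\<^sup>p\<^sup>)\<close>, which maps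
  functions before completion to such functions; their vanishing on \<open>Z\<close> is checked at points.\<close>

lemma lambda_lift_horizontal:
  fixes \<phi> :: "('n::finite, 'r::frobenius_dvr) gl_endo"
  assumes p: "\<not> base_prime TYPE('r) dvd CARD('n)" and \<phi>: "frobenius_lift \<phi>"
    and univ: "map_matrix \<phi> gl_univ = smat gl_lambda (ppow_mat gl_univ)"
    and Z: "Z \<subseteq> GL"
    and det: "\<And>a. a \<in> Z \<Longrightarrow> det (ppow_mat a) = det a ^ base_prime TYPE('r)"
    and frob: "\<And>a. a \<in> Z \<Longrightarrow> map_matrix (inv frob) (ppow_mat a) \<in> Z"
  shows "horizontal \<phi> (gl_coords ` Z)"
  unfolding horizontal_def
proof (rule image_subsetI)
  let ?p = "base_prime TYPE('r)"
  let ?J = "hat_ideal_of (gl_coords ` Z)"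
  have closed: "closed_ideal ?J"
    by (rule closed_ideal_hat_ideal_of[OF solves_gl_image[OF Z]])
  then have J: "is_ideal ?J"
    by (simp add: closed_ideal_def)
  note hom = frobenius_lift_hom[OF \<phi>]
  have cong: "\<phi> (crd v) - crd v ^ ?p \<in> ?J" for v
  proof (cases v)
    case (Entry i j)
    have "\<phi> (crd v) = gl_lambda * crd v ^ ?p"
      using univ by (simp add: vec_eq_iff gl_univ_def ppow_mat_def Entry)
    then have "\<phi> (crd v) - crd v ^ ?p = crd v ^ ?p * (gl_lambda - 1)"
      by (simp add: algebra_simps)
    then show ?thesis
      by (simp only: ideal_mult[OF J] lambda_minus_1_in_hat_ideal[OF p Z det])
  next
    case DetInv
    have "\<phi> (det gl_univ) * \<phi> (crd DetInv) = 1"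
      by (simp add: det_gl_univ is_ring_hom_1[OF hom] flip: is_ring_hom_mult[OF hom])
    moreover have "\<phi> (det gl_univ) * crd DetInv ^ ?p = 1"
      by (simp add: lambda_lift_det[OF p hom univ] det_gl_univ flip: power_mult_distrib)
    ultimately have "\<phi> (crd v) = crd v ^ ?p"
      unfolding DetInv by (metis ring_inv_eqI)
    then show ?thesis
      by (simp add: ideal_0[OF J])
  qed
  have ideal_of: "\<phi> (to_hat f) \<in> ?J" if f: "f \<in> ideal_of (gl_coords ` Z)" for f
  proof -
    obtain g where g: "f = abs_coord g"
      by (rule abs_coord_cases)
    \<comment> \<open>Frobenius on the coefficients and p-th powers of the variables: the action of
      \<open>x \<mapsto> x^(p)\<close>, with p-th power on the inverse determinant, before
      completion.\<close>
    define q where "q = poly_eval (coord_const \<circ> frob) (\<lambda>v. coord_var v ^ ?p) g"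
    have cf: "is_ring_hom (coord_const \<circ> frob :: 'r \<Rightarrow> ('n gl_var, 'r) coord)"
      by (intro is_ring_hom_comp is_ring_hom_coord_const frob_hom)
    have q_hat: "to_hat q = poly_eval (\<lambda>c. cst (frob c)) (\<lambda>v. crd v ^ ?p) g"
      unfolding q_def poly_eval_comp[OF cf is_ring_hom_to_hat]
      by (simp add: comp_def cst_def crd_def is_ring_hom_power[OF is_ring_hom_to_hat])
    have "\<phi> (to_hat f) = poly_eval (\<lambda>c. cst (frob c)) (\<lambda>v. \<phi> (crd v)) g"
      unfolding g to_hat_abs_coord poly_eval_comp[OF is_ring_hom_cst hom]
      by (simp add: comp_def frobenius_lift_cst[OF \<phi>])
    then have "\<phi> (to_hat f) - to_hat q \<in> ?J"
      unfolding q_hat by (simp only: ideal_cong_poly_eval[OF J cong])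
    moreover have "point (gl_coords a) (to_hat q) = 0" if a: "a \<in> Z" for a
    proof -
      \<comment> \<open>The image point of \<open>a\<close>, chosen so that the value of
        \<open>q\<close> at \<open>a\<close> is \<open>frob\<close> of the value of \<open>f\<close>
        at \<open>?b\<close>; the latter vanishes because \<open>?b\<close> lies in
        \<open>Z\<close>.\<close>
      let ?b = "map_matrix (inv frob) (ppow_mat a)"
      have GL: "a \<in> GL" "?b \<in> GL"
        using Z a frob by blast+
      then have sol: "solves (gl_coords a)" "solves (gl_coords ?b)"
        by (auto simp: GL_iff intro: solves_gl_coords)
      have "det ?b = inv frob (det a ^ ?p)"
        by (simp add: det[OF a] flip: is_ring_hom_det[OF is_ring_hom_inv_frob])
      moreover have "det a dvd 1"
        using GL(1) by (simp add: GL_iff)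
      ultimately have "frob (ring_inv (det ?b)) = ring_inv (det a) ^ ?p"
        by (simp add: frob_inv_frob is_ring_hom_ring_inv[OF frob_hom] ring_inv_power unit_power
            is_ring_hom_unit[OF is_ring_hom_inv_frob])
      then have b: "frob (gl_coords ?b v) = gl_coords a v ^ ?p" for v
        by (cases v) (simp_all add: frob_inv_frob ppow_mat_def)
      have cf': "is_ring_hom (\<lambda>c. cst (frob c) :: ('n, 'r) gl_hat)"
        by (rule is_ring_hom_cst_frob)
      have "point (gl_coords a) (to_hat q) = poly_eval frob (\<lambda>v. gl_coords a v ^ ?p) g"
        unfolding q_hat poly_eval_comp[OF cf' is_ring_hom_point[OF sol(1)]]
        by (simp add: comp_def point_cst[OF sol(1)] is_ring_hom_power[OF is_ring_hom_point[OF sol(1)]]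
            point_crd[OF sol(1)])
      also have "\<dots> = frob (poly_eval id (gl_coords ?b) g)"
        unfolding poly_eval_comp[OF is_ring_hom_id frob_hom] by (simp only: comp_def b id_apply)
      also have "poly_eval id (gl_coords ?b) g = point (gl_coords ?b) (to_hat f)"
        unfolding g to_hat_abs_coord poly_eval_comp[OF is_ring_hom_cst is_ring_hom_point[OF sol(2)]]
        by (simp add: comp_def id_def point_cst[OF sol(2)] point_crd[OF sol(2)])
      also have "\<dots> = 0"
        using f frob[OF a] by (simp add: ideal_of_def)
      finally show ?thesis
        by (simp add: is_ring_hom_0[OF frob_hom])
    qed
    then have "to_hat q \<in> ?J"
      by (intro to_hat_in_hat_ideal_of) auto
    ultimately show ?thesis
      using ideal_add[OF J, of "\<phi> (to_hat f) - to_hat q" "to_hat q"] by simp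
  qed
  fix F
  assume F: "F \<in> ?J"
  have "\<exists>G\<in>?J. pelt ^ k dvd \<phi> F - G" for k
  proof -
    obtain f where f: "f \<in> ideal_of (gl_coords ` Z)" "pelt ^ k dvd F - to_hat f"
      using F unfolding hat_ideal_of_def by blast
    with is_ring_hom_dvd_diff[OF hom f(2)] ideal_of[OF f(1)] show ?thesis
      by blast
  qed
  then show "\<phi> F \<in> ?J"
    using closed unfolding closed_ideal_def by blast
qed

section \<open>Products\<close>

lemma proj1:
  shows is_ring_hom_proj1: "is_ring_hom (proj1 :: ('v::affine_scheme, 'r::with_prime) hat_ring \<Rightarrow> ('v + 'w::affine_scheme, 'r) hat_ring)" (is ?A)
    and proj1_cst: "proj1 (cst c) = (cst c :: ('v + 'w, 'r) hat_ring)" (is ?B)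
    and proj1_crd: "proj1 (crd v) = (crd (Inl v) :: ('v + 'w, 'r) hat_ring)" (is ?C)
proof -
  have "solves (\<lambda>v. crd (Inl v) :: ('v + 'w, 'r) hat_ring)"
    using solves_crd solves_sum by blast
  then show ?A ?B ?C
    unfolding proj1_def by (auto intro: is_ring_hom_subst_hom subst_hom_cst subst_hom_crd is_ring_hom_cst)
qed

lemma proj2:
  shows is_ring_hom_proj2: "is_ring_hom (proj2 :: ('w::affine_scheme, 'r::with_prime) hat_ring \<Rightarrow> ('v::affine_scheme + 'w, 'r) hat_ring)" (is ?A)
    and proj2_cst: "proj2 (cst c) = (cst c :: ('v + 'w, 'r) hat_ring)" (is ?B)
    and proj2_crd: "proj2 (crd w) = (crd (Inr w) :: ('v + 'w, 'r) hat_ring)" (is ?C)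
proof -
  have "solves (\<lambda>w. crd (Inr w) :: ('v + 'w, 'r) hat_ring)"
    using solves_crd solves_sum by blast
  then show ?A ?B ?C
    unfolding proj2_def by (auto intro: is_ring_hom_subst_hom subst_hom_cst subst_hom_crd is_ring_hom_cst)
qed

lemma hat_sum_hom_eqI:
  fixes h h' :: "('v::affine_scheme + 'w::affine_scheme, 'r::with_prime) hat_ring \<Rightarrow> 'b::padic_complete"
  assumes p: "base_prime TYPE('b) = base_prime TYPE('r)"
    and h: "is_ring_hom h" "is_ring_hom h'"
    and eq: "h \<circ> proj1 = h' \<circ> proj1" "h \<circ> proj2 = h' \<circ> proj2"
  shows "h = h'"
proof (rule hat_hom_eqI[OF p h])
  show "h (cst c) = h' (cst c)" for c
    using fun_cong[OF eq(1), of "cst c"] by (simp add: proj1_cst)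
  show "h (crd v) = h' (crd v)" for v
    using fun_cong[OF eq(1), of "crd (projl v)"] fun_cong[OF eq(2), of "crd (projr v)"]
    by (cases v) (simp_all add: proj1_crd proj2_crd)
qed

lemma pairing:
  fixes f :: "('v::affine_scheme, 'r::with_prime) hat_ring \<Rightarrow> 'b::padic_complete"
    and g :: "('w::affine_scheme, 'r) hat_ring \<Rightarrow> 'b"
  assumes p: "base_prime TYPE('b) = base_prime TYPE('r)"
    and f: "is_ring_hom f" and g: "is_ring_hom g" and cst: "\<And>c. f (cst c) = g (cst c)"
  shows is_ring_hom_pairing: "is_ring_hom (pairing f g)"
    and pairing_proj1: "pairing f g (proj1 F) = f F"
    and pairing_proj2: "pairing f g (proj2 G) = g G"
proof -
  define h where "h = subst_hom (\<lambda>c. f (cst c)) (case_sum (\<lambda>v. f (crd v)) (\<lambda>w. g (crd w)))"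
  have \<sigma>: "is_ring_hom (\<lambda>c. f (cst c))"
    using is_ring_hom_comp[OF f is_ring_hom_cst] by (simp add: comp_def)
  have sol: "solves (case_sum (\<lambda>v. f (crd v)) (\<lambda>w. g (crd w)))"
    by (simp add: solves_sum solves_hom[OF f solves_crd] solves_hom[OF g solves_crd])
  note h = subst_hom[OF p \<sigma> sol, folded h_def]
  have 1: "h \<circ> proj1 = f" and 2: "h \<circ> proj2 = g"
    by (rule hat_hom_eqI[OF p];
        simp add: is_ring_hom_comp h f g is_ring_hom_proj1 is_ring_hom_proj2 proj1_cst proj2_cst
          proj1_crd proj2_crd cst)+
  have "pairing f g = h"
    unfolding pairing_def
    by (rule the_equality) (auto simp: h 1 2 intro!: hat_sum_hom_eqI[OF p])
  with h(1) fun_cong[OF 1, of F] fun_cong[OF 2, of G] show "is_ring_hom (pairing f g)"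
    "pairing f g (proj1 F) = f F" "pairing f g (proj2 G) = g G"
    by simp_all
qed

section \<open>Compatibility with multiplication\<close>

lemma gl_mult:
  shows is_ring_hom_gl_mult: "is_ring_hom (gl_mult :: ('n::finite, 'r::with_prime) gl_hat \<Rightarrow> _)" (is ?A)
    and gl_mult_cst: "gl_mult (cst c) = (cst c :: ('n, 'r) gl2_hat)" (is ?B)
    and gl_mult_univ: "map_matrix gl_mult (gl_univ :: ('n, 'r) gl_mat)
      = map_matrix proj1 gl_univ ** map_matrix proj2 gl_univ"
proof -
  let ?m = "map_matrix proj1 gl_univ ** map_matrix proj2 gl_univ
    :: ('n, 'r) gl2_hat ^ 'n ^ 'n"
  have "det ?m = proj1 (det gl_univ) * proj2 (det gl_univ)"
    by (simp add: det_mul is_ring_hom_det[OF is_ring_hom_proj1] is_ring_hom_det[OF is_ring_hom_proj2])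
  then have "det ?m dvd 1"
    by (simp add: unit_mult is_ring_hom_unit[OF is_ring_hom_proj1] is_ring_hom_unit[OF is_ring_hom_proj2])
  then have sol: "solves (gl_coords ?m)"
    by (rule solves_gl_coords)
  show ?A ?B
    unfolding gl_mult_def
    by (auto intro: is_ring_hom_subst_hom subst_hom_cst is_ring_hom_cst sol)
  have "gl_mult (crd (Entry i j)) = gl_coords ?m (Entry i j)" for i j
    unfolding gl_mult_def by (rule subst_hom_crd) (simp_all add: is_ring_hom_cst sol)
  then show "map_matrix gl_mult gl_univ = ?m"
    by (simp add: vec_eq_iff gl_univ_def)
qed

lemma solves_gl_prod: "A \<subseteq> GL \<Longrightarrow> B \<subseteq> GL \<Longrightarrow> x \<in> gl_prod A B \<Longrightarrow> solves x"
  by (auto simp: gl_prod_def solves_sum GL_iff subset_iff intro!: solves_gl_coords)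

text \<open>The two composites send \<open>x\<close> to \<lambda> of the product times
  \<open>(X Y)^(p)\<close>, and to the product of the two \<lambda> times
  \<open>X^(p) Y^(p)\<close>. Matrices are compared at points, scalars by root uniqueness.\<close>

lemma lambda_lift_mult:
  fixes \<phi> :: "('n::finite, 'r::frobenius_dvr) gl_endo"
  assumes p: "\<not> base_prime TYPE('r) dvd CARD('n)" and \<phi>: "frobenius_lift \<phi>"
    and univ: "map_matrix \<phi> gl_univ = smat gl_lambda (ppow_mat gl_univ)"
    and sub: "A \<subseteq> GL" "B \<subseteq> GL"
    and mult: "\<And>a b. a \<in> A \<Longrightarrow> b \<in> B \<Longrightarrow> ppow_mat (a ** b) = ppow_mat a ** ppow_mat b"
  shows "gl_mult (\<phi> f) - gl_square \<phi> (gl_mult f) \<in> hat_ideal_of (gl_prod A B)"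
proof -
  let ?J = "hat_ideal_of (gl_prod A B)"
  define x where "x = (gl_univ :: ('n, 'r) gl_mat)"
  define X Y where "X = (map_matrix proj1 x :: ('n, 'r) gl2_hat ^ 'n ^ 'n)"
    and "Y = (map_matrix proj2 x :: ('n, 'r) gl2_hat ^ 'n ^ 'n)"
  have closed: "closed_ideal ?J"
    by (rule closed_ideal_hat_ideal_of[OF solves_gl_prod[OF sub]])
  then have J: "is_ideal ?J"
    by (simp add: closed_ideal_def)
  note hom = frobenius_lift_hom[OF \<phi>]
  have hom1: "is_ring_hom (proj1 \<circ> \<phi> :: _ \<Rightarrow> ('n, 'r) gl2_hat)"
    and hom2: "is_ring_hom (proj2 \<circ> \<phi> :: _ \<Rightarrow> ('n, 'r) gl2_hat)"
    by (intro is_ring_hom_comp is_ring_hom_proj1 is_ring_hom_proj2 hom)+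
  have cst: "(proj1 \<circ> \<phi>) (cst c) = ((proj2 \<circ> \<phi>) (cst c) :: ('n, 'r) gl2_hat)" for c
    by (simp add: frobenius_lift_cst[OF \<phi>] proj1_cst proj2_cst)
  have p': "base_prime TYPE(('n, 'r) gl2_hat) = base_prime TYPE('r)"
    by simp
  note sq = pairing[OF p' hom1 hom2 cst, folded gl_square_def]
  have sq_univ: "map_matrix (gl_square \<phi>) X = smat (proj1 gl_lambda) (ppow_mat X)"
    "map_matrix (gl_square \<phi>) Y = smat (proj2 gl_lambda) (ppow_mat Y)"
  proof -
    have "map_matrix (gl_square \<phi>) X = map_matrix proj1 (map_matrix \<phi> x)"
      by (simp add: X_def vec_eq_iff sq)
    then show "map_matrix (gl_square \<phi>) X = smat (proj1 gl_lambda) (ppow_mat X)"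
      by (simp add: x_def X_def univ map_matrix_smat is_ring_hom_proj1 map_matrix_ppow)
    have "map_matrix (gl_square \<phi>) Y = map_matrix proj2 (map_matrix \<phi> x)"
      by (simp add: Y_def vec_eq_iff sq)
    then show "map_matrix (gl_square \<phi>) Y = smat (proj2 gl_lambda) (ppow_mat Y)"
      by (simp add: x_def Y_def univ map_matrix_smat is_ring_hom_proj2 map_matrix_ppow)
  qed
  have X0: "X = map_matrix to_hat (\<chi> i j. coord_var (Inl (Entry i j)))"
    and Y0: "Y = map_matrix to_hat (\<chi> i j. coord_var (Inr (Entry i j)))"
    by (simp_all add: X_def Y_def x_def vec_eq_iff gl_univ_def proj1_crd proj2_crd flip: crd_def)
  \<comment> \<open>The difference involves no \<lambda> and comes from a function before
    completion, so vanishing at the points of the product suffices.\<close>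
  have ppow: "ppow_mat (X ** Y) $ i $ j - (ppow_mat X ** ppow_mat Y) $ i $ j \<in> ?J" for i j
  proof -
    let ?D = "ppow_mat (X ** Y) - ppow_mat X ** ppow_mat Y"
    note th = is_ring_hom_to_hat[where 'a = "('n gl_var + 'n gl_var, 'r) coord"]
    define X1 Y1 :: "('n gl_var + 'n gl_var, 'r) coord ^ 'n ^ 'n"
      where "X1 = (\<chi> i j. coord_var (Inl (Entry i j)))" and "Y1 = (\<chi> i j. coord_var (Inr (Entry i j)))"
    have D0: "?D = map_matrix to_hat (ppow_mat (X1 ** Y1) - ppow_mat X1 ** ppow_mat Y1)"
      by (simp add: X0 Y0 map_matrix_diff[OF th] map_matrix_mult[OF th] map_matrix_ppow[OF th]
          flip: X1_def Y1_def)
    have "point z (?D $ i $ j) = 0" if z: "z \<in> gl_prod A B" for z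
    proof -
      obtain a b where ab: "a \<in> A" "b \<in> B" "z = case_sum (gl_coords a) (gl_coords b)"
        using z by (auto simp: gl_prod_def)
      have sol: "solves z"
        by (rule solves_gl_prod[OF sub z])
      note hom = is_ring_hom_point[OF sol]
      have "point z (crd w) = case_sum (gl_coords a) (gl_coords b) w" for w
        using point_crd[OF sol, of w] by (simp only: ab(3))
      then have "map_matrix (point z) X = a" "map_matrix (point z) Y = b"
        by (simp_all add: vec_eq_iff X_def Y_def x_def gl_univ_def proj1_crd proj2_crd)
      then have "map_matrix (point z) (ppow_mat (X ** Y)) = map_matrix (point z) (ppow_mat X ** ppow_mat Y)"
        by (simp add: map_matrix_ppow[OF hom] map_matrix_mult[OF hom] mult[OF ab(1,2)])
      then show ?thesis
        by (simp add: vec_eq_iff is_ring_hom_diff[OF hom])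
    qed
    then have "?D $ i $ j \<in> ?J"
      unfolding D0 nth_map_matrix by (rule to_hat_in_hat_ideal_of)
    then show ?thesis
      by simp
  qed
  have lam: "gl_mult gl_lambda - proj1 gl_lambda * proj2 gl_lambda \<in> ?J"
  proof (rule is_lambda_mult_mod[OF _ J _ _ _ _ _ ppow])
    show "coprime CARD('n) (base_prime TYPE(('n, 'r) gl2_hat))"
      using coprime_base_prime[OF p] by simp
    show "det X dvd 1" "det Y dvd 1"
      by (simp_all add: X_def Y_def x_def is_ring_hom_unit is_ring_hom_proj1 is_ring_hom_proj2
          flip: is_ring_hom_det)
    show "is_lambda X (proj1 gl_lambda)" "is_lambda Y (proj2 gl_lambda)"
      by (simp_all add: X_def Y_def x_def is_lambda_hom is_ring_hom_proj1 is_ring_hom_proj2 gl_lambda[OF p])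
    show "is_lambda (X ** Y) (gl_mult gl_lambda)"
      using is_lambda_hom[OF is_ring_hom_gl_mult _ gl_lambda[OF p]] by (simp add: gl_mult_univ X_def Y_def x_def)
  qed
  have "(gl_mult \<circ> \<phi>) f - (gl_square \<phi> \<circ> gl_mult) f \<in> ?J"
  proof (rule gl_hom_cong[OF p' closed])
    show "is_ring_hom (gl_mult \<circ> \<phi>)" "is_ring_hom (gl_square \<phi> \<circ> gl_mult)"
      by (intro is_ring_hom_comp is_ring_hom_gl_mult sq hom)+
    have "gl_square \<phi> (cst c) = cst (frob c)" for c
      using sq(2)[of "cst c"] by (simp add: proj1_cst frobenius_lift_cst[OF \<phi>])
    then show "(gl_mult \<circ> \<phi>) (cst c) - (gl_square \<phi> \<circ> gl_mult) (cst c) \<in> ?J" for c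
      by (simp add: frobenius_lift_cst[OF \<phi>] gl_mult_cst ideal_0[OF J])
    fix i j
    have "map_matrix (gl_mult \<circ> \<phi>) x = smat (gl_mult gl_lambda) (ppow_mat (X ** Y))"
      by (simp add: x_def X_def Y_def univ map_matrix_smat is_ring_hom_gl_mult map_matrix_ppow gl_mult_univ
          flip: map_matrix_comp)
    moreover have "map_matrix (gl_square \<phi> \<circ> gl_mult) x
        = smat (proj1 gl_lambda * proj2 gl_lambda) (ppow_mat X ** ppow_mat Y)"
      using sq_univ map_matrix_mult[OF sq(1), of X Y]
      by (simp add: x_def X_def Y_def gl_mult_univ mult.commute flip: map_matrix_comp)
    ultimately show "map_matrix (gl_mult \<circ> \<phi>) gl_univ $ i $ j
        - map_matrix (gl_square \<phi> \<circ> gl_mult) gl_univ $ i $ j \<in> ?J"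
      unfolding x_def[symmetric] by (simp only: smat_nth ideal_cong_mult[OF J lam ppow])
  qed
  then show ?thesis
    by simp
qed

section \<open>The normalizer of the torus\<close>

text \<open>At most one nonzero entry in each row and column; invertibility is imposed
  separately.\<close>

definition monomial_mat :: "'a::zero ^ 'n ^ 'n \<Rightarrow> bool" where
  "monomial_mat g \<longleftrightarrow> (\<forall>i. \<exists>k. \<forall>j. j \<noteq> k \<longrightarrow> g $ i $ j = 0) \<and> (\<forall>j. \<exists>k. \<forall>i. i \<noteq> k \<longrightarrow> g $ i $ j = 0)"

lemma monomial_map_matrix:
  assumes "monomial_mat g" "f 0 = 0"
  shows "monomial_mat (map_matrix f g)"
proof -
  obtain q r where "\<And>i j. j \<noteq> q i \<Longrightarrow> g $ i $ j = 0" "\<And>i j. i \<noteq> r j \<Longrightarrow> g $ i $ j = 0"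
    using assms(1) unfolding monomial_mat_def by metis
  then have "\<forall>j. j \<noteq> q i \<longrightarrow> map_matrix f g $ i $ j = 0" "\<forall>i. i \<noteq> r j \<longrightarrow> map_matrix f g $ i $ j = 0" for i j
    using assms(2) by simp_all
  then show ?thesis
    unfolding monomial_mat_def by blast
qed

lemma torus_unit_entries:
  fixes t :: "'r::comm_ring_1 ^ 'n ^ 'n"
  shows "t \<in> torus \<longleftrightarrow> (\<forall>i j. i \<noteq> j \<longrightarrow> t $ i $ j = 0) \<and> (\<forall>i. t $ i $ i dvd 1)"
proof -
  have "det t dvd 1 \<longleftrightarrow> (\<forall>i. t $ i $ i dvd 1)" if "\<forall>i j. i \<noteq> j \<longrightarrow> t $ i $ j = 0"
  proof -
    have det: "det t = (\<Prod>i\<in>UNIV. t $ i $ i)"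
      using that by (intro det_diagonal) auto
    have "(\<Prod>i\<in>I. t $ i $ i) dvd 1" if "\<forall>i. t $ i $ i dvd 1" for I
      using that by (induction I rule: infinite_finite_induct) (auto intro: unit_mult)
    moreover have "t $ i $ i dvd (\<Prod>i\<in>UNIV. t $ i $ i)" for i
      by (rule dvd_prodI) auto
    ultimately show ?thesis
      unfolding det by (meson dvd_trans)
  qed
  then show ?thesis
    by (auto simp: torus_def GL_iff)
qed

lemma diag_mult_nth:
  fixes t g :: "'r::comm_ring_1 ^ 'n ^ 'n"
  assumes "\<forall>i j. i \<noteq> j \<longrightarrow> t $ i $ j = 0"
  shows "(t ** g) $ i $ j = t $ i $ i * g $ i $ j" "(g ** t) $ i $ j = g $ i $ j * t $ j $ j"
proof -
  have "(\<Sum>k\<in>UNIV. t $ i $ k * g $ k $ j) = (\<Sum>k\<in>{i}. t $ i $ k * g $ k $ j)"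
    using assms by (intro sum.mono_neutral_right) auto
  moreover have "(\<Sum>k\<in>UNIV. g $ i $ k * t $ k $ j) = (\<Sum>k\<in>{j}. g $ i $ k * t $ k $ j)"
    using assms by (intro sum.mono_neutral_right) auto
  ultimately show "(t ** g) $ i $ j = t $ i $ i * g $ i $ j" "(g ** t) $ i $ j = g $ i $ j * t $ j $ j"
    by (simp_all add: matrix_matrix_mult_def)
qed

lemma conjugate_eq_iff:
  fixes g :: "'r::comm_ring_1 ^ 'n ^ 'n"
  assumes "g \<in> GL"
  shows "g ** t ** matrix_inv g = s \<longleftrightarrow> g ** t = s ** g"
proof -
  have g: "g ** matrix_inv g = mat 1" "matrix_inv g ** g = mat 1"
    using assms by (simp_all add: GL_iff matrix_inv_right' matrix_inv_left')
  show ?thesis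
  proof
    assume "g ** t ** matrix_inv g = s"
    then have "s ** g = g ** t ** (matrix_inv g ** g)"
      by (simp add: matrix_mul_assoc)
    then show "g ** t = s ** g"
      by (simp add: g)
  next
    assume "g ** t = s ** g"
    then have "g ** t ** matrix_inv g = s ** (g ** matrix_inv g)"
      by (simp add: matrix_mul_assoc)
    then show "g ** t ** matrix_inv g = s"
      by (simp add: g)
  qed
qed

lemma regular_torus_element:
  obtains t :: "'r::frobenius_dvr ^ 'n::finite ^ 'n" where "t \<in> torus" "\<And>i j. t $ i $ i = t $ j $ j \<Longrightarrow> i = j"
proof
  \<comment> \<open>The value is \<open>1 + p^(i+1)\<close> with i the index number: a unit, and
    different for different indices.\<close>
  define c :: "'n \<Rightarrow> 'r" where "c i = 1 - pelt * (- (pelt ^ to_nat i))" for i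
  show "(\<chi> i j. if i = j then c i else 0) \<in> torus"
    unfolding torus_unit_entries by (simp add: c_def unit_one_minus_pelt del: mult_minus_right)
  fix i j :: 'n
  assume "(\<chi> i j. if i = j then c i else 0) $ i $ i = (\<chi> i j. if i = j then c i else 0) $ j $ j"
  then have eq: "(pelt :: 'r) ^ to_nat i = pelt ^ to_nat j"
    using pelt_nonzero[where 'a = 'r] by (simp add: c_def)
  have "\<not> a < b" if "(pelt :: 'r) ^ a = pelt ^ b" for a b
    using pelt_power_Suc_not_dvd[of "1 :: 'r" a] that le_imp_power_dvd[of "Suc a" b "pelt :: 'r"] by auto
  from this[OF eq] this[OF eq[symmetric]] have "to_nat i = to_nat j"
    by simp
  then show "i = j"
    by simp
qed

lemma torus_normalizer_iff:
  fixes g :: "'r::frobenius_dvr ^ 'n::finite ^ 'n"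
  shows "g \<in> torus_normalizer \<longleftrightarrow> g \<in> GL \<and> monomial_mat g"
proof safe
  assume g: "g \<in> torus_normalizer"
  then show GL: "g \<in> GL"
    by (simp add: torus_normalizer_def)
  have img: "(\<lambda>a. g ** a ** matrix_inv g) ` torus = torus"
    using g by (simp add: torus_normalizer_def)
  obtain t :: "'r ^ 'n ^ 'n" where t: "t \<in> torus" "\<And>i j. t $ i $ i = t $ j $ j \<Longrightarrow> i = j"
    using regular_torus_element by blast
  \<comment> \<open>Comparison of entries in \<open>g s = s' g\<close>; the base ring is a domain.
    With distinct diagonal entries on one side, at most one entry of a row or column
    survives.\<close>
  have entry: "g $ i $ j = 0 \<or> s $ j $ j = s' $ i $ i" if "s \<in> torus" "s' \<in> torus" "g ** s = s' ** g" for s s' i j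
  proof -
    have "(g ** s) $ i $ j = (s' ** g) $ i $ j"
      using that by simp
    then have "g $ i $ j * (s $ j $ j - s' $ i $ i) = 0"
      using that(1,2) by (simp add: torus_def diag_mult_nth algebra_simps)
    then show ?thesis
      by simp
  qed
  obtain s where s: "s \<in> torus" "g ** t = s ** g"
    using img t(1) conjugate_eq_iff[OF GL] by blast
  \<comment> \<open>Columns need the regular element on the left, hence the surjectivity of
    conjugation on the torus.\<close>
  obtain s' where s': "s' \<in> torus" "g ** s' = t ** g"
    using img t(1) conjugate_eq_iff[OF GL] by (metis (no_types, lifting) imageE)
  show "monomial_mat g"
    unfolding monomial_mat_def
  proof safe
    fix i
    show "\<exists>k. \<forall>j. j \<noteq> k \<longrightarrow> g $ i $ j = 0"
      using entry[OF t(1) s, of i] t(2) by metis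
  next
    fix j
    show "\<exists>k. \<forall>i. i \<noteq> k \<longrightarrow> g $ i $ j = 0"
      using entry[OF s'(1) t(1) s'(2), of _ j] t(2) by metis
  qed
next
  assume GL: "g \<in> GL" and "monomial_mat g"
  then obtain q r where q: "\<And>i j. j \<noteq> q i \<Longrightarrow> g $ i $ j = 0" and r: "\<And>i j. i \<noteq> r j \<Longrightarrow> g $ i $ j = 0"
    unfolding monomial_mat_def by metis
  have "g ** t ** matrix_inv g \<in> torus" if t: "t \<in> torus" for t
  proof -
    \<comment> \<open>Row \<open>i\<close> of \<open>g\<close> is supported at column
      \<open>q i\<close>, so moving \<open>t\<close> across \<open>g\<close> permutes its diagonal
      entries by \<open>q\<close>.\<close>
    define s where "s = (\<chi> i j. if i = j then t $ q i $ q i else 0)"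
    have "s \<in> torus"
      using t by (simp add: s_def torus_unit_entries)
    moreover have "g ** t = s ** g"
    proof -
      have "g $ i $ j * t $ j $ j = t $ q i $ q i * g $ i $ j" for i j
        using q[of j i] by (cases "j = q i") auto
      then show ?thesis
        using t \<open>s \<in> torus\<close> by (simp add: vec_eq_iff torus_def diag_mult_nth) (simp add: s_def)
    qed
    ultimately show ?thesis
      by (metis conjugate_eq_iff[OF GL])
  qed
  moreover have "\<exists>t\<in>torus. g ** t ** matrix_inv g = s" if s: "s \<in> torus" for s
  proof -
    define t where "t = (\<chi> i j. if i = j then s $ r i $ r i else 0)"
    have "t \<in> torus"
      using s by (simp add: t_def torus_unit_entries)
    moreover have "g ** t = s ** g"
    proof -
      have "g $ i $ j * s $ r j $ r j = s $ i $ i * g $ i $ j" for i j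
        using r[of i j] by (cases "i = r j") auto
      then show ?thesis
        using s \<open>t \<in> torus\<close> by (simp add: vec_eq_iff torus_def diag_mult_nth) (simp add: t_def)
    qed
    ultimately show ?thesis
      using conjugate_eq_iff[OF GL] by blast
  qed
  ultimately show "g \<in> torus_normalizer"
    using GL by (auto simp: torus_normalizer_def image_iff)
qed

lemma sum_power_single:
  fixes f :: "'i \<Rightarrow> 'a::comm_ring_1"
  assumes "\<And>i. i \<in> I \<Longrightarrow> i \<noteq> k \<Longrightarrow> f i = 0" "m > 0"
  shows "(sum f I) ^ m = (\<Sum>i\<in>I. f i ^ m)"
proof (cases "finite I \<and> k \<in> I")
  case True
  then have "sum f I = f k" "(\<Sum>i\<in>I. f i ^ m) = f k ^ m"
    using assms by (auto simp: sum.remove[of I k] zero_power)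
  then show ?thesis
    by simp
next
  case False
  then have "infinite I \<or> (\<forall>i\<in>I. f i = 0)"
    using assms(1) by blast
  then have "sum f I = 0" "(\<Sum>i\<in>I. f i ^ m) = 0"
    using assms(2) by (auto simp: zero_power)
  then show ?thesis
    using assms(2) by (simp add: zero_power)
qed

text \<open>Each entry of the product is a sum with at most one nonzero term, for which the p-th
  power is additive.\<close>

lemma ppow_mat_monomial_mult:
  fixes a b :: "'r::odd_prime ^ 'n ^ 'n"
  assumes "monomial_mat a \<or> monomial_mat b"
  shows "ppow_mat (a ** b) = ppow_mat a ** ppow_mat b"
proof -
  have "(\<Sum>l\<in>UNIV. a $ i $ l * b $ l $ j) ^ base_prime TYPE('r)
      = (\<Sum>l\<in>UNIV. (a $ i $ l * b $ l $ j) ^ base_prime TYPE('r))" for i j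
  proof -
    obtain k where "\<And>l. l \<noteq> k \<Longrightarrow> a $ i $ l = 0 \<or> b $ l $ j = 0"
      using assms unfolding monomial_mat_def by blast
    then have "a $ i $ l * b $ l $ j = 0" if "l \<noteq> k" for l
      using that by fastforce
    then show ?thesis
      by (intro sum_power_single[of _ k]) auto
  qed
  then show ?thesis
    by (simp add: vec_eq_iff ppow_mat_def matrix_matrix_mult_def power_mult_distrib)
qed

text \<open>At most one permutation contributes to the Leibniz formula, the one following the
  nonzero entries.\<close>

lemma det_ppow_monomial:
  fixes a :: "'r::odd_prime ^ 'n ^ 'n"
  assumes "monomial_mat a"
  shows "det (ppow_mat a) = det a ^ base_prime TYPE('r)"
proof -
  let ?f = "\<lambda>q. of_int (sign q) * (\<Prod>i\<in>UNIV. a $ i $ q i)"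
  obtain q where q: "\<And>i j. j \<noteq> q i \<Longrightarrow> a $ i $ j = 0"
    using assms unfolding monomial_mat_def by metis
  have "?f r = 0" if rq: "r \<noteq> q" for r
  proof -
    obtain i where "r i \<noteq> q i"
      using rq by (auto simp: fun_eq_iff)
    then have "(\<Prod>i\<in>UNIV. a $ i $ r i) = 0"
      using q by (metis finite prod_zero UNIV_I)
    then show ?thesis
      by simp
  qed
  then have "(sum ?f {r. r permutes UNIV}) ^ base_prime TYPE('r)
      = (\<Sum>r\<in>{r. r permutes UNIV}. ?f r ^ base_prime TYPE('r))"
    by (intro sum_power_single[of _ q]) auto
  then show ?thesis
    by (simp add: det_def ppow_mat_def power_mult_distrib prod_power_distrib of_int_sign_power odd_base_prime)
qed

lemma lambda_lift_bicompatible: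
  fixes \<phi> :: "('n::finite, 'r::frobenius_dvr) gl_endo"
  assumes p: "\<not> base_prime TYPE('r) dvd CARD('n)" and \<phi>: "frobenius_lift \<phi>"
    and univ: "map_matrix \<phi> gl_univ = smat gl_lambda (ppow_mat gl_univ)"
  shows "bicompatible \<phi> torus_normalizer"
proof -
  have sub: "torus_normalizer \<subseteq> (GL :: ('r ^ 'n ^ 'n) set)"
    by (auto simp: torus_normalizer_def)
  have "horizontal \<phi> (gl_coords ` torus_normalizer)"
  proof (rule lambda_lift_horizontal[OF p \<phi> univ sub])
    fix a :: "'r ^ 'n ^ 'n"
    assume "a \<in> torus_normalizer"
    then have a: "det a dvd 1" "monomial_mat a"
      by (simp_all add: torus_normalizer_iff GL_iff)
    show "det (ppow_mat a) = det a ^ base_prime TYPE('r)"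
      by (rule det_ppow_monomial[OF a(2)])
    have "inv frob (det (ppow_mat a)) dvd 1"
      by (rule is_ring_hom_unit[OF is_ring_hom_inv_frob unit_det_ppow[OF a(1)]])
    moreover have "monomial_mat (map_matrix (inv frob) (ppow_mat a))"
      unfolding ppow_mat_def
      by (intro monomial_map_matrix a(2)) (simp_all add: zero_power is_ring_hom_0[OF is_ring_hom_inv_frob])
    ultimately show "map_matrix (inv frob) (ppow_mat a) \<in> torus_normalizer"
      by (simp add: torus_normalizer_iff GL_iff is_ring_hom_det[OF is_ring_hom_inv_frob])
  qed
  moreover have "gl_mult (\<phi> f) - gl_square \<phi> (gl_mult f) \<in> hat_ideal_of (gl_prod torus_normalizer GL)"
    "gl_mult (\<phi> f) - gl_square \<phi> (gl_mult f) \<in> hat_ideal_of (gl_prod GL torus_normalizer)" for f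
    using sub by (auto intro!: lambda_lift_mult[OF p \<phi> univ] ppow_mat_monomial_mult
        simp: torus_normalizer_iff)
  ultimately show ?thesis
    by (simp add: bicompatible_def left_compatible_def right_compatible_def)
qed

section \<open>Root subgroups\<close>

lemma root_elem_nth: "root_elem i j \<mu> $ k $ l = (if k = l then 1 else 0) + (if k = i \<and> l = j then \<mu> else 0)"
  by (simp add: root_elem_def mat_def)

lemma det_root_elem:
  assumes "i \<noteq> j"
  shows "det (root_elem i j \<mu>) = 1"
proof -
  have "root_elem i j \<mu> = (\<chi> k. if k = i then row i (mat 1) + \<mu> *s row j (mat 1) else row k (mat 1))"
    using assms by (auto simp: vec_eq_iff root_elem_nth row_def mat_def)
  then show ?thesis
    by (simp add: det_row_operation[OF assms])
qed

lemma ppow_root_elem: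
  "i \<noteq> j \<Longrightarrow> ppow_mat (root_elem i j \<mu>) = root_elem i j (\<mu> ^ base_prime TYPE('a))"
  for \<mu> :: "'a::odd_prime"
  by (auto simp: vec_eq_iff ppow_mat_def root_elem_nth zero_power)

lemma map_root_elem:
  assumes "is_ring_hom h"
  shows "map_matrix h (root_elem i j \<mu>) = root_elem i j (h \<mu>)"
  by (simp add: vec_eq_iff root_elem_nth is_ring_hom_simps[OF assms])

lemma lambda_lift_root_horizontal:
  fixes \<phi> :: "('n::finite, 'r::frobenius_dvr) gl_endo"
  assumes p: "\<not> base_prime TYPE('r) dvd CARD('n)" and \<phi>: "frobenius_lift \<phi>"
    and univ: "map_matrix \<phi> gl_univ = smat gl_lambda (ppow_mat gl_univ)" and ij: "i \<noteq> j"
  shows "horizontal \<phi> (gl_coords ` range (root_elem i j))"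
  by (rule lambda_lift_horizontal[OF p \<phi> univ])
    (auto simp: GL_iff det_root_elem[OF ij] ppow_root_elem[OF ij] map_root_elem[OF is_ring_hom_inv_frob])

lemma root_embedding:
  assumes ij: "i \<noteq> (j :: 'n::finite)"
  shows is_ring_hom_root_embedding: "is_ring_hom (root_embedding i j :: ('n, 'r::with_prime) gl_hat \<Rightarrow> _)" (is ?A)
    and root_embedding_cst: "root_embedding i j (cst c) = (cst c :: (unit, 'r) hat_ring)" (is ?B)
    and root_embedding_univ: "map_matrix (root_embedding i j) (gl_univ :: ('n, 'r) gl_mat)
      = root_elem i j (crd ())" (is ?C)
proof -
  have sol: "solves (gl_coords (root_elem i j (crd ()) :: (unit, 'r) hat_ring ^ 'n ^ 'n))"
    by (rule solves_gl_coords) (simp add: det_root_elem[OF ij])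
  show ?A ?B
    unfolding root_embedding_def
    by (auto intro: is_ring_hom_subst_hom subst_hom_cst is_ring_hom_cst sol)
  have "root_embedding i j (crd (Entry k l))
      = gl_coords (root_elem i j (crd ()) :: (unit, 'r) hat_ring ^ 'n ^ 'n) (Entry k l)" for k l
    unfolding root_embedding_def by (rule subst_hom_crd) (simp_all add: is_ring_hom_cst sol)
  then show ?C
    by (simp add: vec_eq_iff gl_univ_def)
qed

lemma lambda_lift_root_induced:
  fixes \<phi> :: "('n::finite, 'r::frobenius_dvr) gl_endo"
  assumes p: "\<not> base_prime TYPE('r) dvd CARD('n)" and \<phi>: "frobenius_lift \<phi>"
    and univ: "map_matrix \<phi> gl_univ = smat gl_lambda (ppow_mat gl_univ)" and ij: "i \<noteq> j"
  shows "\<exists>\<psi>. induced_lift (root_embedding i j) \<phi> \<psi> \<and>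
    (\<forall>\<psi>'. induced_lift (root_embedding i j) \<phi> \<psi>' \<longrightarrow> \<psi>' = \<psi>) \<and>
    \<psi> (crd ()) = crd () ^ base_prime TYPE('r)"
proof -
  let ?p = "base_prime TYPE('r)"
  let ?z = "crd () :: (unit, 'r) hat_ring"
  let ?u = "root_embedding i j :: ('n, 'r) gl_hat \<Rightarrow> (unit, 'r) hat_ring"
  note u = root_embedding[OF ij, where 'r = 'r]
  have "is_lambda (root_elem i j ?z) (?u gl_lambda)"
    using is_lambda_hom[OF u(1) _ gl_lambda[OF p]] by (simp add: u)
  \<comment> \<open>A root element and its entrywise p-th power both have determinant 1, so
    \<lambda> restricts to 1 exactly.\<close>
  then have "?u gl_lambda - 1 \<in> {0}"
    using coprime_base_prime[OF p]
    by (intro is_lambda_one_mod[OF _ is_ideal_zero, where X = "root_elem i j ?z"]) (simp_all add: det_root_elem[OF ij] ppow_root_elem[OF ij])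
  then have u\<phi>: "map_matrix (?u \<circ> \<phi>) gl_univ = root_elem i j (?z ^ ?p)"
    by (simp add: univ map_matrix_smat[OF u(1)] map_matrix_ppow[OF u(1)] u ppow_root_elem[OF ij]
        flip: map_matrix_comp)
  obtain \<psi> where \<psi>: "frobenius_lift \<psi>" "\<And>v. \<psi> (crd v :: (unit, 'r) hat_ring) = crd v ^ ?p"
    using frobenius_lift_exists[of "\<lambda>v. crd v ^ ?p :: (unit, 'r) hat_ring"] solves_unit by auto
  have "\<psi> \<circ> ?u = ?u \<circ> \<phi>"
  proof (rule gl_hom_eqI)
    show "map_matrix (\<psi> \<circ> ?u) gl_univ = map_matrix (?u \<circ> \<phi>) gl_univ"
      unfolding u\<phi> by (simp add: u map_root_elem[OF frobenius_lift_hom[OF \<psi>(1)]] \<psi>(2) flip: map_matrix_comp)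
  qed (auto simp: frobenius_lift_cst[OF \<phi>] frobenius_lift_cst[OF \<psi>(1)] u
      intro!: is_ring_hom_comp frobenius_lift_hom \<phi> \<psi>(1))
  then have "induced_lift ?u \<phi> \<psi>"
    by (simp add: induced_lift_def \<psi>(1))
  moreover have "\<psi>' = \<psi>" if "induced_lift ?u \<phi> \<psi>'" for \<psi>'
  proof -
    have \<psi>': "frobenius_lift \<psi>'" "\<psi>' \<circ> ?u = ?u \<circ> \<phi>"
      using that by (simp_all add: induced_lift_def)
    have "root_elem i j (\<psi>' ?z) = map_matrix (\<psi>' \<circ> ?u) gl_univ"
      by (simp add: u map_root_elem[OF frobenius_lift_hom[OF \<psi>'(1)]] flip: map_matrix_comp)
    \<comment> \<open>The coordinate \<open>z\<close> is the entry at position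
      \<open>(i, j)\<close>, so the matrix identity determines the induced lift.\<close>
    then have "root_elem i j (\<psi>' ?z) $ i $ j = root_elem i j (?z ^ ?p) $ i $ j"
      by (simp only: \<psi>'(2) u\<phi>)
    then have "\<psi>' ?z = ?z ^ ?p"
      using ij by (simp add: root_elem_nth)
    then show ?thesis
      by (intro frobenius_lift_eqI \<psi>' \<psi>(1)) (simp add: \<psi>(2))
  qed
  ultimately show ?thesis
    using \<psi>(2) by blast
qed

section \<open>The group \<open>G\<close> and its lifts of Frobenius\<close>

text \<open>The points of \<open>G\<close> with values in \<open>'b\<close>.\<close>

definition g_valid :: "('n::finite, 'b::comm_ring_1) g_point \<Rightarrow> bool" where
  "g_valid g \<longleftrightarrow> det (fst g) dvd 1 \<and> snd g dvd 1 \<and> (det (fst g))\<^sup>2 = snd g ^ CARD('n)"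

lemma fst_g_map [simp]: "fst (g_map h g) = map_matrix h (fst g)"
  and snd_g_map [simp]: "snd (g_map h g) = h (snd g)"
  by (simp_all add: g_map_def)

lemma g_map_comp: "g_map (h \<circ> h') g = g_map h (g_map h' g)"
  by (simp add: prod_eq_iff map_matrix_comp)

lemma g_valid_map:
  assumes h: "is_ring_hom h" and g: "g_valid g"
  shows "g_valid (g_map h g)"
proof -
  have "h ((det (fst g))\<^sup>2) = h (snd g ^ CARD('c))"
    using g by (simp add: g_valid_def)
  then show ?thesis
    using g by (simp add: g_valid_def is_ring_hom_unit[OF h] is_ring_hom_power[OF h]
        flip: is_ring_hom_det[OF h])
qed

lemma g_valid_univ: "g_valid (g_univ :: ('n::finite, 'r::with_prime) g_upoint)"
  by (simp add: g_valid_def g_univ_relations(3)[OF refl])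

lemma g_hom_eqI:
  fixes h h' :: "('n::finite, 'r::with_prime) g_hat \<Rightarrow> 'b::padic_complete"
  assumes p: "base_prime TYPE('b) = base_prime TYPE('r)"
    and h: "is_ring_hom h" "is_ring_hom h'" and cst: "\<And>c. h (cst c) = h' (cst c)"
    and univ: "g_map h g_univ = g_map h' g_univ"
  shows "h = h'"
proof (rule hat_hom_eqI[OF p h cst])
  fix v :: "'n g_var"
  have mat: "map_matrix h (fst g_univ) = map_matrix h' (fst g_univ)" and scal: "h (snd g_univ) = h' (snd g_univ)"
    using univ by (simp_all add: prod_eq_iff)
  have inv: "h b = h' b" if "h a = h' a" "a * b = 1" for a b
  proof -
    have "h a * h b = 1"
      using that(2) is_ring_hom_mult[OF h(1), of a b] by (simp add: is_ring_hom_1[OF h(1)])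
    moreover have "h a * h' b = 1"
      using that is_ring_hom_mult[OF h(2), of a b] by (simp add: is_ring_hom_1[OF h(2)])
    ultimately show ?thesis
      using ring_inv_eqI[of "h a"] by metis
  qed
  show "h (crd v) = h' (crd v)"
  proof (cases v)
    case (GEntry i j)
    then show ?thesis
      using mat by (simp add: vec_eq_iff g_univ_def)
  next
    case GDetInv
    have "h (det (fst g_univ)) = h' (det (fst g_univ))"
      by (simp add: is_ring_hom_det[OF h(1)] is_ring_hom_det[OF h(2)] mat)
    then show ?thesis
      unfolding GDetInv by (rule inv) (rule g_univ_relations(1)[OF refl])
  next
    case GScal
    then show ?thesis
      using scal by (simp add: g_univ_def)
  next
    case GScalInv
    show ?thesis
      unfolding GScalInv by (rule inv[OF scal]) (rule g_univ_relations(2)[OF refl])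
  qed
qed

lemma subst_hom_g_coords:
  fixes g :: "('n::finite, 'b::padic_complete) g_point" and \<sigma> :: "'r::with_prime \<Rightarrow> 'b"
  assumes p: "base_prime TYPE('b) = base_prime TYPE('r)" and \<sigma>: "is_ring_hom \<sigma>" and g: "g_valid g"
  shows "is_ring_hom (subst_hom \<sigma> (g_coords g))" "subst_hom \<sigma> (g_coords g) (cst c) = \<sigma> c"
    "g_map (subst_hom \<sigma> (g_coords g)) g_univ = g"
proof -
  have sol: "solves (g_coords g)"
    using g by (intro solves_g_coords) (simp_all add: g_valid_def)
  note h = subst_hom[OF p \<sigma> sol]
  show "is_ring_hom (subst_hom \<sigma> (g_coords g))" "subst_hom \<sigma> (g_coords g) (cst c) = \<sigma> c"
    by (rule h)+
  show "g_map (subst_hom \<sigma> (g_coords g)) g_univ = g"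
    by (simp add: g_map_def g_univ_def vec_eq_iff prod_eq_iff h)
qed

lemma unit_pow_cong:
  fixes u v :: "'b::{padic_complete, odd_prime}"
  assumes "u dvd 1" "pelt dvd v - u ^ base_prime TYPE('b)"
  shows "v dvd 1"
  using unit_cong_pelt[OF unit_power[OF assms(1)] assms(2)] .

text \<open>The image of t is fixed by its n-th power and its residue modulo p. This is the
  uniqueness half of lifting along the etale map from \<open>G\<close> to
  \<open>GL_n\<close>.\<close>

lemma g_lift_scal:
  fixes \<psi> :: "('n::finite, 'r::frobenius_dvr) g_hat \<Rightarrow> ('n, 'r) g_hat"
  assumes p: "\<not> base_prime TYPE('r) dvd CARD('n)" and \<psi>: "frobenius_lift \<psi>"
    and s: "s ^ CARD('n) = (det (map_matrix \<psi> (fst g_univ)))\<^sup>2"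
    "of_nat (base_prime TYPE('r)) dvd s - snd g_univ ^ base_prime TYPE('r)"
  shows "\<psi> (snd g_univ) = s"
proof (rule root_unique)
  show "coprime CARD('n) (base_prime TYPE(('n, 'r) g_hat))"
    using coprime_base_prime[OF p] by simp
  show "s dvd 1"
    using unit_pow_cong[OF unit_g_univ(2), of s] s(2) by simp
  show "pelt dvd \<psi> (snd g_univ) - s"
    using dvd_diff_trans[OF frobenius_lift_cong[OF \<psi>] dvd_diff_sym[OF s(2)]] by simp
  have "g_valid (g_map \<psi> g_univ)"
    by (rule g_valid_map[OF frobenius_lift_hom[OF \<psi>] g_valid_univ])
  then show "\<psi> (snd g_univ) ^ CARD('n) = s ^ CARD('n)"
    by (simp add: g_valid_def s(1))
qed

lemma g_univ_power:
  "(snd g_univ ^ base_prime TYPE('r)) ^ CARD('n)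
    = (det (fst (g_univ :: ('n::finite, 'r::with_prime) g_upoint)) ^ base_prime TYPE('r))\<^sup>2"
proof -
  let ?g = "g_univ :: ('n, 'r) g_upoint" and ?p = "base_prime TYPE('r)"
  have "(snd ?g ^ ?p) ^ CARD('n) = (snd ?g ^ CARD('n)) ^ ?p"
    by (simp add: mult.commute flip: power_mult)
  also have "\<dots> = (det (fst ?g) ^ ?p)\<^sup>2"
    unfolding g_univ_relations(3)[OF refl, symmetric] by (simp add: mult.commute flip: power_mult)
  finally show ?thesis .
qed

text \<open>With \<open>X\<close> the image of the matrix part, t must go to an n-th root of
  \<open>det(X)^2\<close> congruent to \<open>t^p\<close>. Such a root exists because
  \<open>det(X)^2\<close> and \<open>t^(pn)\<close> agree modulo p and n is prime to p.\<close>

lemma g_extension: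
  fixes \<phi> :: "('n::finite, 'r::frobenius_dvr) gl_endo"
  assumes p: "\<not> base_prime TYPE('r) dvd CARD('n)" and \<phi>: "frobenius_lift \<phi>"
  shows frobenius_lift_g_extension: "frobenius_lift (g_extension \<phi>)"
    and g_extension_projection: "g_extension \<phi> \<circ> g_projection = g_projection \<circ> \<phi>"
    and g_extension_univ: "map_matrix (g_extension \<phi>) (fst g_univ) = map_matrix g_projection (map_matrix \<phi> gl_univ)"
proof -
  let ?p = "base_prime TYPE('r)"
  let ?x = "fst g_univ :: ('n, 'r) g_mat" and ?t = "snd g_univ :: ('n, 'r) g_hat"
  let ?\<pi> = "g_projection :: ('n, 'r) gl_hat \<Rightarrow> ('n, 'r) g_hat"
  define X where "X = map_matrix ?\<pi> (map_matrix \<phi> gl_univ)"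
  note \<pi> = is_ring_hom_g_projection[where 'n = 'n and 'r = 'r]
  let ?J = "{x. of_nat ?p dvd (x :: ('n, 'r) g_hat)}"
  have J: "is_ideal ?J"
    by (rule is_ideal_dvd)
  have \<pi>\<phi>: "of_nat ?p dvd ?\<pi> (\<phi> f) - ?\<pi> f ^ ?p" for f
    using is_ring_hom_dvd_diff[OF \<pi>, of ?p 1 "\<phi> f" "f ^ ?p"] frobenius_lift_cong[OF \<phi>, of f]
    by (simp add: is_ring_hom_power[OF \<pi>])
  have \<pi>x: "?\<pi> (crd (Entry i j)) = ?x $ i $ j" for i j
    using g_projection_gl_univ[where 'n = 'n and 'r = 'r] by (simp add: vec_eq_iff gl_univ_def)
  have detX: "det X = ?\<pi> (\<phi> (det gl_univ))"
    by (simp add: X_def is_ring_hom_det[OF \<pi>] is_ring_hom_det[OF frobenius_lift_hom[OF \<phi>]])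
  have det: "?\<pi> (det gl_univ) = det ?x"
    by (simp add: is_ring_hom_det[OF \<pi>] g_projection_gl_univ)
  have detX_cong: "of_nat ?p dvd det X - det ?x ^ ?p"
    using \<pi>\<phi>[of "det gl_univ"] by (simp add: detX det)
  have unit: "det X dvd 1"
    using unit_pow_cong[OF unit_g_univ(1), of "det X"] detX_cong by simp
  have t: "?t ^ ?p dvd 1"
    by (simp add: unit_power)
  \<comment> \<open>The ratio of the required n-th power to that of \<open>t^p\<close>; being 1
    modulo p it has an n-th root \<open>r\<close>, and \<open>r * t^p\<close> is the image of
    t.\<close>
  define V where "V = (det X)\<^sup>2 * ring_inv ((?t ^ ?p) ^ CARD('n))"
  note tn = g_univ_power[where 'n = 'n and 'r = 'r]
  have "of_nat ?p dvd (det X)\<^sup>2 - (?t ^ ?p) ^ CARD('n)"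
    unfolding tn by (rule dvd_diff_power[OF detX_cong])
  then have "of_nat ?p dvd ring_inv ((?t ^ ?p) ^ CARD('n)) * ((det X)\<^sup>2 - (?t ^ ?p) ^ CARD('n))"
    by (rule dvd_mult)
  then have "of_nat ?p dvd V - 1"
    using ring_inv_left[OF unit_power[OF t, of "CARD('n)"]]
    by (simp add: V_def right_diff_distrib mult.commute)
  then obtain r where r: "r ^ CARD('n) = V" "of_nat ?p dvd r - 1"
    using root_exists[of "CARD('n)" V] coprime_base_prime[OF p] by auto
  define s where "s = r * ?t ^ ?p"
  have s_cong: "of_nat ?p dvd s - ?t ^ ?p"
    using dvd_mult2[OF r(2), of "?t ^ ?p"] by (simp add: s_def algebra_simps)
  have s_pow: "s ^ CARD('n) = (det X)\<^sup>2"
    using ring_inv_left[OF unit_power[OF t, of "CARD('n)"]]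
    by (simp add: s_def power_mult_distrib r(1) V_def mult.assoc)
  have s_unit: "s dvd 1"
    using unit_pow_cong[OF unit_g_univ(2), of s] s_cong by simp
  have valid: "g_valid (X, s)"
    by (simp add: g_valid_def unit s_unit s_pow)
  have inverse: "of_nat ?p dvd ring_inv a - b ^ ?p"
    if "a dvd 1" "c * b = 1" "of_nat ?p dvd a - c ^ ?p" for a b c :: "('n, 'r) g_hat"
  proof -
    have "c ^ ?p * b ^ ?p = 1"
      by (simp add: that(2) flip: power_mult_distrib)
    from ideal_cong_inverse[OF J ring_inv_right[OF that(1)] this] that(3) show ?thesis
      by simp
  qed
  have "of_nat ?p dvd g_coords (X, s) v - crd v ^ ?p" for v
  proof (cases v)
    case (GEntry i j)
    then show ?thesis
      using \<pi>\<phi>[of "crd (Entry i j)"] by (simp add: X_def gl_univ_def \<pi>x) (simp add: g_univ_def)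
  next
    case GDetInv
    then show ?thesis
      using inverse[OF unit g_univ_relations(1)[OF refl] detX_cong] by simp
  next
    case GScal
    then show ?thesis
      using s_cong by (simp add: g_univ_def)
  next
    case GScalInv
    then show ?thesis
      using inverse[OF s_unit g_univ_relations(2)[OF refl] s_cong] by simp
  qed
  then obtain \<psi> where \<psi>: "frobenius_lift \<psi>" "\<And>v. \<psi> (crd v) = g_coords (X, s) v"
    using frobenius_lift_exists[OF solves_g_coords] unit s_unit s_pow by (metis fst_conv snd_conv)
  have \<psi>x: "map_matrix \<psi> ?x = X" and \<psi>t: "\<psi> ?t = s"
    by (simp_all add: vec_eq_iff g_univ_def \<psi>(2))
  have ext: "\<psi> \<circ> ?\<pi> = ?\<pi> \<circ> \<phi>"
  proof (rule gl_hom_eqI)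
    show "map_matrix (\<psi> \<circ> ?\<pi>) gl_univ = map_matrix (?\<pi> \<circ> \<phi>) gl_univ"
      by (simp add: g_projection_gl_univ \<psi>x X_def flip: map_matrix_comp)
  qed (auto simp: frobenius_lift_cst[OF \<phi>] frobenius_lift_cst[OF \<psi>(1)] g_projection_cst
      intro!: is_ring_hom_comp \<pi> frobenius_lift_hom \<phi> \<psi>(1))
  have "g_extension \<phi> = \<psi>"
    unfolding g_extension_def
  proof (rule the_equality)
    fix \<psi>'
    assume "frobenius_lift \<psi>' \<and> \<psi>' \<circ> ?\<pi> = ?\<pi> \<circ> \<phi>"
    then have \<psi>': "frobenius_lift \<psi>'" "\<psi>' \<circ> ?\<pi> = ?\<pi> \<circ> \<phi>"
      by auto
    have "map_matrix \<psi>' ?x = map_matrix (\<psi>' \<circ> ?\<pi>) gl_univ"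
      by (simp add: g_projection_gl_univ flip: map_matrix_comp)
    then have \<psi>'x: "map_matrix \<psi>' ?x = X"
      by (simp add: \<psi>'(2) X_def map_matrix_comp)
    moreover have "\<psi>' ?t = s"
      by (rule g_lift_scal[OF p \<psi>'(1)]) (simp_all add: \<psi>'x s_pow s_cong)
    ultimately show "\<psi>' = \<psi>"
      by (intro g_hom_eqI) (simp_all add: frobenius_lift_hom frobenius_lift_cst \<psi>'(1) \<psi>(1)
          prod_eq_iff \<psi>x \<psi>t)
  qed (use ext \<psi>(1) in blast)
  with ext \<psi>(1) \<psi>x show "frobenius_lift (g_extension \<phi>)"
    "g_extension \<phi> \<circ> g_projection = g_projection \<circ> \<phi>"
    "map_matrix (g_extension \<phi>) (fst g_univ) = map_matrix g_projection (map_matrix \<phi> gl_univ)"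
    by (simp_all add: X_def)
qed

section \<open>The maps \<open>\<H>\<close> and \<open>\<B>\<close>\<close>

lemma g_bilinear_eq:
  assumes g: "g_valid g"
  shows "g_bilinear g h = (smat (snd g) (matrix_inv (fst g) ** fst h), snd g * snd h)"
proof -
  have unit: "det (fst g) dvd 1" "snd g dvd 1"
    using g by (simp_all add: g_valid_def)
  then show ?thesis
    by (simp add: g_bilinear_def g_times_def g_inverse_def g_tau_def matrix_inv_smat unit_ring_inv
        ring_inv_ring_inv)
qed

lemma g_quadratic_bilinear: "g_quadratic g = g_bilinear g g"
  by (simp add: g_quadratic_def g_bilinear_def)

lemma g_quadratic_eq:
  assumes g: "g_valid g"
  shows "g_quadratic g = (smat (snd g) (mat 1), (snd g)\<^sup>2)"
  using g by (simp add: g_quadratic_bilinear g_bilinear_eq matrix_inv_left' power2_eq_square g_valid_def)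

lemma g_valid_bilinear:
  fixes g h :: "('n::finite, 'b::comm_ring_1) g_point"
  assumes g: "g_valid g" and h: "g_valid h"
  shows "g_valid (g_bilinear g h)"
proof -
  have unit: "det (fst g) dvd 1" "snd g dvd 1" "det (fst h) dvd 1" "snd h dvd 1"
    using g h by (simp_all add: g_valid_def)
  have det: "det (fst (g_bilinear g h)) = snd g ^ CARD('n) * (ring_inv (det (fst g)) * det (fst h))"
    by (simp add: g_bilinear_eq[OF g] det_smat det_mul det_matrix_inv(1)[OF unit(1)])
  then have "det (fst (g_bilinear g h)) dvd 1"
    by (simp add: unit unit_mult unit_power unit_ring_inv)
  moreover have "snd (g_bilinear g h) dvd 1"
    by (simp add: g_bilinear_eq[OF g] unit unit_mult)
  moreover have "(det (fst (g_bilinear g h)))\<^sup>2 = snd (g_bilinear g h) ^ CARD('n)"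
  proof -
    have "(det (fst (g_bilinear g h)))\<^sup>2
        = (snd g ^ CARD('n))\<^sup>2 * (ring_inv ((det (fst g))\<^sup>2) * (det (fst h))\<^sup>2)"
      by (simp add: det power_mult_distrib ring_inv_power[OF unit(1)])
    also have "\<dots> = snd g ^ CARD('n) * (snd g ^ CARD('n) * ring_inv (snd g ^ CARD('n))) * snd h ^ CARD('n)"
      using g h by (simp add: g_valid_def power2_eq_square mult.assoc)
    also have "\<dots> = snd g ^ CARD('n) * snd h ^ CARD('n)"
      by (simp add: ring_inv_right unit_power unit)
    finally show ?thesis
      by (simp add: g_bilinear_eq[OF g] power_mult_distrib)
  qed
  ultimately show ?thesis
    by (simp add: g_valid_def)
qed

lemma g_map_bilinear:
  assumes h: "is_ring_hom h" and g: "g_valid g"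
  shows "g_map h (g_bilinear g g') = g_bilinear (g_map h g) (g_map h g')"
  using g by (simp add: g_bilinear_eq[OF g] g_bilinear_eq[OF g_valid_map[OF h g]] prod_eq_iff
      map_matrix_smat[OF h] map_matrix_mult[OF h] map_matrix_inv[OF h] is_ring_hom_mult[OF h] g_valid_def)

lemma H_comorphism:
  shows is_ring_hom_H_comorphism: "is_ring_hom (H_comorphism :: ('n::finite, 'r::with_prime) g_hat \<Rightarrow> _)" (is ?A)
    and H_comorphism_cst: "H_comorphism (cst c) = (cst c :: ('n, 'r) g_hat)" (is ?B)
    and H_comorphism_univ: "g_map (H_comorphism :: ('n, 'r) g_hat \<Rightarrow> _) g_univ = g_quadratic g_univ" (is ?C)
proof -
  have "g_valid (g_quadratic (g_univ :: ('n, 'r) g_upoint))"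
    by (simp add: g_quadratic_bilinear g_valid_bilinear g_valid_univ)
  note h = subst_hom_g_coords[OF _ is_ring_hom_cst this, folded H_comorphism_def]
  show ?A ?B ?C
    by (rule h; simp)+
qed

lemma B_comorphism:
  shows is_ring_hom_B_comorphism: "is_ring_hom (B_comorphism :: ('n::finite, 'r::with_prime) g_hat \<Rightarrow> _)" (is ?A)
    and B_comorphism_cst: "B_comorphism (cst c) = (cst c :: ('n g_var + 'n g_var, 'r) hat_ring)" (is ?B)
    and B_comorphism_univ: "g_map (B_comorphism :: ('n, 'r) g_hat \<Rightarrow> _) g_univ
      = g_bilinear (g_map proj1 g_univ) (g_map proj2 g_univ)" (is ?C)
proof -
  have "g_valid (g_bilinear (g_map proj1 g_univ) (g_map proj2 g_univ)
      :: ('n, ('n g_var + 'n g_var, 'r) hat_ring) g_point)"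
    by (intro g_valid_bilinear g_valid_map is_ring_hom_proj1 is_ring_hom_proj2 g_valid_univ)
  note h = subst_hom_g_coords[OF _ is_ring_hom_cst this, folded B_comorphism_def]
  show ?A ?B ?C
    by (rule h; simp)+
qed

lemma pairing_B_comorphism:
  fixes f g :: "('n::finite, 'r::frobenius_dvr) g_hat \<Rightarrow> ('n, 'r) g_hat"
  assumes f: "frobenius_lift f" and g: "frobenius_lift g"
  shows "is_ring_hom (pairing f g \<circ> B_comorphism)" "(pairing f g \<circ> B_comorphism) (cst c) = cst (frob c)"
    "g_map (pairing f g \<circ> B_comorphism) g_univ = g_bilinear (g_map f g_univ) (g_map g g_univ)"
proof -
  note pr = pairing[OF _ frobenius_lift_hom[OF f] frobenius_lift_hom[OF g], simplified frobenius_lift_cst[OF f]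
      frobenius_lift_cst[OF g], OF _ refl]
  have hom: "is_ring_hom (pairing f g)"
    by (rule pr) simp
  show "is_ring_hom (pairing f g \<circ> B_comorphism)"
    by (intro is_ring_hom_comp hom is_ring_hom_B_comorphism)
  have p1: "pairing f g (proj1 F) = f F" and p2: "pairing f g (proj2 F) = g F" for F
    by (rule pr; simp)+
  show "(pairing f g \<circ> B_comorphism) (cst c) = cst (frob c)"
    using p1[of "cst c"] by (simp add: B_comorphism_cst proj1_cst frobenius_lift_cst[OF f])
  have "g_map (pairing f g \<circ> B_comorphism) g_univ
      = g_bilinear (g_map (pairing f g) (g_map proj1 g_univ)) (g_map (pairing f g) (g_map proj2 g_univ))"
    unfolding g_map_comp B_comorphism_univ
    by (intro g_map_bilinear hom g_valid_map is_ring_hom_proj1 g_valid_univ)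
  also have "g_map (pairing f g) (g_map proj1 g_univ) = g_map f g_univ"
    by (simp add: prod_eq_iff vec_eq_iff p1)
  also have "g_map (pairing f g) (g_map proj2 g_univ) = g_map g g_univ"
    by (simp add: prod_eq_iff vec_eq_iff p2)
  finally show "g_map (pairing f g \<circ> B_comorphism) g_univ = g_bilinear (g_map f g_univ) (g_map g g_univ)" .
qed

text \<open>Both composites are homomorphisms acting by \<open>frob\<close> on constants, so they
  agree iff they agree on the universal point.\<close>

lemma B_symmetric_iff:
  fixes \<phi> \<phi>0 :: "('n::finite, 'r::frobenius_dvr) gl_endo"
  assumes p: "\<not> base_prime TYPE('r) dvd CARD('n)" and \<phi>0: "frobenius_lift \<phi>0" and \<phi>: "frobenius_lift \<phi>"
  shows "B_symmetric \<phi>0 \<phi> \<longleftrightarrow>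
    g_bilinear (g_map (g_extension \<phi>0) g_univ) (g_map (g_extension \<phi>) g_univ)
    = g_bilinear (g_map (g_extension \<phi>) g_univ) (g_map (g_extension \<phi>0) g_univ)"
    (is "_ \<longleftrightarrow> ?A = ?B")
proof -
  let ?L = "pairing (g_extension \<phi>0) (g_extension \<phi>) \<circ> B_comorphism"
  let ?R = "pairing (g_extension \<phi>) (g_extension \<phi>0) \<circ> B_comorphism"
  note l = frobenius_lift_g_extension[OF p \<phi>0] frobenius_lift_g_extension[OF p \<phi>]
  note 1 = pairing_B_comorphism[OF l] and 2 = pairing_B_comorphism[OF l(2) l(1)]
  have "?L = ?R" if "?A = ?B"
    using that by (intro g_hom_eqI) (simp_all only: 1 2 base_prime_padic base_prime_coord)
  moreover have "?A = ?B" if "?L = ?R"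
    using that by (simp only: 1(3)[symmetric] 2(3)[symmetric])
  ultimately show ?thesis
    unfolding B_symmetric_def by blast
qed

lemma H_horizontal_iff:
  fixes \<phi> \<phi>0 :: "('n::finite, 'r::frobenius_dvr) gl_endo"
  assumes p: "\<not> base_prime TYPE('r) dvd CARD('n)" and \<phi>0: "frobenius_lift \<phi>0" and \<phi>: "frobenius_lift \<phi>"
  shows "H_horizontal \<phi>0 \<phi> \<longleftrightarrow>
    g_quadratic (g_map (g_extension \<phi>) g_univ) = g_map H_comorphism (g_map (g_extension \<phi>0) g_univ)"
    (is "_ \<longleftrightarrow> ?A = ?B")
proof -
  let ?L = "g_extension \<phi> \<circ> H_comorphism" and ?R = "H_comorphism \<circ> g_extension \<phi>0"
  note l0 = frobenius_lift_g_extension[OF p \<phi>0] and l = frobenius_lift_g_extension[OF p \<phi>]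
  have 1: "g_map ?L g_univ = ?A"
    by (simp add: g_map_comp H_comorphism_univ g_quadratic_bilinear g_valid_univ
        g_map_bilinear[OF frobenius_lift_hom[OF l]])
  have 2: "g_map ?R g_univ = ?B"
    by (rule g_map_comp)
  have "?L = ?R" if "?A = ?B"
    using that by (intro g_hom_eqI) (auto simp: 1 2 frobenius_lift_cst[OF l] frobenius_lift_cst[OF l0]
        H_comorphism_cst intro!: is_ring_hom_comp is_ring_hom_H_comorphism frobenius_lift_hom[OF l]
        frobenius_lift_hom[OF l0])
  moreover have "?A = ?B" if "?L = ?R"
    using that by (simp only: 1[symmetric] 2[symmetric])
  ultimately show ?thesis
    unfolding H_horizontal_def by blast
qed

section \<open>The lift attached to \<open>SL\<^sub>n\<close>\<close>

lemma g_extension_frob0: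
  assumes p: "\<not> base_prime TYPE('r::frobenius_dvr) dvd CARD('n::finite)"
  shows "map_matrix (g_extension (gl_frob0 :: ('n, 'r) gl_endo)) (fst g_univ) = ppow_mat (fst g_univ)"
  by (simp add: g_extension_univ[OF p frobenius_lift_gl_frob0] gl_frob0_univ
      map_matrix_ppow[OF is_ring_hom_g_projection] g_projection_gl_univ)

context
  fixes x :: "('n::finite, 'r::frobenius_dvr) g_mat" and t s0 w :: "('n, 'r) g_hat"
  assumes p: "\<not> base_prime TYPE('r) dvd CARD('n)"
  defines "x \<equiv> fst g_univ" and "t \<equiv> snd g_univ"
    and "s0 \<equiv> g_extension gl_frob0 (snd g_univ)" and "w \<equiv> g_projection gl_lambda"
begin

lemma coprime_card: "coprime CARD('n) (base_prime TYPE(('n, 'r) g_hat))"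
  using coprime_base_prime[OF p] by simp

lemma g_unit: "t dvd 1" "det x dvd 1"
  by (simp_all add: t_def x_def)

lemma w_lambda: "is_lambda x w"
  using is_lambda_hom[OF is_ring_hom_g_projection _ gl_lambda[OF p]]
  by (simp add: w_def x_def g_projection_gl_univ)

lemma s0_power: "s0 ^ CARD('n) = (det (ppow_mat x))\<^sup>2"
  and s0_cong: "of_nat (base_prime TYPE('r)) dvd s0 - t ^ base_prime TYPE('r)"
proof -
  note lift = frobenius_lift_g_extension[OF p frobenius_lift_gl_frob0]
  have "g_valid (g_map (g_extension gl_frob0) g_univ :: ('n, 'r) g_upoint)"
    by (rule g_valid_map[OF frobenius_lift_hom[OF lift] g_valid_univ])
  then show "s0 ^ CARD('n) = (det (ppow_mat x))\<^sup>2"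
    by (simp add: g_valid_def g_extension_frob0[OF p] s0_def x_def)
  show "of_nat (base_prime TYPE('r)) dvd s0 - t ^ base_prime TYPE('r)"
    unfolding s0_def t_def by (rule frobenius_lift_cong[OF lift])
qed

text \<open>Measures how far the extension of the standard lift is from
  \<open>t \<mapsto> t^p\<close>. Both sides have n-th power \<open>det(x)^(2p)\<close> and the same
  residue modulo p.\<close>

lemma w_square: "w\<^sup>2 * s0 = t ^ base_prime TYPE('r)"
proof (rule root_unique[OF coprime_card])
  let ?p = "base_prime TYPE('r)"
  show "t ^ ?p dvd 1"
    by (rule unit_power[OF g_unit(1)])
  have "of_nat ?p dvd w\<^sup>2 - 1\<^sup>2"
    using w_lambda by (intro dvd_diff_power) (simp add: is_lambda_def)
  from dvd_diff_mult[OF this s0_cong] show "pelt dvd w\<^sup>2 * s0 - t ^ ?p"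
    by simp
  have "(w\<^sup>2 * s0) ^ CARD('n) = (w ^ CARD('n) * det (ppow_mat x))\<^sup>2"
    by (simp add: power_mult_distrib s0_power mult.commute flip: power_mult)
  also have "\<dots> = (t ^ ?p) ^ CARD('n)"
    using w_lambda g_univ_power[where 'n = 'n and 'r = 'r] by (simp add: is_lambda_def x_def t_def)
  finally show "(w\<^sup>2 * s0) ^ CARD('n) = (t ^ ?p) ^ CARD('n)" .
qed

lemma ppow_scalar: "ppow_mat (smat t (mat 1)) = smat (t ^ base_prime TYPE('r)) (mat 1 :: ('n, 'r) g_mat)"
  by (auto simp: vec_eq_iff ppow_mat_def mat_def zero_power)

text \<open>The matrix part follows from \<open>x \<mapsto> t 1_n\<close>. The image of
  \<open>s0\<close> is known only by its n-th power and residue, which single out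
  \<open>t^(2p)\<close>.\<close>

lemma H_comorphism_frob0:
  "g_map H_comorphism (g_map (g_extension gl_frob0) g_univ)
    = (smat (t ^ base_prime TYPE('r)) (mat 1), (t ^ base_prime TYPE('r))\<^sup>2)"
proof -
  let ?p = "base_prime TYPE('r)"
  let ?H = "H_comorphism :: ('n, 'r) g_hat \<Rightarrow> ('n, 'r) g_hat"
  note H = is_ring_hom_H_comorphism[where 'n = 'n and 'r = 'r]
  have "g_map ?H g_univ = (smat t (mat 1), t\<^sup>2)"
    by (simp add: H_comorphism_univ g_quadratic_eq[OF g_valid_univ] t_def)
  then have Hx: "map_matrix ?H x = smat t (mat 1)" and Ht: "?H t = t\<^sup>2"
    by (simp_all add: prod_eq_iff x_def t_def)
  have Hppow: "map_matrix ?H (ppow_mat x) = smat (t ^ ?p) (mat 1)"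
    by (simp add: map_matrix_ppow[OF H] Hx ppow_scalar)
  have "?H s0 = (t ^ ?p)\<^sup>2"
  proof (rule root_unique[OF coprime_card])
    show "(t ^ ?p)\<^sup>2 dvd 1"
      by (intro unit_power g_unit)
    have "of_nat ?p dvd ?H s0 - ?H (t ^ ?p)"
      using is_ring_hom_dvd_diff[OF H, of ?p 1] s0_cong by simp
    then show "pelt dvd ?H s0 - (t ^ ?p)\<^sup>2"
      by (simp add: is_ring_hom_power[OF H] Ht mult.commute flip: power_mult)
    have "?H s0 ^ CARD('n) = ?H ((det (ppow_mat x))\<^sup>2)"
      by (simp add: s0_power flip: is_ring_hom_power[OF H])
    also have "\<dots> = (det (smat (t ^ ?p) (mat 1 :: ('n, 'r) g_mat)))\<^sup>2"
      by (simp add: is_ring_hom_simps[OF H] Hppow)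
    also have "\<dots> = ((t ^ ?p)\<^sup>2) ^ CARD('n)"
      by (simp add: det_smat ac_simps flip: power_mult)
    finally show "?H s0 ^ CARD('n) = ((t ^ ?p)\<^sup>2) ^ CARD('n)" .
  qed
  then show ?thesis
    using Hppow by (simp add: prod_eq_iff g_extension_frob0[OF p] x_def s0_def)
qed

context
  fixes \<phi> :: "('n, 'r) gl_endo"
  assumes \<phi>: "frobenius_lift \<phi>" and univ: "map_matrix \<phi> gl_univ = smat gl_lambda (ppow_mat gl_univ)"
begin

text \<open>The determinant of \<open>w x^(p)\<close> is \<open>det(x)^p\<close>, so
  \<open>t^p\<close> has exactly the n-th power required of the image of t.\<close>

lemma lambda_lift_extension: "g_map (g_extension \<phi>) g_univ = (smat w (ppow_mat x), t ^ base_prime TYPE('r))"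
proof -
  have mat: "map_matrix (g_extension \<phi>) (fst g_univ) = smat w (ppow_mat x)"
    by (simp add: g_extension_univ[OF p \<phi>] univ map_matrix_smat map_matrix_ppow
        is_ring_hom_g_projection g_projection_gl_univ w_def x_def)
  have "(t ^ base_prime TYPE('r)) ^ CARD('n) = (det (smat w (ppow_mat x)))\<^sup>2"
    using w_lambda g_univ_power[where 'n = 'n and 'r = 'r]
    by (simp add: det_smat is_lambda_def x_def t_def)
  then have "g_extension \<phi> (snd g_univ) = t ^ base_prime TYPE('r)"
    by (intro g_lift_scal[OF p frobenius_lift_g_extension[OF p \<phi>]]) (simp_all add: mat t_def)
  with mat show ?thesis
    by (simp add: prod_eq_iff)
qed

lemma lambda_lift_H_horizontal: "H_horizontal gl_frob0 \<phi>"
proof -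
  have "g_valid (g_map (g_extension \<phi>) g_univ :: ('n, 'r) g_upoint)"
    by (intro g_valid_map frobenius_lift_hom frobenius_lift_g_extension[OF p \<phi>] g_valid_univ)
  then show ?thesis
    by (simp add: H_horizontal_iff[OF p frobenius_lift_gl_frob0 \<phi>] H_comorphism_frob0
        lambda_lift_extension g_quadratic_eq)
qed

lemma lambda_lift_B_symmetric: "B_symmetric gl_frob0 \<phi>"
proof -
  let ?h = "g_map (g_extension gl_frob0) g_univ :: ('n, 'r) g_upoint"
  let ?g = "g_map (g_extension \<phi>) g_univ :: ('n, 'r) g_upoint"
  have valid: "g_valid ?h" "g_valid ?g"
    by (intro g_valid_map g_valid_univ frobenius_lift_hom frobenius_lift_g_extension[OF p]
        frobenius_lift_gl_frob0 \<phi>)+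
  have g0: "?h = (ppow_mat x, s0)"
    by (simp add: prod_eq_iff g_extension_frob0[OF p] x_def s0_def)
  have unit: "det (ppow_mat x) dvd 1" "w dvd 1"
    using unit_det_ppow[OF g_unit(2)] is_lambda_unit[OF w_lambda] by auto
  \<comment> \<open>The matrix parts of the two sides of symmetry are the scalars
    \<open>s0 * w\<close> and \<open>t^p / w\<close>.\<close>
  have "s0 * w = t ^ base_prime TYPE('r) * ring_inv w"
    unfolding w_square[symmetric] using ring_inv_right[OF unit(2)]
    by (simp add: power2_eq_square ac_simps)
  then show ?thesis
    unfolding B_symmetric_iff[OF p frobenius_lift_gl_frob0 \<phi>] g_bilinear_eq[OF valid(1)] g_bilinear_eq[OF valid(2)]
    by (simp add: g0 lambda_lift_extension matrix_inv_smat matrix_inv_left' unit mult.commute)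
qed

end

text \<open>Horizontality gives \<open>\<psi>(t) = t\<^sup>p\<close>. With \<open>W = (x\<^sup>(\<^sup>p\<^sup>))\<^sup>-\<^sup>1 \<psi>(x)\<close>, symmetry then says that \<open>W\<^sup>2\<close> is the
  scalar \<open>w\<^sup>2\<close>, whence \<open>W = w\<close> because \<open>W + w \<equiv> 2\<close> modulo \<open>p\<close> is invertible.\<close>

lemma H_horizontal_B_symmetric_unique:
  fixes \<psi> :: "('n, 'r) gl_endo"
  assumes \<psi>: "frobenius_lift \<psi>" and H: "H_horizontal gl_frob0 \<psi>" and B: "B_symmetric gl_frob0 \<psi>"
  shows "map_matrix \<psi> gl_univ = smat gl_lambda (ppow_mat gl_univ)"
proof -
  let ?p = "base_prime TYPE('r)"
  let ?h = "g_map (g_extension gl_frob0) g_univ :: ('n, 'r) g_upoint"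
  let ?g = "g_map (g_extension \<psi>) g_univ :: ('n, 'r) g_upoint"
  have valid: "g_valid ?h" "g_valid ?g"
    by (intro g_valid_map g_valid_univ frobenius_lift_hom frobenius_lift_g_extension[OF p]
        frobenius_lift_gl_frob0 \<psi>)+
  define X0 where "X0 = ppow_mat x"
  define X where "X = map_matrix (g_extension \<psi>) x"
  have g0: "?h = (X0, s0)"
    by (simp add: prod_eq_iff g_extension_frob0[OF p] x_def s0_def X0_def)
  have "g_quadratic ?g = (smat (t ^ ?p) (mat 1), (t ^ ?p)\<^sup>2)"
    using H by (simp add: H_horizontal_iff[OF p frobenius_lift_gl_frob0 \<psi>] H_comorphism_frob0)
  then have "smat (g_extension \<psi> (snd g_univ)) (mat 1) = smat (t ^ ?p) (mat 1 :: ('n, 'r) g_mat)"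
    by (simp add: g_quadratic_eq[OF valid(2)])
  then have "g_extension \<psi> (snd g_univ) = t ^ ?p"
    by (rule smat_mat_1_inject)
  then have g: "?g = (X, t ^ ?p)"
    by (simp add: prod_eq_iff X_def x_def)
  have unit0: "det X0 dvd 1"
    unfolding X0_def by (rule unit_det_ppow[OF g_unit(2)])
  have unit: "det X dvd 1"
    using valid(2) by (simp add: g g_valid_def)
  have s0: "s0 dvd 1"
    using valid(1) by (simp add: g0 g_valid_def)
  define W where "W = matrix_inv X0 ** X"
  have W: "W ** (matrix_inv X ** X0) = mat 1"
  proof -
    have "W ** (matrix_inv X ** X0) = matrix_inv X0 ** (X ** matrix_inv X) ** X0"
      by (simp add: W_def matrix_mul_assoc)
    then show ?thesis
      by (simp add: matrix_inv_right'[OF unit] matrix_inv_left'[OF unit0])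
  qed
  \<comment> \<open>The matrix parts of symmetry. The matrix on the right is the inverse of
    \<open>W\<close>, so multiplying by \<open>W\<close> yields its square.\<close>
  have "smat s0 W = smat (t ^ ?p) (matrix_inv X ** X0)"
    using B unfolding B_symmetric_iff[OF p frobenius_lift_gl_frob0 \<psi>] g_bilinear_eq[OF valid(1)] g_bilinear_eq[OF valid(2)]
    by (simp add: g0 g W_def)
  then have "smat s0 W = smat (w\<^sup>2 * s0) (matrix_inv X ** X0)"
    by (simp only: w_square)
  then have "smat (ring_inv s0) (smat s0 (W ** W)) = smat (ring_inv s0) (smat (w\<^sup>2 * s0) (W ** (matrix_inv X ** X0)))"
    by (metis smat_mult_right)
  also have "\<dots> = smat (ring_inv s0 * s0) (smat (w\<^sup>2) (mat 1))"
    by (simp add: W ac_simps)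
  finally have square: "W ** W = smat (w\<^sup>2) (mat 1)"
    by (simp add: ring_inv_left[OF s0])
  let ?w = "smat w (mat 1) :: ('n, 'r) g_mat"
  \<comment> \<open>The difference of squares factors because a scalar matrix commutes with
    \<open>W\<close>.\<close>
  have zero: "(W - ?w) ** (W + ?w) = 0"
  proof -
    have "(W - ?w) ** (W + ?w) = W ** W - smat (w\<^sup>2) (mat 1)"
      by (simp add: matrix_diff_rdistrib matrix_add_ldistrib smat_diff power2_eq_square)
    then show ?thesis
      by (simp add: square)
  qed
  have "X $ i $ j - X0 $ i $ j \<in> {z. of_nat ?p dvd z}" for i j
    using frobenius_lift_cong[OF frobenius_lift_g_extension[OF p \<psi>], of "x $ i $ j"]
    by (simp add: X_def X0_def ppow_mat_def)
  then have "W $ i $ j - (matrix_inv X0 ** X0) $ i $ j \<in> {z. of_nat ?p dvd z}" for i j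
    unfolding W_def matrix_matrix_mult_def
    by (simp, intro dvd_diff_sum dvd_diff_mult) auto
  then have W1: "of_nat ?p dvd W $ i $ j - (mat 1 :: ('n, 'r) g_mat) $ i $ j" for i j
    by (simp add: matrix_inv_left'[OF unit0])
  have w1: "of_nat ?p dvd w - 1"
    using w_lambda by (simp add: is_lambda_def)
  have "of_nat ?p dvd (W + ?w) $ i $ j - (smat 2 (mat 1) :: ('n, 'r) g_mat) $ i $ j" for i j
  proof -
    define e where "e = (mat 1 :: ('n, 'r) g_mat) $ i $ j"
    have "of_nat ?p dvd (W $ i $ j + w * e) - (e + 1 * e)"
      by (intro dvd_diff_add dvd_diff_mult) (use W1[of i j] w1 in \<open>simp_all add: e_def\<close>)
    moreover have "(smat 2 (mat 1) :: ('n, 'r) g_mat) $ i $ j = e + 1 * e"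
      by (simp add: e_def)
    ultimately show ?thesis
      by (simp only: vector_add_component smat_nth e_def)
  qed
  then have "det (W + ?w) - det (smat 2 (mat 1) :: ('n, 'r) g_mat) \<in> {z. of_nat ?p dvd z}"
    by (intro ideal_cong_det is_ideal_dvd) simp
  \<comment> \<open>Here p odd is essential: \<open>W + w\<close> reduces to 2 modulo p and must be
    invertible.\<close>
  moreover have "(2 :: ('n, 'r) g_hat) dvd 1"
    using unit_of_nat[of 2, where 'b = "('n, 'r) g_hat"] odd_base_prime[where 'a = 'r]
    by (simp add: coprime_left_2_iff_odd)
  then have "det (smat 2 (mat 1) :: ('n, 'r) g_mat) dvd 1"
    by (simp add: det_smat unit_power)
  ultimately have "det (W + ?w) dvd 1"
    using unit_cong_pelt[of "det (smat 2 (mat 1) :: ('n, 'r) g_mat)" "det (W + ?w)"] by simp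
  then have "(W - ?w) ** ((W + ?w) ** matrix_inv (W + ?w)) = W - ?w"
    by (simp add: matrix_inv_right')
  then have "0 ** matrix_inv (W + ?w) = W - ?w"
    by (simp only: matrix_mul_assoc zero)
  moreover have "0 ** matrix_inv (W + ?w) = 0"
    by (simp add: vec_eq_iff matrix_matrix_mult_def)
  ultimately have "W = ?w"
    by simp
  then have "X0 ** W = smat w X0"
    by simp
  moreover have "X0 ** W = X"
    by (simp add: W_def matrix_mul_assoc matrix_inv_right'[OF unit0])
  \<comment> \<open>The identity has been found on \<open>G\<close>; injectivity of the comorphism
    of the projection brings it back to \<open>GL_n\<close>.\<close>
  ultimately have "map_matrix g_projection (map_matrix \<psi> gl_univ)
      = map_matrix g_projection (smat gl_lambda (ppow_mat gl_univ))"
    by (simp add: X_def X0_def x_def w_def g_extension_univ[OF p \<psi>] map_matrix_smat map_matrix_ppow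
        is_ring_hom_g_projection g_projection_gl_univ)
  then show ?thesis
    by (simp add: vec_eq_iff) (metis inj_g_projection)
qed

end

section \<open>Values at points\<close>

lemma pdiv_pelt: "pdiv (pelt * a) = (a :: 'r::frobenius_dvr)"
  by (rule pdiv_eqI) (auto simp: pelt_nonzero)

lemma pelt_pdiv: "pelt dvd a \<Longrightarrow> pelt * pdiv a = (a :: 'r::frobenius_dvr)"
  by (auto simp: pdiv_pelt elim!: dvdE)

lemma pdiv_mat_pelt: "pdiv_mat (smat pelt A) = (A :: 'r::frobenius_dvr ^ 'n ^ 'm)"
  by (simp add: vec_eq_iff pdiv_mat_def pdiv_pelt)

lemma smat_pelt_cancel: "smat pelt A = smat pelt B \<longleftrightarrow> A = (B :: 'r::frobenius_dvr ^ 'n ^ 'm)"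
  by (simp add: vec_eq_iff pelt_nonzero)

lemma frob_mat_eq: "frob_mat A = ppow_mat A + smat pelt (delta_mat A)"
  by (simp add: vec_eq_iff frob_mat_def ppow_mat_def delta_mat_def pelt_pdiv frob_lift)

lemma is_lambda_at:
  fixes a :: "'r::frobenius_dvr ^ 'n::finite ^ 'n"
  assumes p: "\<not> base_prime TYPE('r) dvd CARD('n)" and a: "a \<in> GL"
  shows "is_lambda a (gl_lambda_at a)"
proof -
  have "is_ring_hom (point (gl_coords a))"
    using a by (intro is_ring_hom_point solves_gl_coords) (simp add: GL_iff)
  from is_lambda_hom[OF this _ gl_lambda[OF p]] show ?thesis
    by (simp add: point_gl_univ[OF a] gl_lambda_at_def)
qed

context
  fixes \<phi> :: "('n::finite, 'r::frobenius_dvr) gl_endo"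
  assumes p: "\<not> base_prime TYPE('r) dvd CARD('n)" and \<phi>: "frobenius_lift \<phi>"
    and univ: "map_matrix \<phi> gl_univ = smat gl_lambda (ppow_mat gl_univ)"
begin

context
  fixes a :: "'r ^ 'n ^ 'n"
  assumes a: "a \<in> GL"
begin

lemma hom_point: "is_ring_hom (point (gl_coords a))"
  using a by (intro is_ring_hom_point solves_gl_coords) (simp add: GL_iff)

lemma gl_value_eq: "gl_value \<phi> a = smat (gl_lambda_at a) (ppow_mat a)"
  by (simp add: gl_value_def univ map_matrix_smat[OF hom_point] map_matrix_ppow[OF hom_point]
      point_gl_univ[OF a] gl_lambda_at_def)

lemma unit_at:
  shows unit_lambda_at: "gl_lambda_at a dvd 1" and unit_ppow_at: "det (ppow_mat a) dvd 1"
    and unit_value: "det (gl_value \<phi> a) dvd 1"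
proof -
  show "gl_lambda_at a dvd 1" "det (ppow_mat a) dvd 1"
    using is_lambda_unit[OF is_lambda_at[OF p a]] unit_det_ppow a by (auto simp: GL_iff)
  then show "det (gl_value \<phi> a) dvd 1"
    by (simp add: gl_value_eq det_smat unit_mult unit_power)
qed

lemma lambda_at_cong: "pelt dvd gl_lambda_at a - 1" "pelt dvd ring_inv (gl_lambda_at a) - 1"
proof -
  show cong: "pelt dvd gl_lambda_at a - 1"
    using is_lambda_at[OF p a] by (simp add: is_lambda_def)
  have "ring_inv (gl_lambda_at a) - 1 = ring_inv (gl_lambda_at a) * (1 - gl_lambda_at a)"
    using ring_inv_left[OF unit_lambda_at] by (simp add: right_diff_distrib)
  with dvd_diff_sym[OF cong] show "pelt dvd ring_inv (gl_lambda_at a) - 1"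
    by simp
qed

text \<open>Split \<open>frob_mat a\<close> into \<open>a^(p)\<close> and p times
  \<open>delta_mat a\<close>: the first part contributes the inverse of \<lambda>, which differs
  from 1 by a multiple of p.\<close>

lemma pelt_log_derivative:
  "frob_mat a ** matrix_inv (gl_value \<phi> a) - mat 1 = smat pelt
    (delta_mat a ** matrix_inv (gl_value \<phi> a) + smat (pdiv (ring_inv (gl_lambda_at a) - 1)) (mat 1))"
proof -
  have "ppow_mat a ** matrix_inv (gl_value \<phi> a) = smat (ring_inv (gl_lambda_at a)) (mat 1)"
    by (simp add: gl_value_eq matrix_inv_smat unit_at matrix_inv_right')
  then have "frob_mat a ** matrix_inv (gl_value \<phi> a) - mat 1
      = smat (ring_inv (gl_lambda_at a) - 1) (mat 1) + smat pelt (delta_mat a ** matrix_inv (gl_value \<phi> a))"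
    by (simp add: frob_mat_eq matrix_add_rdistrib smat_diff_scalar)
  also have "smat (ring_inv (gl_lambda_at a) - 1) (mat 1 :: 'r ^ 'n ^ 'n)
      = smat pelt (smat (pdiv (ring_inv (gl_lambda_at a) - 1)) (mat 1))"
    by (simp add: pelt_pdiv lambda_at_cong)
  finally show ?thesis
    by (simp only: smat_add add.commute)
qed

lemma log_derivative_eq:
  "log_derivative \<phi> a =
    delta_mat a ** matrix_inv (gl_value \<phi> a) + smat (pdiv (ring_inv (gl_lambda_at a) - 1)) (mat 1)"
  unfolding log_derivative_def pelt_log_derivative by (rule pdiv_mat_pelt)

lemma log_derivative_iff:
  "log_derivative \<phi> a = \<alpha> \<longleftrightarrow> frob_mat a = (mat 1 + smat pelt \<alpha>) ** gl_value \<phi> a"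
proof -
  have "log_derivative \<phi> a = \<alpha> \<longleftrightarrow> frob_mat a ** matrix_inv (gl_value \<phi> a) - mat 1 = smat pelt \<alpha>"
    unfolding pelt_log_derivative log_derivative_eq smat_pelt_cancel ..
  also have "\<dots> \<longleftrightarrow> frob_mat a ** matrix_inv (gl_value \<phi> a) = mat 1 + smat pelt \<alpha>"
    by (simp add: algebra_simps)
  also have "\<dots> \<longleftrightarrow> frob_mat a = (mat 1 + smat pelt \<alpha>) ** gl_value \<phi> a"
  proof
    assume "frob_mat a ** matrix_inv (gl_value \<phi> a) = mat 1 + smat pelt \<alpha>"
    then have "(mat 1 + smat pelt \<alpha>) ** gl_value \<phi> a
        = frob_mat a ** (matrix_inv (gl_value \<phi> a) ** gl_value \<phi> a)"
      by (simp only: matrix_mul_assoc)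
    then show "frob_mat a = (mat 1 + smat pelt \<alpha>) ** gl_value \<phi> a"
      by (simp add: matrix_inv_left'[OF unit_value])
  next
    assume "frob_mat a = (mat 1 + smat pelt \<alpha>) ** gl_value \<phi> a"
    then have "frob_mat a ** matrix_inv (gl_value \<phi> a)
        = (mat 1 + smat pelt \<alpha>) ** (gl_value \<phi> a ** matrix_inv (gl_value \<phi> a))"
      by (simp only: matrix_mul_assoc)
    then show "frob_mat a ** matrix_inv (gl_value \<phi> a) = mat 1 + smat pelt \<alpha>"
      by (simp add: matrix_inv_right'[OF unit_value])
  qed
  finally show ?thesis .
qed

text \<open>The equation is compared after multiplication by p, where the quotient by p in the
  coefficient of the identity disappears.\<close>

lemma log_derivative_iff_delta:
  "log_derivative \<phi> a = \<alpha> \<longleftrightarrow>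
    delta_mat a = (smat (gl_lambda_at a) \<alpha> + smat (pdiv (gl_lambda_at a - 1)) (mat 1)) ** ppow_mat a"
proof -
  let ?R = "(smat (gl_lambda_at a) \<alpha> + smat (pdiv (gl_lambda_at a - 1)) (mat 1)) ** ppow_mat a"
  have "smat pelt ?R
      = smat (pelt * gl_lambda_at a) (\<alpha> ** ppow_mat a) + smat (pelt * pdiv (gl_lambda_at a - 1)) (ppow_mat a)"
    by (simp add: matrix_add_rdistrib smat_add)
  also have "\<dots> = (mat 1 + smat pelt \<alpha>) ** gl_value \<phi> a - ppow_mat a"
    by (simp add: pelt_pdiv lambda_at_cong gl_value_eq matrix_add_rdistrib smat_diff_scalar smat_add mult.commute)
  finally have "smat pelt ?R = (mat 1 + smat pelt \<alpha>) ** gl_value \<phi> a - ppow_mat a" .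
  then have "(mat 1 + smat pelt \<alpha>) ** gl_value \<phi> a = ppow_mat a + smat pelt ?R"
    by simp
  then show ?thesis
    unfolding log_derivative_iff frob_mat_eq by (simp only: add_left_cancel smat_pelt_cancel)
qed

lemma gl_point_map_eq: "gl_point_map \<psi> a = map_matrix (inv frob) (gl_value \<psi> a)"
  by (simp add: gl_point_map_def gl_value_def map_matrix_comp comp_assoc)

end

section \<open>Multiplicativity, the bracket, and the remaining statements at points\<close>

lemma GL_mult: "a \<in> GL \<Longrightarrow> b \<in> GL \<Longrightarrow> a ** b \<in> (GL :: ('r ^ 'n ^ 'n) set)"
  by (simp add: GL_iff det_mul unit_mult)

lemma gl_value_mult:
  assumes ab: "a \<in> GL" "b \<in> GL" and N: "a \<in> torus_normalizer \<or> b \<in> torus_normalizer"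
  shows "gl_value \<phi> (a ** b) = gl_value \<phi> a ** gl_value \<phi> b"
proof -
  have ppow: "ppow_mat (a ** b) = ppow_mat a ** ppow_mat b"
    using N by (intro ppow_mat_monomial_mult) (auto simp: torus_normalizer_iff)
  have "gl_lambda_at (a ** b) - gl_lambda_at a * gl_lambda_at b \<in> {0}"
    by (rule is_lambda_mult_mod[OF coprime_base_prime[OF p] is_ideal_zero, where X = a and Y = b])
      (use ab in \<open>simp_all add: ppow is_lambda_at[OF p] GL_mult GL_iff[symmetric]\<close>)
  then show ?thesis
    by (simp add: gl_value_eq ab GL_mult ppow mult.commute)
qed

text \<open>The map \<open>X \<mapsto> 1 + p X\<close> turns \<open>plus_delta\<close> into
  multiplication, so the identity becomes one between products, where \<open>gl_value_mult\<close>
  applies.\<close>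

lemma log_derivative_mult:
  assumes ab: "a \<in> GL" "b \<in> GL" and N: "a \<in> torus_normalizer \<or> b \<in> torus_normalizer"
  shows "log_derivative \<phi> (a ** b) =
    plus_delta (frob_mat a ** log_derivative \<phi> b ** matrix_inv (frob_mat a)) (log_derivative \<phi> a)"
proof -
  define F where "F = frob_mat a"
  define X where "X = F ** log_derivative \<phi> b ** matrix_inv F"
  define Y where "Y = log_derivative \<phi> a"
  have "det F = frob (det a)"
    by (simp add: F_def frob_mat_def is_ring_hom_det[OF frob_hom])
  then have F: "det F dvd 1"
    using ab(1) is_ring_hom_unit[OF frob_hom] by (simp add: GL_iff)
  have A: "F = (mat 1 + smat pelt Y) ** gl_value \<phi> a"
    unfolding F_def Y_def by (simp only: log_derivative_iff[OF ab(1), symmetric])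
  have B: "frob_mat b = (mat 1 + smat pelt (log_derivative \<phi> b)) ** gl_value \<phi> b"
    by (simp only: log_derivative_iff[OF ab(2), symmetric])
  have X: "mat 1 + smat pelt X = F ** (mat 1 + smat pelt (log_derivative \<phi> b)) ** matrix_inv F"
    by (simp add: X_def matrix_add_ldistrib matrix_add_rdistrib matrix_inv_right'[OF F])
  have "mat 1 + smat pelt (plus_delta X Y) = (mat 1 + smat pelt X) ** (mat 1 + smat pelt Y)"
    by (simp add: plus_delta_def matrix_add_ldistrib matrix_add_rdistrib smat_add algebra_simps)
  then have "(mat 1 + smat pelt (plus_delta X Y)) ** gl_value \<phi> (a ** b)
      = (mat 1 + smat pelt X) ** ((mat 1 + smat pelt Y) ** gl_value \<phi> a) ** gl_value \<phi> b"
    by (simp only: gl_value_mult[OF ab N] matrix_mul_assoc)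
  also have "\<dots> = F ** (mat 1 + smat pelt (log_derivative \<phi> b)) ** (matrix_inv F ** F) ** gl_value \<phi> b"
    by (simp only: A[symmetric] X matrix_mul_assoc)
  also have "\<dots> = F ** frob_mat b"
    by (simp add: matrix_inv_left'[OF F] B flip: matrix_mul_assoc)
  also have "\<dots> = frob_mat (a ** b)"
    by (simp add: F_def frob_mat_def map_matrix_mult[OF frob_hom])
  finally show ?thesis
    unfolding X_def Y_def F_def by (simp only: log_derivative_iff[OF GL_mult[OF ab]])
qed

lemma gl_bracket_eq:
  assumes ab: "a \<in> GL" "b \<in> GL"
  shows "gl_bracket \<phi> a b =
    pdiv_mat (smat (gl_lambda_at a * gl_lambda_at b * ring_inv (gl_lambda_at (a ** b)))
      (ppow_mat a ** ppow_mat b ** matrix_inv (ppow_mat (a ** b))) - mat 1)"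
  by (simp add: gl_bracket_def gl_value_eq ab GL_mult matrix_inv_smat unit_at ac_simps)

text \<open>Undoing the inverse of \<open>frob\<close>, the second hypothesis says
  \<open>det(a^(p)) = 1\<close>; together with \<open>det a = 1\<close> this forces \<lambda> to be
  1 at \<open>a\<close>.\<close>

lemma point_map_SL:
  assumes a: "a \<in> SL" and SL: "gl_point_map gl_frob0 a \<in> SL"
  shows "gl_point_map \<phi> a = gl_point_map gl_frob0 a"
proof -
  have GL: "a \<in> GL"
    using a by (simp add: SL_def GL_iff)
  have frob0: "gl_value gl_frob0 a = ppow_mat a"
    by (simp add: gl_value_def gl_frob0_univ map_matrix_ppow[OF hom_point[OF GL]] point_gl_univ[OF GL])
  have "inv frob (det (ppow_mat a)) = 1"
    using SL by (simp add: SL_def gl_point_map_eq[OF GL] frob0 flip: is_ring_hom_det[OF is_ring_hom_inv_frob])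
  then have "det (ppow_mat a) = 1"
    by (metis frob_inv_frob frob_one)
  then have "gl_lambda_at a - 1 \<in> {0}"
    using a GL by (intro is_lambda_one_mod[OF coprime_base_prime[OF p] is_ideal_zero _ is_lambda_at[OF p GL]])
      (simp_all add: SL_def)
  then show ?thesis
    by (simp add: gl_point_map_eq[OF GL] frob0 gl_value_eq[OF GL])
qed

text \<open>As \<epsilon> has determinant 1, the twist does not change the image of the determinant,
  which remains its p-th power.\<close>

lemma twisted_lift:
  assumes \<alpha>: "\<alpha> \<in> L_delta_SL" and \<epsilon>: "\<epsilon> = mat 1 + smat pelt \<alpha>"
  shows "\<exists>\<phi>\<alpha>. frobenius_lift \<phi>\<alpha> \<and>
    map_matrix \<phi>\<alpha> gl_univ = map_matrix cst \<epsilon> ** map_matrix \<phi> gl_univ \<and>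
    (\<forall>\<psi>. frobenius_lift \<psi> \<and>
      map_matrix \<psi> gl_univ = map_matrix cst \<epsilon> ** map_matrix \<phi> gl_univ \<longrightarrow> \<psi> = \<phi>\<alpha>) \<and>
    p_derivation \<phi>\<alpha> (det gl_univ) = 0"
proof -
  let ?p = "base_prime TYPE('r)"
  let ?x = "gl_univ :: ('n, 'r) gl_mat"
  define E where "E = (map_matrix cst \<epsilon> :: ('n, 'r) gl_mat)"
  define M where "M = E ** map_matrix \<phi> ?x"
  have c: "is_ring_hom (cst :: 'r \<Rightarrow> ('n, 'r) gl_hat)"
    by (rule is_ring_hom_cst)
  have "E $ i $ j = (mat 1 :: ('n, 'r) gl_mat) $ i $ j + of_nat ?p * cst (\<alpha> $ i $ j)" for i j
    by (simp add: E_def \<epsilon> mat_def is_ring_hom_simps[OF c])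
  then have E1: "of_nat ?p dvd E $ i $ j - (mat 1 :: ('n, 'r) gl_mat) $ i $ j" for i j
    by simp
  have "of_nat ?p dvd M $ i $ j - (mat 1 ** ppow_mat ?x) $ i $ j" for i j
    unfolding M_def matrix_matrix_mult_def vec_lambda_beta
    using frobenius_lift_cong[OF \<phi>]
    by (intro dvd_diff_sum dvd_diff_mult E1) (simp add: ppow_mat_def)
  then obtain \<phi>\<alpha> :: "('n, 'r) gl_endo" where \<phi>\<alpha>: "frobenius_lift \<phi>\<alpha>" "map_matrix \<phi>\<alpha> ?x = M"
    using gl_lift_exists[of M] by (auto simp: ppow_mat_def)
  have "det E = 1"
    using \<alpha> by (simp add: E_def \<epsilon> L_delta_SL_def is_ring_hom_1[OF c] flip: is_ring_hom_det[OF c])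
  moreover have "\<phi>\<alpha> (det ?x) = det E * \<phi> (det ?x)"
    by (simp add: is_ring_hom_det[OF frobenius_lift_hom[OF \<phi>\<alpha>(1)]] \<phi>\<alpha>(2) M_def det_mul
        is_ring_hom_det[OF frobenius_lift_hom[OF \<phi>]])
  ultimately have "\<phi>\<alpha> (det ?x) = det ?x ^ ?p"
    by (simp add: lambda_lift_det[OF p frobenius_lift_hom[OF \<phi>] univ])
  then have "p_derivation \<phi>\<alpha> (det ?x) = 0"
    unfolding p_derivation_def by (intro pdiv_eqI) (auto intro: gl_hat_cancel)
  with \<phi>\<alpha> show ?thesis
    unfolding M_def E_def by (intro exI[of _ \<phi>\<alpha>]) (auto intro: gl_lift_eqI)
qed

end

theorem proposition5p2:
  assumes "\<not> base_prime TYPE('r::frobenius_dvr) dvd CARD('n::finite)"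
  shows "\<exists>\<phi> :: ('n, 'r) gl_endo.
    \<comment> \<open>i)\<close>
    (frobenius_lift \<phi> \<and> H_horizontal gl_frob0 \<phi> \<and> B_symmetric gl_frob0 \<phi>) \<and>
    (\<forall>\<psi>. frobenius_lift \<psi> \<and> H_horizontal gl_frob0 \<psi> \<and> B_symmetric gl_frob0 \<psi> \<longrightarrow> \<psi> = \<phi>) \<and>
    map_matrix \<phi> gl_univ = smat gl_lambda (ppow_mat gl_univ) \<and>
    \<comment> \<open>ii)\<close>
    bicompatible \<phi> torus_normalizer \<and>
    \<comment> \<open>iii)\<close>
    (\<forall>a \<in> SL \<inter> {a \<in> GL. gl_point_map gl_frob0 a \<in> SL}.
       gl_point_map \<phi> a = gl_point_map gl_frob0 a) \<and>
    (\<forall>i j. i \<noteq> j \<longrightarrow>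
       horizontal \<phi> (gl_coords ` range (root_elem i j)) \<and>
       (\<exists>\<psi>. induced_lift (root_embedding i j) \<phi> \<psi> \<and>
         (\<forall>\<psi>'. induced_lift (root_embedding i j) \<phi> \<psi>' \<longrightarrow> \<psi>' = \<psi>) \<and>
         \<psi> (crd ()) = crd () ^ base_prime TYPE('r))) \<and>
    \<comment> \<open>iv)\<close>
    (\<forall>a \<in> GL. log_derivative \<phi> a =
       delta_mat a ** matrix_inv (smat (gl_lambda_at a) (ppow_mat a)) +
       smat (pdiv (ring_inv (gl_lambda_at a) - 1)) (mat 1)) \<and>
    (\<forall>a \<in> GL. \<forall>b \<in> GL. a \<in> torus_normalizer \<or> b \<in> torus_normalizer \<longrightarrow>
       log_derivative \<phi> (a ** b) =
       plus_delta (frob_mat a ** log_derivative \<phi> b ** matrix_inv (frob_mat a))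
         (log_derivative \<phi> a)) \<and>
    \<comment> \<open>v)\<close>
    (\<forall>a \<in> GL. \<forall>b \<in> GL. gl_bracket \<phi> a b =
       pdiv_mat (smat (gl_lambda_at a * gl_lambda_at b * ring_inv (gl_lambda_at (a ** b)))
         (ppow_mat a ** ppow_mat b ** matrix_inv (ppow_mat (a ** b))) - mat 1)) \<and>
    \<comment> \<open>vi)\<close>
    (\<forall>\<alpha> \<epsilon>. \<epsilon> = mat 1 + smat pelt \<alpha> \<longrightarrow>
       (\<forall>u \<in> GL.
         (log_derivative \<phi> u = \<alpha> \<longleftrightarrow>
           delta_mat u = (smat (gl_lambda_at u) \<alpha> + smat (pdiv (gl_lambda_at u - 1)) (mat 1)) **
             ppow_mat u) \<and>
         (log_derivative \<phi> u = \<alpha> \<longleftrightarrow>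
           frob_mat u = \<epsilon> ** smat (gl_lambda_at u) (ppow_mat u)))) \<and>
    \<comment> \<open>vii)\<close>
    (\<forall>\<alpha> \<in> L_delta_SL. \<forall>\<epsilon>. \<epsilon> = mat 1 + smat pelt \<alpha> \<longrightarrow>
       (\<exists>\<phi>\<alpha>. frobenius_lift \<phi>\<alpha> \<and>
         map_matrix \<phi>\<alpha> gl_univ = map_matrix cst \<epsilon> ** map_matrix \<phi> gl_univ \<and>
         (\<forall>\<psi>. frobenius_lift \<psi> \<and>
           map_matrix \<psi> gl_univ = map_matrix cst \<epsilon> ** map_matrix \<phi> gl_univ \<longrightarrow> \<psi> = \<phi>\<alpha>) \<and>
         p_derivation \<phi>\<alpha> (det gl_univ) = 0))"
proof -
  let ?x = "gl_univ :: ('n, 'r) gl_mat"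
  note p = assms
  have "of_nat (base_prime TYPE('r)) dvd smat gl_lambda (ppow_mat ?x) $ i $ j - ?x $ i $ j ^ base_prime TYPE('r)" for i j
  proof -
    have "of_nat (base_prime TYPE('r)) dvd (gl_lambda - 1) * ?x $ i $ j ^ base_prime TYPE('r)"
      using gl_lambda[OF p] by (intro dvd_mult2) (simp add: is_lambda_def)
    then show ?thesis
      by (simp add: ppow_mat_def left_diff_distrib)
  qed
  then obtain \<phi> :: "('n, 'r) gl_endo" where \<phi>: "frobenius_lift \<phi>"
    and univ: "map_matrix \<phi> gl_univ = smat gl_lambda (ppow_mat gl_univ)"
    by (rule gl_lift_exists)
  note lift = p \<phi> univ
  have unique: "\<psi> = \<phi>"
    if "frobenius_lift \<psi> \<and> H_horizontal gl_frob0 \<psi> \<and> B_symmetric gl_frob0 \<psi>" for \<psi>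
    using that H_horizontal_B_symmetric_unique[OF p, of \<psi>] by (intro gl_lift_eqI \<phi>) (simp_all add: univ)
  show ?thesis
  proof (rule exI[of _ \<phi>], intro conjI allI ballI impI, goal_cases)
    case (4 \<psi>)
    then show ?case
      by (rule unique)
  next
    case (7 a)
    then show ?case
      using point_map_SL[OF lift, of a] by blast
  next
    case (10 a)
    then show ?case
      using log_derivative_eq[OF lift, of a] by (simp add: gl_value_eq[OF lift])
  next
    case (14 \<alpha> \<epsilon> u)
    then show ?case
      using log_derivative_iff[OF lift, of u] by (simp add: gl_value_eq[OF lift])
  qed (rule \<phi> univ lambda_lift_H_horizontal[OF lift] lambda_lift_B_symmetric[OF lift]
      lambda_lift_bicompatible[OF lift] lambda_lift_root_horizontal[OF lift]
      lambda_lift_root_induced[OF lift] log_derivative_mult[OF lift] gl_bracket_eq[OF lift]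
      log_derivative_iff_delta[OF lift] twisted_lift[OF lift]; assumption)+
qed

end
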